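(* Let $n\ge 1$ and let $f$ and $g$ be regular positive $n$-free polynomials, with $f$ aspherical. If $\Phi:\mathcal{A}(\mathcal{D}_f)\to\mathcal{A}(\mathcal{D}_g)$ is an isomorphism (i.e. a completely isometric unital algebra isomorphism), then $\widehat{\Phi}(0)=0$, and therefore there exists a matrix $M=[m_{ij}]\in M_{n\times n}(\mathbb{C})$ such that $$\Phi(W_i^f)=\sum_{j=1}^n m_{ij}W_j^g\qquad (i=1,\ldots,n).$$
   Context: Let $\mathbb{F}_n^+$ be the free semigroup (monoid) on generators $g_1,\ldots,g_n$ with identity $g_0$; $|\alpha|$ is the length of the word $\alpha$ (with $|g_0|=0$). For $\alpha=g_{i_1}\cdots g_{i_k}$ and elements $X_1,\ldots,X_n$ of a unital ring, $X_\alpha=X_{i_1}\cdots X_{i_k}$, and $X_{g_0}=1$. An $n$-free formal power series is a formal power series $f=\sum_{\alpha\in\mathbb{F}_n^+}a_\alpha X_\alpha$ in $n$ noncommuting indeterminates; it is an $n$-free polynomial if only finitely many $a_\alpha$ are nonzero. It is regular positive if the $a_\alpha$ are real, $a_{g_0}=0$, $a_{g_i}>0$ for $i=1,\ldots,n$, $a_\alpha\ge 0$ for all $\alpha$, and $\sup_{k\ge 1}\left|\sum_{|\alpha|=k}a_\alpha^2\right|^{1/k}<\infty$ (automatic for polynomials). For a Hilbert space $\mathcal{H}$, $\mathcal{D}_f(\mathcal{H})=\{(T_1,\ldots,T_n)\in\mathcal{B}(\mathcal{H})^n:\sum_\alpha a_\alpha T_\alpha T_\alpha^*\le 1\}$.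 The interior of $\mathcal{D}_f(\mathbb{C}^k)$ in $(M_{k\times k}(\mathbb{C}))^n$ is denoted $\mathbb{D}_f^k$; in particular $\mathbb{D}_f^1\subseteq\mathbb{C}^n$. Two regular positive $n$-free power series $f,g$ are permutation-rescaling equivalent if there are a permutation $\sigma$ of $\{1,\ldots,n\}$ and positive real numbers $\lambda_1,\ldots,\lambda_n$ with $g(\lambda_1X_{\sigma(1)},\ldots,\lambda_nX_{\sigma(n)})=f(X_1,\ldots,X_n)$. The series $f$ is spherical if it is permutation-rescaling equivalent to some regular positive $g$ with $\mathbb{D}_g^1=\{z\in\mathbb{C}^n:|z_1|^2+\cdots+|z_n|^2<1\}$, and aspherical if it is not spherical. Set $b^f_{g_0}=1$ and, for $|\alpha|\ge 1$, $b^f_\alpha=\sum_{j=1}^{|\alpha|}\ \sum_{\gamma_1\cdots\gamma_j=\alpha,\ |\gamma_i|\ge 1}a_{\gamma_1}\cdots a_{\gamma_j}$. Let $(\delta_\alpha)_{\alpha\in\mathbb{F}_n^+}$ be the canonical basis of $\ell^2(\mathbb{F}_n^+)$ and define bounded operators $W_i^f$ on $\ell^2(\mathbb{F}_n^+)$ by $W_i^f\delta_\alpha=\sqrt{b^f_\alpha/b^f_{g_i\alpha}}\;\delta_{g_i\alpha}$. The noncommutative domain algebra $\mathcal{A}(\mathcal{D}_f)$ is the norm closure in $\mathcal{B}(\ell^2(\mathbb{F}_n^+))$ of the span of $\{W^f_\alpha:\alpha\in\mathbb{F}_n^+\}$. Isomorphisms between noncommutative domain algebras are completely isometric unital algebra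 isomorphisms. It is known (Popescu) that for every $(T_1,\ldots,T_n)\in\mathcal{D}_f(\mathcal{H})$ there is a unique completely contractive unital algebra morphism $\mathcal{A}(\mathcal{D}_f)\to\mathcal{B}(\mathcal{H})$ sending $W_j^f$ to $T_j$ for all $j$. For an isomorphism $\Phi:\mathcal{A}(\mathcal{D}_f)\to\mathcal{A}(\mathcal{D}_g)$, the map $\widehat{\Phi}:\mathbb{D}_g^1\to\mathbb{D}_f^1$ is defined by $\widehat{\Phi}(\lambda)=(\pi_\lambda(\Phi(W_1^f)),\ldots,\pi_\lambda(\Phi(W_n^f)))$, where for $\lambda\in\mathbb{D}_g^1$, $\pi_\lambda:\mathcal{A}(\mathcal{D}_g)\to\mathbb{C}$ is the unique completely contractive unital morphism with $\pi_\lambda(W_j^g)=\lambda_j$ for all $j$. *)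

theory Defs
  imports "HOL-Analysis.Analysis"
begin

section \<open>The complex Hilbert space of square-summable families\<close>

lemma square_summable_add:
  fixes x y :: "'a \<Rightarrow> complex"
  assumes "(\<lambda>i. (cmod (x i))\<^sup>2) summable_on UNIV" "(\<lambda>i. (cmod (y i))\<^sup>2) summable_on UNIV"
  shows "(\<lambda>i. (cmod (x i + y i))\<^sup>2) summable_on UNIV"
proof (rule summable_on_comparison_test)
  show "(\<lambda>i. 2 * (cmod (x i))\<^sup>2 + 2 * (cmod (y i))\<^sup>2) summable_on UNIV"
    by (intro summable_on_add summable_on_cmult_right assms)
next
  fix i
  have "(cmod (x i + y i))\<^sup>2 \<le> (cmod (x i) + cmod (y i))\<^sup>2"
    by (intro power_mono norm_triangle_ineq) simp
  also have "\<dots> \<le> 2 * (cmod (x i))\<^sup>2 + 2 * (cmod (y i))\<^sup>2"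
    using sum_squares_bound[of "cmod (x i)" "cmod (y i)"]
    by (simp add: power2_sum)
  finally show "(cmod (x i + y i))\<^sup>2 \<le> 2 * (cmod (x i))\<^sup>2 + 2 * (cmod (y i))\<^sup>2" .
qed simp

lemma square_summable_scale:
  fixes x :: "'a \<Rightarrow> complex"
  assumes "(\<lambda>i. (cmod (x i))\<^sup>2) summable_on UNIV"
  shows "(\<lambda>i. (cmod (c * x i))\<^sup>2) summable_on UNIV"
  using summable_on_cmult_right[OF assms, of "(cmod c)\<^sup>2"]
  by (simp add: norm_mult power_mult_distrib)

lemma square_summable_inner:
  fixes x y :: "'a \<Rightarrow> complex"
  assumes "(\<lambda>i. (cmod (x i))\<^sup>2) summable_on UNIV" "(\<lambda>i. (cmod (y i))\<^sup>2) summable_on UNIV"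
  shows "(\<lambda>i. x i \<bullet> y i) summable_on UNIV"
proof -
  have "(\<lambda>i. norm (x i \<bullet> y i)) summable_on UNIV"
  proof (rule Infinite_Sum.abs_summable_on_comparison_test')
    show "(\<lambda>i. (cmod (x i))\<^sup>2 + (cmod (y i))\<^sup>2) summable_on UNIV"
      by (intro summable_on_add assms)
    fix i
    have "norm (x i \<bullet> y i) \<le> cmod (x i) * cmod (y i)"
      using Cauchy_Schwarz_ineq2[of "x i" "y i"] by simp
    also have "\<dots> \<le> 2 * cmod (x i) * cmod (y i)"
      by simp
    also have "\<dots> \<le> (cmod (x i))\<^sup>2 + (cmod (y i))\<^sup>2"
      by (rule sum_squares_bound)
    finally show "norm (x i \<bullet> y i) \<le> (cmod (x i))\<^sup>2 + (cmod (y i))\<^sup>2" .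
  qed
  then show ?thesis by (rule Infinite_Sum.abs_summable_summable)
qed

typedef 'a ell2 = "{x :: 'a \<Rightarrow> complex. (\<lambda>i. (cmod (x i))\<^sup>2) summable_on UNIV}"
  morphisms ell2_coord Abs_ell2
  by (rule exI[of _ "\<lambda>_. 0"]) simp

setup_lifting type_definition_ell2

lemma ell2_coord_summable: "(\<lambda>i. (cmod (ell2_coord x i))\<^sup>2) summable_on UNIV"
  using ell2_coord[of x] by simp

instantiation ell2 :: (type) real_vector
begin

lift_definition zero_ell2 :: "'a ell2" is "\<lambda>_. 0" by simp
lift_definition plus_ell2 :: "'a ell2 \<Rightarrow> 'a ell2 \<Rightarrow> 'a ell2" is "\<lambda>x y i. x i + y i"
  by (rule square_summable_add)
lift_definition uminus_ell2 :: "'a ell2 \<Rightarrow> 'a ell2" is "\<lambda>x i. - x i" by simp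
lift_definition minus_ell2 :: "'a ell2 \<Rightarrow> 'a ell2 \<Rightarrow> 'a ell2" is "\<lambda>x y i. x i - y i"
  subgoal for x y using square_summable_add[of x "\<lambda>i. - y i"] by simp
  done
lift_definition scaleR_ell2 :: "real \<Rightarrow> 'a ell2 \<Rightarrow> 'a ell2" is "\<lambda>r x i. of_real r * x i"
  by (rule square_summable_scale)

instance
proof
  fix x y z :: "'a ell2" and r s :: real
  show "x + y + z = x + (y + z)" by transfer (simp add: add.assoc)
  show "x + y = y + x" by transfer (simp add: add.commute)
  show "0 + x = x" by transfer simp
  show "- x + x = 0" by transfer simp
  show "x - y = x + - y" by transfer simp
  show "r *\<^sub>R (x + y) = r *\<^sub>R x + r *\<^sub>R y" by transfer (simp add: distrib_left)
  show "(r + s) *\<^sub>R x = r *\<^sub>R x + s *\<^sub>R x" by transfer (simp add: distrib_right)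
  show "r *\<^sub>R s *\<^sub>R x = (r * s) *\<^sub>R x" by transfer (simp add: mult.assoc)
  show "1 *\<^sub>R x = x" by transfer simp
qed

end

text \<open>The real inner product below is the real part of the usual complex one; it induces
  the usual Hilbert space norm, see \<open>norm_ell2_eq\<close>.\<close>

instantiation ell2 :: (type) real_inner
begin

lift_definition inner_ell2 :: "'a ell2 \<Rightarrow> 'a ell2 \<Rightarrow> real"
  is "\<lambda>x y. \<Sum>\<^sub>\<infinity>i. x i \<bullet> y i" .

definition norm_ell2 :: "'a ell2 \<Rightarrow> real" where "norm_ell2 x = sqrt (x \<bullet> x)"
definition dist_ell2 :: "'a ell2 \<Rightarrow> 'a ell2 \<Rightarrow> real" where "dist_ell2 x y = norm (x - y)"
definition sgn_ell2 :: "'a ell2 \<Rightarrow> 'a ell2" where "sgn_ell2 x = scaleR (inverse (norm x)) x"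
definition uniformity_ell2 :: "('a ell2 \<times> 'a ell2) filter"
  where "uniformity_ell2 = (INF e\<in>{0 <..}. principal {(x, y). dist x y < e})"
definition open_ell2 :: "'a ell2 set \<Rightarrow> bool"
  where "open_ell2 U \<longleftrightarrow> (\<forall>x\<in>U. \<forall>\<^sub>F (x', y) in uniformity. x' = x \<longrightarrow> y \<in> U)"

instance
proof
  fix x y z :: "'a ell2" and r :: real
  show "dist x y = norm (x - y)" by (rule dist_ell2_def)
  show "sgn x = x /\<^sub>R norm x" by (rule sgn_ell2_def)
  show "uniformity = (INF e\<in>{0 <..}. principal {(x :: 'a ell2, y). dist x y < e})"
    by (rule uniformity_ell2_def)
  show "open U \<longleftrightarrow> (\<forall>x\<in>U. \<forall>\<^sub>F (x', y) in uniformity. x' = x \<longrightarrow> y \<in> U)" for U :: "'a ell2 set"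
    by (rule open_ell2_def)
  show "x \<bullet> y = y \<bullet> x" by transfer (simp add: inner_commute)
  show "(x + y) \<bullet> z = x \<bullet> z + y \<bullet> z"
    by transfer (simp add: inner_add_left infsum_add square_summable_inner)
  show "(r *\<^sub>R x) \<bullet> y = r * (x \<bullet> y)"
  proof transfer
    fix r :: real and x y :: "'a \<Rightarrow> complex"
    have "(\<Sum>\<^sub>\<infinity>i. (of_real r * x i) \<bullet> y i) = (\<Sum>\<^sub>\<infinity>i. r * (x i \<bullet> y i))"
      by (simp flip: scaleR_conv_of_real)
    then show "(\<Sum>\<^sub>\<infinity>i. (of_real r * x i) \<bullet> y i) = r * (\<Sum>\<^sub>\<infinity>i. x i \<bullet> y i)"
      by (simp add: infsum_cmult_right')
  qed
  show "0 \<le> x \<bullet> x" by transfer (simp add: infsum_nonneg)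
  show "x \<bullet> x = 0 \<longleftrightarrow> x = 0"
  proof transfer
    fix x :: "'a \<Rightarrow> complex"
    assume x: "(\<lambda>i. (cmod (x i))\<^sup>2) summable_on UNIV"
    show "(\<Sum>\<^sub>\<infinity>i. x i \<bullet> x i) = 0 \<longleftrightarrow> x = (\<lambda>_. 0)"
    proof
      assume "(\<Sum>\<^sub>\<infinity>i. x i \<bullet> x i) = 0"
      then have "x i \<bullet> x i = 0" for i
        using nonneg_infsum_le_0D[of "\<lambda>i. x i \<bullet> x i" UNIV i] x
        by (simp add: square_summable_inner)
      then show "x = (\<lambda>_. 0)" by auto
    qed simp
  qed
  show "norm x = sqrt (x \<bullet> x)" by (rule norm_ell2_def)
qed

end

lemma norm_ell2_eq: "norm x = sqrt (\<Sum>\<^sub>\<infinity>i. (cmod (ell2_coord x i))\<^sup>2)"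
  unfolding norm_eq_sqrt_inner by (simp add: inner_ell2.rep_eq power2_norm_eq_inner)

lift_definition ell2_basis :: "'a \<Rightarrow> 'a ell2" is "\<lambda>a i. if i = a then 1 else 0"
proof -
  fix a :: 'a
  have "(\<lambda>i. (cmod (if i = a then 1 else 0))\<^sup>2) summable_on {a}" by simp
  then show "(\<lambda>i. (cmod (if i = a then 1 else 0))\<^sup>2) summable_on UNIV"
    by (rule summable_on_cong_neutral[THEN iffD1, rotated -1]) auto
qed

lift_definition scaleC_ell2 :: "complex \<Rightarrow> 'a ell2 \<Rightarrow> 'a ell2" is "\<lambda>c x i. c * x i"
  by (rule square_summable_scale)

lemma norm_scaleC_ell2: "norm (scaleC_ell2 c x) = cmod c * norm x"
  by (simp add: norm_ell2_eq scaleC_ell2.rep_eq norm_mult power_mult_distrib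
      infsum_cmult_right' real_sqrt_mult)


section \<open>Operators and matrices of operators\<close>

type_synonym 'a op = "'a ell2 \<Rightarrow>\<^sub>L 'a ell2"

lift_definition scalar_op :: "complex \<Rightarrow> 'a op" is scaleC_ell2
proof (rule bounded_linear_intro)
  fix c :: complex and x y :: "'a ell2" and r :: real
  show "scaleC_ell2 c (x + y) = scaleC_ell2 c x + scaleC_ell2 c y"
    by transfer (simp add: distrib_left)
  show "scaleC_ell2 c (r *\<^sub>R x) = r *\<^sub>R scaleC_ell2 c x"
    by transfer (simp add: mult.left_commute)
  show "norm (scaleC_ell2 c x) \<le> norm x * cmod c"
    by (simp add: norm_scaleC_ell2)
qed

text \<open>The library's \<open>\<Rightarrow>\<^sub>L\<close> consists of real-linear maps, hence the scalar
  multiplication by complex numbers has to be added.\<close>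

definition scaleC_op :: "complex \<Rightarrow> 'a op \<Rightarrow> 'a op" where
  "scaleC_op c T = scalar_op c o\<^sub>L T"

text \<open>The norm of the \<open>m \<times> m\<close> operator matrix \<open>[A i j]\<close> (indices below \<open>m\<close>), acting on the
  Hilbert space direct sum of \<open>m\<close> copies of the underlying space.\<close>

definition op_matrix_norm ::
    "nat \<Rightarrow> (nat \<Rightarrow> nat \<Rightarrow> 'h::real_normed_vector \<Rightarrow>\<^sub>L 'h) \<Rightarrow> real" where
  "op_matrix_norm m A =
     Sup {sqrt (\<Sum>i<m. (norm (\<Sum>j<m. A i j (x j)))\<^sup>2) | x :: nat \<Rightarrow> 'h. (\<Sum>j<m. (norm (x j))\<^sup>2) \<le> 1}"

text \<open>Completely contractive unital algebra morphisms into the complex numbers; a scalar matrix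
  \<open>[c i j]\<close> is normed as an operator on \<open>\<complex>\<^sup>m\<close>, where a scalar acts on \<open>\<complex>\<close> by multiplication.\<close>

definition cc_character :: "'a op set \<Rightarrow> ('a op \<Rightarrow> complex) \<Rightarrow> bool" where
  "cc_character A \<pi> \<longleftrightarrow>
     \<pi> id_blinfun = 1 \<and>
     (\<forall>S\<in>A. \<forall>T\<in>A. \<pi> (S + T) = \<pi> S + \<pi> T \<and> \<pi> (S o\<^sub>L T) = \<pi> S * \<pi> T) \<and>
     (\<forall>c. \<forall>T\<in>A. \<pi> (scaleC_op c T) = c * \<pi> T) \<and>
     (\<forall>m\<ge>1. \<forall>X. (\<forall>i<m. \<forall>j<m. X i j \<in> A) \<longrightarrow>
        op_matrix_norm m (\<lambda>i j. blinfun_mult_right (\<pi> (X i j))) \<le> op_matrix_norm m X)"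

definition ci_isomorphism :: "'a op set \<Rightarrow> 'b op set \<Rightarrow> ('a op \<Rightarrow> 'b op) \<Rightarrow> bool" where
  "ci_isomorphism A B \<Phi> \<longleftrightarrow>
     bij_betw \<Phi> A B \<and>
     \<Phi> id_blinfun = id_blinfun \<and>
     (\<forall>S\<in>A. \<forall>T\<in>A. \<Phi> (S + T) = \<Phi> S + \<Phi> T \<and> \<Phi> (S o\<^sub>L T) = \<Phi> S o\<^sub>L \<Phi> T) \<and>
     (\<forall>c. \<forall>T\<in>A. \<Phi> (scaleC_op c T) = scaleC_op c (\<Phi> T)) \<and>
     (\<forall>m\<ge>1. \<forall>X. (\<forall>i<m. \<forall>j<m. X i j \<in> A) \<longrightarrow>
        op_matrix_norm m (\<lambda>i j. \<Phi> (X i j)) = op_matrix_norm m X)"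


section \<open>Free power series\<close>

text \<open>A word in the free monoid on generators indexed by the finite type \<open>'n\<close> is a list, and a
  series with real coefficients is its coefficient function. The number of generators is
  \<open>CARD('n)\<close>, which is arbitrary and at least 1.\<close>

type_synonym 'n series = "'n list \<Rightarrow> real"

definition regular_positive :: "'n::finite series \<Rightarrow> bool" where
  "regular_positive f \<longleftrightarrow>
     f [] = 0 \<and> (\<forall>i. f [i] > 0) \<and> (\<forall>\<alpha>. f \<alpha> \<ge> 0) \<and>
     bdd_above ((\<lambda>k. root k \<bar>\<Sum>\<alpha> | length \<alpha> = k. (f \<alpha>)\<^sup>2\<bar>) ` {1..})"

definition free_polynomial :: "'n series \<Rightarrow> bool" where
  "free_polynomial f \<longleftrightarrow> finite {\<alpha>. f \<alpha> \<noteq> 0}"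

text \<open>Coefficients of \<open>g(r\<^sub>1 X\<^bsub>\<sigma>(1)\<^esub>, \<dots>, r\<^sub>n X\<^bsub>\<sigma>(n)\<^esub>)\<close>: the word \<open>\<alpha>\<close> becomes the word
  \<open>map \<sigma> \<alpha>\<close> times the product of the \<open>r\<close>s along \<open>\<alpha>\<close>.\<close>

definition rescale_permute :: "('n \<Rightarrow> 'n) \<Rightarrow> ('n \<Rightarrow> real) \<Rightarrow> 'n series \<Rightarrow> 'n series" where
  "rescale_permute \<sigma> r g = (\<lambda>\<beta>. \<Sum>\<alpha> | map \<sigma> \<alpha> = \<beta>. prod_list (map r \<alpha>) * g \<alpha>)"

definition perm_rescale_equiv :: "'n series \<Rightarrow> 'n series \<Rightarrow> bool" where
  "perm_rescale_equiv f g \<longleftrightarrow>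
     (\<exists>\<sigma> r. bij \<sigma> \<and> (\<forall>i. r i > 0) \<and> rescale_permute \<sigma> r g = f)"

text \<open>The interior of the scalar points \<open>z\<close> with \<open>\<Sum> f \<alpha> z\<^sub>\<alpha> (z\<^sub>\<alpha>)\<^sup>* \<le> 1\<close>.\<close>

definition scalar_domain :: "'n::finite series \<Rightarrow> (complex ^ 'n) set" where
  "scalar_domain f = interior {z.
     (\<lambda>\<alpha>. f \<alpha> * (cmod (prod_list (map (($) z) \<alpha>)))\<^sup>2) summable_on UNIV \<and>
     (\<Sum>\<^sub>\<infinity>\<alpha>. f \<alpha> * (cmod (prod_list (map (($) z) \<alpha>)))\<^sup>2) \<le> 1}"

definition spherical :: "'n::finite series \<Rightarrow> bool" where
  "spherical f \<longleftrightarrow>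
     (\<exists>g. regular_positive g \<and> perm_rescale_equiv f g \<and>
          scalar_domain g = {z. (\<Sum>i\<in>UNIV. (cmod (z $ i))\<^sup>2) < 1})"

abbreviation aspherical :: "'n::finite series \<Rightarrow> bool" where
  "aspherical f \<equiv> \<not> spherical f"


section \<open>Noncommutative domain algebras\<close>

definition factorizations :: "'n list \<Rightarrow> nat \<Rightarrow> 'n list list set" where
  "factorizations \<alpha> j = {\<gamma>s. length \<gamma>s = j \<and> concat \<gamma>s = \<alpha> \<and> (\<forall>\<gamma>\<in>set \<gamma>s. length \<gamma> \<ge> 1)}"

definition weight :: "'n series \<Rightarrow> 'n series" where
  "weight f \<alpha> =
     (if \<alpha> = [] then 1
      else \<Sum>j = 1..length \<alpha>. \<Sum>\<gamma>s\<in>factorizations \<alpha> j. prod_list (map f \<gamma>s))"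

definition weighted_shift_coord ::
    "'n series \<Rightarrow> 'n \<Rightarrow> ('n list \<Rightarrow> complex) \<Rightarrow> 'n list \<Rightarrow> complex" where
  "weighted_shift_coord f i x \<beta> =
     (case \<beta> of [] \<Rightarrow> 0
      | j # \<alpha> \<Rightarrow> if j = i then of_real (sqrt (weight f \<alpha> / weight f (i # \<alpha>))) * x \<alpha> else 0)"

text \<open>\<open>Blinfun\<close> is only meaningful on bounded linear maps. For regular positive \<open>f\<close>, the map is
  bounded and the operator is characterised on the canonical basis by \<open>weighted_shift_basis\<close>.\<close>

definition weighted_shift :: "'n series \<Rightarrow> 'n \<Rightarrow> 'n list op" where
  "weighted_shift f i = Blinfun (\<lambda>x. Abs_ell2 (weighted_shift_coord f i (ell2_coord x)))"

definition weighted_shift_word :: "'n series \<Rightarrow> 'n list \<Rightarrow> 'n list op" where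
  "weighted_shift_word f \<alpha> = foldr (\<lambda>i T. weighted_shift f i o\<^sub>L T) \<alpha> id_blinfun"

definition domain_algebra :: "'n series \<Rightarrow> 'n list op set" where
  "domain_algebra f =
     closure {\<Sum>\<alpha>\<in>F. scaleC_op (c \<alpha>) (weighted_shift_word f \<alpha>) | F c. finite F}"

text \<open>The morphism \<open>\<pi>\<^sub>z\<close>; \<open>extensional\<close> fixes its irrelevant values outside the algebra, so that
  uniqueness on the algebra is uniqueness as a HOL function.\<close>

definition point_eval :: "'n::finite series \<Rightarrow> complex ^ 'n \<Rightarrow> 'n list op \<Rightarrow> complex" where
  "point_eval g z = (THE \<pi>. \<pi> \<in> extensional (domain_algebra g) \<and>
     cc_character (domain_algebra g) \<pi> \<and> (\<forall>j. \<pi> (weighted_shift g j) = z $ j))"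

text \<open>Meaningful for \<open>z \<in> scalar_domain g\<close>.\<close>

definition dual_map :: "'n::finite series \<Rightarrow> 'n series \<Rightarrow> ('n list op \<Rightarrow> 'n list op) \<Rightarrow>
    complex ^ 'n \<Rightarrow> complex ^ 'n" where
  "dual_map f g \<Phi> z = (\<chi> i. point_eval g z (\<Phi> (weighted_shift f i)))"


subsection \<open>The weighted shifts are the intended operators\<close>

lemma finite_factorizations: "finite (factorizations (\<alpha> :: 'n::finite list) j)"
proof (rule finite_subset)
  have "length \<gamma> \<le> length (concat \<gamma>s)" if "\<gamma> \<in> set \<gamma>s" for \<gamma> :: "'n list" and \<gamma>s
    using that by (induction \<gamma>s) auto
  then show "factorizations \<alpha> j
      \<subseteq> {\<gamma>s. set \<gamma>s \<subseteq> {\<gamma>. set \<gamma> \<subseteq> UNIV \<and> length \<gamma> \<le> length \<alpha>} \<and> length \<gamma>s = j}"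
    by (auto simp: factorizations_def)
  show "finite {\<gamma>s. set \<gamma>s \<subseteq> {\<gamma> :: 'n list. set \<gamma> \<subseteq> UNIV \<and> length \<gamma> \<le> length \<alpha>} \<and> length \<gamma>s = j}"
    by (intro finite_lists_length_eq finite_lists_length_le) simp
qed

lemma weight_Cons_ge:
  fixes f :: "'n::finite series"
  assumes f: "regular_positive f"
  shows "weight f (i # \<alpha>) \<ge> f [i] * weight f \<alpha>"
proof -
  have nn: "prod_list (map f \<gamma>s) \<ge> 0" for \<gamma>s
    using f by (induction \<gamma>s) (auto simp: regular_positive_def)
  have nnS: "(\<Sum>\<gamma>s\<in>factorizations \<beta> j. prod_list (map f \<gamma>s)) \<ge> 0" for \<beta> j
    by (intro sum_nonneg nn)
  have step: "f [i] * (\<Sum>\<gamma>s\<in>factorizations \<alpha> j. prod_list (map f \<gamma>s))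
      \<le> (\<Sum>\<gamma>s\<in>factorizations (i # \<alpha>) (Suc j). prod_list (map f \<gamma>s))" for j
  proof -
    have "f [i] * (\<Sum>\<gamma>s\<in>factorizations \<alpha> j. prod_list (map f \<gamma>s))
        = (\<Sum>\<gamma>s\<in>(#) [i] ` factorizations \<alpha> j. prod_list (map f \<gamma>s))"
      by (subst sum.reindex) (auto simp: sum_distrib_left inj_on_def)
    also have "\<dots> \<le> (\<Sum>\<gamma>s\<in>factorizations (i # \<alpha>) (Suc j). prod_list (map f \<gamma>s))"
      by (intro sum_mono2 finite_factorizations nn) (auto simp: factorizations_def)
    finally show ?thesis .
  qed
  show ?thesis
  proof (cases "\<alpha> = []")
    case True
    have "factorizations [i] (Suc 0) = {[[i]]}"
      by (auto simp: factorizations_def length_Suc_conv)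
    then show ?thesis using True by (simp add: weight_def)
  next
    case False
    have "f [i] * weight f \<alpha>
        = (\<Sum>j = 1..length \<alpha>. f [i] * (\<Sum>\<gamma>s\<in>factorizations \<alpha> j. prod_list (map f \<gamma>s)))"
      using False by (simp add: weight_def sum_distrib_left)
    also have "\<dots> \<le> (\<Sum>j = 1..length \<alpha>. \<Sum>\<gamma>s\<in>factorizations (i # \<alpha>) (Suc j). prod_list (map f \<gamma>s))"
      by (intro sum_mono step)
    also have "\<dots> = (\<Sum>j\<in>Suc ` {1..length \<alpha>}. \<Sum>\<gamma>s\<in>factorizations (i # \<alpha>) j. prod_list (map f \<gamma>s))"
      by (subst sum.reindex) auto
    also have "\<dots> \<le> weight f (i # \<alpha>)"
      unfolding weight_def by (auto intro!: sum_mono2 nnS)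
    finally show ?thesis .
  qed
qed

lemma weight_pos:
  fixes f :: "'n::finite series"
  assumes "regular_positive f"
  shows "weight f \<alpha> > 0"
proof (induction \<alpha>)
  case (Cons i \<alpha>)
  have "0 < f [i] * weight f \<alpha>"
    using Cons assms by (simp add: regular_positive_def)
  with weight_Cons_ge[OF assms, of i \<alpha>] show ?case by linarith
qed (simp add: weight_def)

lemma
  fixes f :: "'n::finite series"
  assumes f: "regular_positive f" and x: "(\<lambda>\<alpha>. (cmod (x \<alpha>))\<^sup>2) summable_on UNIV"
  shows weighted_shift_coord_summable:
      "(\<lambda>\<beta>. (cmod (weighted_shift_coord f i x \<beta>))\<^sup>2) summable_on UNIV"
    and weighted_shift_coord_bound:
      "(\<Sum>\<^sub>\<infinity>\<beta>. (cmod (weighted_shift_coord f i x \<beta>))\<^sup>2) \<le> (\<Sum>\<^sub>\<infinity>\<alpha>. (cmod (x \<alpha>))\<^sup>2) / f [i]"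
proof -
  let ?y = "\<lambda>\<beta>. (cmod (weighted_shift_coord f i x \<beta>))\<^sup>2"
  have fi: "f [i] > 0" using f by (simp add: regular_positive_def)
  have inj: "inj ((#) i)" by simp
  have eq: "?y (i # \<alpha>) = weight f \<alpha> / weight f (i # \<alpha>) * (cmod (x \<alpha>))\<^sup>2" for \<alpha>
    using weight_pos[OF f, of \<alpha>] weight_pos[OF f, of "i # \<alpha>"]
    by (simp add: weighted_shift_coord_def norm_mult power_mult_distrib)
  have le: "?y (i # \<alpha>) \<le> (cmod (x \<alpha>))\<^sup>2 / f [i]" for \<alpha>
  proof -
    have "weight f \<alpha> / weight f (i # \<alpha>) \<le> 1 / f [i]"
      using weight_Cons_ge[OF f, of i \<alpha>] weight_pos[OF f, of "i # \<alpha>"] fi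
      by (simp add: divide_simps mult.commute)
    from mult_right_mono[OF this, of "(cmod (x \<alpha>))\<^sup>2"] show ?thesis
      by (simp add: eq)
  qed
  have zero: "?y \<beta> = 0" if "\<beta> \<notin> range ((#) i)" for \<beta>
    using that by (auto simp: weighted_shift_coord_def split: list.splits)
  have x': "(\<lambda>\<alpha>. (cmod (x \<alpha>))\<^sup>2 / f [i]) summable_on UNIV"
    using summable_on_cmult_left[OF x, of "1 / f [i]"] by simp
  have s: "(\<lambda>\<alpha>. ?y (i # \<alpha>)) summable_on UNIV"
    by (rule summable_on_comparison_test[OF x']) (use le in auto)
  then have "?y summable_on range ((#) i)"
    by (subst summable_on_reindex[OF inj]) (simp add: o_def)
  then show "?y summable_on UNIV"
    by (rule summable_on_cong_neutral[THEN iffD1, rotated -1]) (use zero in auto)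
  have "(\<Sum>\<^sub>\<infinity>\<beta>. ?y \<beta>) = (\<Sum>\<^sub>\<infinity>\<beta>\<in>range ((#) i). ?y \<beta>)"
    by (rule infsum_cong_neutral) (use zero in auto)
  also have "\<dots> = (\<Sum>\<^sub>\<infinity>\<alpha>. ?y (i # \<alpha>))"
    by (subst infsum_reindex[OF inj]) (simp add: o_def)
  also have "\<dots> \<le> (\<Sum>\<^sub>\<infinity>\<alpha>. (cmod (x \<alpha>))\<^sup>2 / f [i])"
    by (rule infsum_mono[OF s x']) (rule le)
  also have "\<dots> = (\<Sum>\<^sub>\<infinity>\<alpha>. (cmod (x \<alpha>))\<^sup>2) / f [i]"
    using infsum_cmult_left'[of "\<lambda>\<alpha>. (cmod (x \<alpha>))\<^sup>2" "1 / f [i]" UNIV] by simp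
  finally show "(\<Sum>\<^sub>\<infinity>\<beta>. ?y \<beta>) \<le> (\<Sum>\<^sub>\<infinity>\<alpha>. (cmod (x \<alpha>))\<^sup>2) / f [i]" .
qed

lemma weighted_shift_apply:
  fixes f :: "'n::finite series"
  assumes f: "regular_positive f"
  shows "ell2_coord (weighted_shift f i x) = weighted_shift_coord f i (ell2_coord x)"
proof -
  let ?W = "\<lambda>x. Abs_ell2 (weighted_shift_coord f i (ell2_coord x))"
  have coord: "ell2_coord (?W x) = weighted_shift_coord f i (ell2_coord x)" for x
    by (rule Abs_ell2_inverse)
      (simp add: weighted_shift_coord_summable[OF f ell2_coord_summable])
  have "bounded_linear ?W"
  proof (rule bounded_linear_intro[of _ "sqrt (1 / f [i])"])
    show "?W (x + y) = ?W x + ?W y" for x y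
      by (rule ell2_coord_inject[THEN iffD1], rule ext, simp only: coord)
        (simp add: coord plus_ell2.rep_eq weighted_shift_coord_def distrib_left split: list.split)
    show "?W (r *\<^sub>R x) = r *\<^sub>R ?W x" for r x
      by (rule ell2_coord_inject[THEN iffD1], rule ext, simp only: coord)
        (simp add: coord scaleR_ell2.rep_eq weighted_shift_coord_def split: list.split)
    show "norm (?W x) \<le> norm x * sqrt (1 / f [i])" for x
      using weighted_shift_coord_bound[OF f ell2_coord_summable, of i x]
      by (simp add: norm_ell2_eq coord flip: real_sqrt_mult)
  qed
  then show ?thesis
    by (simp add: weighted_shift_def bounded_linear_Blinfun_apply coord)
qed

lemma weighted_shift_basis:
  fixes f :: "'n::finite series"
  assumes "regular_positive f"
  shows "weighted_shift f i (ell2_basis \<alpha>)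
       = sqrt (weight f \<alpha> / weight f (i # \<alpha>)) *\<^sub>R ell2_basis (i # \<alpha>)"
  by (rule ell2_coord_inject[THEN iffD1], rule ext)
    (auto simp: weighted_shift_apply[OF assms] weighted_shift_coord_def scaleR_ell2.rep_eq
      ell2_basis.rep_eq split: list.split)

end

theory Submission
  imports Defs
begin

text \<open>
  Evaluation of \<open>\<Phi>(W\<^sub>i)\<close> at the points of the scalar domain gives a bijection \<open>\<phi>\<close> from
  \<open>{z. K\<^sub>g(z,z) < 1}\<close> onto \<open>{z. K\<^sub>f(z,z) < 1}\<close>, where \<open>K\<^sub>f(z,w) = \<Sum> a\<^sub>\<alpha> z\<^sub>\<alpha> (w\<^sub>\<alpha>)\<^sup>*\<close>. Since
  \<open>[\<surd>a\<^sub>\<alpha> W\<^sub>\<alpha>]\<close> is a row contraction and \<open>\<Phi>\<close> and its inverse are completely isometric, the kernel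
  \<open>(1 - K\<^sub>f(\<phi> z,\<phi> w)) / (1 - K\<^sub>g(z,w))\<close> and its reciprocal are both positive semidefinite, hence of
  rank one: \<open>1 - K\<^sub>f(\<phi> z,\<phi> w) = h(z) (h w)\<^sup>* (1 - K\<^sub>g(z,w))\<close>.

  Transporting the rotations of the domain of \<open>f\<close> by \<open>\<phi>\<close> and differentiating yields a vector field \<open>v\<close>
  with \<open>D\<^sub>1K\<^sub>g(z,w)v(z) + (D\<^sub>1K\<^sub>g(w,z)v(w))\<^sup>* = (l(z) + (l w)\<^sup>*)(1 - K\<^sub>g(z,w))\<close>, where
  \<open>l(z) = \<Sum> a\<^sub>i z\<^sub>i (v\<^sub>i 0)\<^sup>*\<close> for the coefficients \<open>a\<^sub>i\<close> of \<open>g\<close>. The terms of bidegree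
  \<open>(2,1)\<close> determine the quadratic part of \<open>v\<close>; inserted into the terms of bidegree \<open>(d+1,d)\<close>,
  \<open>d\<close> the degree of \<open>g\<close>, nonnegativity of the coefficients forces \<open>d = 1\<close> or \<open>v(0) = 0\<close>, and the latter
  implies \<open>\<phi>(0) = 0\<close>. Applied to the inverse of \<open>\<Phi>\<close>: if \<open>\<phi>(0) \<noteq> 0\<close>, then \<open>f\<close> is linear, hence spherical.

  If \<open>\<phi>(0) = 0\<close>, the degree-one part of \<open>\<Phi>(W\<^sub>i)\<close> applied to the vacuum vector already has the full norm
  \<open>\<parallel>W\<^sub>i\<parallel>\<close>, so there is nothing else, and elements of the algebra are determined by their value at the
  vacuum vector.
\<close>

section \<open>Words, scalar domains and averages over roots of unity\<close>

text \<open>The obstacle is the lack of regularity: \<open>\<phi>\<close> is at first just a map of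
  points, so no power series or uniqueness theorem for holomorphic maps is at hand. Polynomiality of
  \<open>f\<close> and \<open>g\<close> replaces it. Averages over \<open>N\<close>-th roots of
  unity, with \<open>N\<close> beyond the degree, isolate single bidegrees of the kernels exactly,
  and the only derivatives taken are in the rotation angle, where the \<open>f\<close> side of the
  kernel identity is an explicit trigonometric polynomial. The inverse of \<open>\<Phi>\<close> has
  to enter because the degree argument needs a word of length at least 2 in the series on whose
  domain the point map is defined, while asphericity supplies such a word for \<open>f\<close>, on
  whose domain the point map takes its values.\<close>

definition word_eval :: "complex ^ 'n \<Rightarrow> 'n list \<Rightarrow> complex" where
  "word_eval z \<alpha> = prod_list (map (($) z) \<alpha>)"

lemma word_eval_simps [simp]:
  "word_eval z [] = 1" "word_eval z (i # \<alpha>) = z $ i * word_eval z \<alpha>"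
  by (simp_all add: word_eval_def)

lemma word_eval_append: "word_eval z (\<alpha> @ \<beta>) = word_eval z \<alpha> * word_eval z \<beta>"
  by (simp add: word_eval_def)

lemma word_eval_scale: "word_eval (c *s z) \<alpha> = c ^ length \<alpha> * word_eval z \<alpha>"
  by (induction \<alpha>) simp_all

lemma word_eval_0: "\<alpha> \<noteq> [] \<Longrightarrow> word_eval 0 \<alpha> = 0"
  by (cases \<alpha>) simp_all

text \<open>Its role is that \<open>1 / (1 - series_kernel f z w)\<close> is the inner product of
  two kernel vectors, see \<open>cinner_kernel_vectors\<close>. For a polynomial the sum is
  finite.\<close>

definition series_kernel :: "'n series \<Rightarrow> complex ^ 'n \<Rightarrow> complex ^ 'n \<Rightarrow> complex" where
  "series_kernel f z w = (\<Sum>\<alpha> | f \<alpha> \<noteq> 0. of_real (f \<alpha>) * word_eval z \<alpha> * cnj (word_eval w \<alpha>))"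

text \<open>Stands in for \<open>scalar_domain\<close>: the strict inequality makes kernel vectors
  square-summable, and no topology of the domain is involved.\<close>

definition open_domain :: "'n series \<Rightarrow> (complex ^ 'n) set" where
  "open_domain f = {z. (\<Sum>\<alpha> | f \<alpha> \<noteq> 0. f \<alpha> * (cmod (word_eval z \<alpha>))\<^sup>2) < 1}"

lemma cnj_series_kernel: "cnj (series_kernel f z w) = series_kernel f w z"
  by (simp add: series_kernel_def mult_ac)

lemma series_kernel_diag:
  "series_kernel f z z = of_real (\<Sum>\<alpha> | f \<alpha> \<noteq> 0. f \<alpha> * (cmod (word_eval z \<alpha>))\<^sup>2)"
  by (simp add: series_kernel_def mult.assoc complex_norm_square del: of_real_power)

lemma series_kernel_0 [simp]:
  assumes "f [] = 0"
  shows "series_kernel f 0 w = 0" "series_kernel f z 0 = 0"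
  using assms by (auto simp: series_kernel_def intro!: sum.neutral) (metis word_eval_0)+

lemma zero_in_open_domain:
  assumes "f [] = 0"
  shows "0 \<in> open_domain f"
proof -
  have "(\<Sum>\<alpha> | f \<alpha> \<noteq> 0. f \<alpha> * (cmod (word_eval 0 \<alpha>))\<^sup>2) = 0"
    using assms by (intro sum.neutral) (auto simp: word_eval_0 intro: word_eval_0)
  then show ?thesis by (simp add: open_domain_def)
qed

lemma open_domain_rotate:
  assumes "cmod c = 1" "z \<in> open_domain f"
  shows "c *s z \<in> open_domain f"
  using assms by (simp add: open_domain_def word_eval_scale norm_mult norm_power)

text \<open>As \<open>f [] = 0\<close>, scaling by \<open>\<epsilon> \<le> 1\<close> gains at least
  one factor \<open>\<epsilon>\<close> in every term, and \<open>\<epsilon> = 1 / (1 + C)\<close>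
  makes \<open>\<epsilon> * C < 1\<close>. This supplies test points in every direction, in
  particular on the coordinate axes.\<close>

lemma open_domain_absorbing:
  assumes f: "\<And>\<alpha>. f \<alpha> \<ge> 0" "f [] = 0"
  obtains \<epsilon> :: real where "\<epsilon> > 0" "of_real \<epsilon> *s z \<in> open_domain f"
proof -
  define C where "C = (\<Sum>\<alpha> | f \<alpha> \<noteq> 0. f \<alpha> * (cmod (word_eval z \<alpha>))\<^sup>2)"
  have C: "C \<ge> 0" unfolding C_def by (intro sum_nonneg) (simp add: f)
  define \<epsilon> where "\<epsilon> = 1 / (1 + C)"
  have e: "0 < \<epsilon>" "\<epsilon> \<le> 1" using C by (auto simp: \<epsilon>_def)
  have "(\<Sum>\<alpha> | f \<alpha> \<noteq> 0. f \<alpha> * (cmod (word_eval (of_real \<epsilon> *s z) \<alpha>))\<^sup>2) \<le> \<epsilon> * C"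
    unfolding C_def sum_distrib_left
  proof (intro sum_mono)
    fix \<alpha> assume "\<alpha> \<in> {\<alpha>. f \<alpha> \<noteq> 0}"
    then have "1 \<le> length \<alpha>" using f by (cases \<alpha>) auto
    then have "\<epsilon> ^ (2 * length \<alpha>) \<le> \<epsilon> ^ 1"
      using e by (intro power_decreasing) auto
    then have "\<epsilon> ^ (2 * length \<alpha>) * (f \<alpha> * (cmod (word_eval z \<alpha>))\<^sup>2)
        \<le> \<epsilon> * (f \<alpha> * (cmod (word_eval z \<alpha>))\<^sup>2)"
      by (intro mult_right_mono) (auto simp: f)
    then show "f \<alpha> * (cmod (word_eval (of_real \<epsilon> *s z) \<alpha>))\<^sup>2
        \<le> \<epsilon> * (f \<alpha> * (cmod (word_eval z \<alpha>))\<^sup>2)"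
      using e by (simp add: word_eval_scale norm_mult norm_power power_mult_distrib
          flip: power_mult) (simp add: mult_ac)
  qed
  also have "\<dots> < 1" using C by (simp add: \<epsilon>_def)
  finally show thesis using that e by (auto simp: open_domain_def)
qed

section \<open>Averages over roots of unity\<close>

definition root_of_1 :: "nat \<Rightarrow> nat \<Rightarrow> complex" where
  "root_of_1 N r = cis (2 * pi * real r / real N)"

definition avg :: "nat \<Rightarrow> (nat \<Rightarrow> complex) \<Rightarrow> complex" where
  "avg N F = (\<Sum>r<N. F r) / of_nat N"

lemma norm_root_of_1 [simp]: "cmod (root_of_1 N r) = 1"
  by (simp add: root_of_1_def)

lemma root_of_1_cnj [simp]: "root_of_1 N r * cnj (root_of_1 N r) = 1"
  by (simp add: root_of_1_def cis_cnj cis_mult)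

text \<open>A discrete Cauchy integral: for \<open>a \<noteq> b\<close> the values form a geometric
  progression whose ratio \<open>q\<close> satisfies \<open>q ^ N = 1\<close>. The bounds on the
  exponents exclude \<open>q = 1\<close>, as \<open>a - b\<close> is then no multiple of
  \<open>N\<close>.\<close>

lemma avg_root_of_1:
  assumes "a < N" "b < N"
  shows "avg N (\<lambda>r. root_of_1 N r ^ a * cnj (root_of_1 N r) ^ b) = (if a = b then 1 else 0)"
proof (cases "a = b")
  case True
  then show ?thesis using assms by (simp add: avg_def flip: power_mult_distrib)
next
  case False
  define q where "q = cis (2 * pi * (real a - real b) / N)"
  have eq: "root_of_1 N r ^ a * cnj (root_of_1 N r) ^ b = q ^ r" for r
    by (simp add: root_of_1_def q_def cis_cnj Complex.DeMoivre cis_mult)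
      (simp add: algebra_simps diff_divide_distrib)
  have qN: "q ^ N = 1"
  proof -
    have "q ^ N = cis (2 * pi * (real a - real b))"
      using assms by (simp add: q_def Complex.DeMoivre)
    also have "\<dots> = cis (2 * pi * of_int (int a - int b))" by simp
    also have "\<dots> = 1" by (rule cis_multiple_2pi) simp
    finally show ?thesis .
  qed
  have q1: "q \<noteq> 1"
  proof
    assume "q = 1"
    then have "cos (2 * pi * (real a - real b) / N) = 1"
      by (simp add: q_def complex_eq_iff)
    then obtain k :: int where "2 * pi * (real a - real b) / N = of_int k * 2 * pi"
      using cos_one_2pi_int by blast
    then have "2 * pi * (real a - real b) = 2 * pi * (of_int k * N)"
      using assms by (simp add: field_simps)
    then have "real a - real b = of_int k * N"
      by (metis mult_cancel_left mult_eq_0_iff pi_neq_zero zero_neq_numeral)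
    then have "of_int (int a - int b) = (of_int (k * int N) :: real)" by simp
    then have "int a - int b = k * int N" using of_int_eq_iff by blast
    then have "int N dvd int a - int b" by simp
    moreover have "\<bar>int a - int b\<bar> < int N" using assms by auto
    ultimately show False using False
      by (metis dvd_imp_le_int abs_of_nat eq_iff_diff_eq_0 not_le of_nat_eq_iff)
  qed
  have "(\<Sum>r<N. q ^ r) = 0"
    using q1 qN by (simp add: sum_gp_strict)
  then show ?thesis using False by (simp add: avg_def eq)
qed

lemma avg_add: "avg N (\<lambda>r. F r + G r) = avg N F + avg N G"
  by (simp add: avg_def sum.distrib add_divide_distrib)
lemma avg_diff: "avg N (\<lambda>r. F r - G r) = avg N F - avg N G"
  by (simp add: avg_def sum_subtractf diff_divide_distrib)
lemma avg_cmult: "avg N (\<lambda>r. c * F r) = c * avg N F"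
  by (simp add: avg_def sum_distrib_left)
lemma avg_sum: "avg N (\<lambda>r. \<Sum>x\<in>S. F x r) = (\<Sum>x\<in>S. avg N (F x))"
  unfolding avg_def by (subst sum.swap) (simp add: sum_divide_distrib)
lemma cnj_avg: "cnj (avg N F) = avg N (\<lambda>r. cnj (F r))"
  by (simp add: avg_def)

lemma avg_mult: "avg N (\<lambda>r. avg N (\<lambda>q. P r * Q q)) = avg N P * avg N Q"
  using avg_cmult[of N "avg N Q" P] by (simp add: avg_cmult mult.commute)

lemma avg_avg_sum:
  "avg N (\<lambda>r. avg N (\<lambda>q. \<Sum>x\<in>S. c x * (P x r * Q x q))) = (\<Sum>x\<in>S. c x * (avg N (P x) * avg N (Q x)))"
  by (simp add: avg_sum avg_cmult[of N "c _"] avg_mult)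

section \<open>Directional derivatives of words and kernels\<close>

fun word_deriv :: "complex ^ 'n \<Rightarrow> complex ^ 'n \<Rightarrow> 'n list \<Rightarrow> complex" where
  "word_deriv z u [] = 0"
| "word_deriv z u (i # \<alpha>) = u $ i * word_eval z \<alpha> + z $ i * word_deriv z u \<alpha>"

lemma word_deriv_scale: "word_deriv (c *s z) u \<alpha> = c ^ (length \<alpha> - 1) * word_deriv z u \<alpha>"
proof (induction \<alpha>)
  case (Cons i \<alpha>)
  show ?case
  proof (cases "\<alpha> = []")
    case False
    then obtain m where "length \<alpha> = Suc m" by (cases \<alpha>) auto
    then show ?thesis using Cons by (simp add: word_eval_scale algebra_simps)
  qed simp
qed simp

text \<open>At a fixed base point the derivative is linear in the direction, so an average of a
  vector field may be formed coordinatewise. This is how averages of \<open>generator\<close> become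
  \<open>gen0\<close> and \<open>gen2\<close>.\<close>

lemma word_deriv_linear:
  "word_deriv z (\<chi> i. avg N (\<lambda>r. c r * u r $ i)) \<alpha> = avg N (\<lambda>r. c r * word_deriv z (u r) \<alpha>)"
proof (induction \<alpha>)
  case (Cons i \<alpha>)
  have "avg N (\<lambda>r. c r * word_deriv z (u r) (i # \<alpha>))
      = avg N (\<lambda>r. word_eval z \<alpha> * (c r * u r $ i) + z $ i * (c r * word_deriv z (u r) \<alpha>))"
    by (simp add: algebra_simps)
  also have "\<dots> = word_eval z \<alpha> * avg N (\<lambda>r. c r * u r $ i)
      + z $ i * avg N (\<lambda>r. c r * word_deriv z (u r) \<alpha>)"
    by (simp add: avg_add avg_cmult)
  finally show ?case using Cons by (simp add: algebra_simps)
qed (simp add: avg_def)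

lemma has_vector_derivative_word_eval:
  assumes "\<And>i. ((\<lambda>t. x t $ i) has_vector_derivative u $ i) (at s)"
  shows "((\<lambda>t. word_eval (x t) \<alpha>) has_vector_derivative word_deriv (x s) u \<alpha>) (at s)"
proof (induction \<alpha>)
  case (Cons i \<alpha>)
  from has_vector_derivative_mult[OF assms[of i] Cons]
  show ?case by (simp add: algebra_simps)
qed simp

text \<open>Euler's identity for a diagonal linear vector field: by the Leibniz rule the eigenvalues
  of the letters add up along the word.\<close>

lemma word_deriv_eigen:
  assumes "\<And>i. u $ i = c i * z $ i"
  shows "word_deriv z u \<alpha> = sum_list (map c \<alpha>) * word_eval z \<alpha>"
  by (induction \<alpha>) (simp_all add: assms algebra_simps)

lemma sum_length_1:
  fixes F :: "'n::finite list \<Rightarrow> complex"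
  assumes "regular_positive g" "free_polynomial g"
  shows "(\<Sum>\<alpha> | g \<alpha> \<noteq> 0. if length \<alpha> = 1 then F \<alpha> else 0) = (\<Sum>i\<in>UNIV. F [i])"
proof -
  have "(\<Sum>\<alpha> | g \<alpha> \<noteq> 0. if length \<alpha> = 1 then F \<alpha> else 0)
      = (\<Sum>\<alpha> | g \<alpha> \<noteq> 0 \<and> length \<alpha> = 1. F \<alpha>)"
    using assms by (simp add: free_polynomial_def flip: sum.inter_filter)
  also have "\<dots> = (\<Sum>\<alpha>\<in>(\<lambda>i. [i]) ` UNIV. F \<alpha>)"
  proof (rule sum.cong)
    have "g [i] \<noteq> 0" for i
      using assms(1) by (metis less_irrefl regular_positive_def)
    then show "{\<alpha>. g \<alpha> \<noteq> 0 \<and> length \<alpha> = 1} = range (\<lambda>i. [i])"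
      by (auto simp: length_Suc_conv image_iff)
  qed simp
  also have "\<dots> = (\<Sum>i\<in>UNIV. F [i])"
    by (subst sum.reindex) (auto simp: inj_on_def)
  finally show ?thesis .
qed

text \<open>Unlike one-letter words, two-letter words may lie outside the support. The explicit
  factor \<open>g \<alpha>\<close> makes these vanish, so the sum may run over all pairs.\<close>

lemma sum_length_2:
  fixes F :: "'n::finite list \<Rightarrow> complex"
  assumes "free_polynomial g"
  shows "(\<Sum>\<alpha> | g \<alpha> \<noteq> 0. if length \<alpha> = 2 then of_real (g \<alpha>) * F \<alpha> else 0)
    = (\<Sum>i\<in>UNIV. \<Sum>j\<in>UNIV. of_real (g [i, j]) * F [i, j])"
proof -
  have "(\<Sum>\<alpha> | g \<alpha> \<noteq> 0. if length \<alpha> = 2 then of_real (g \<alpha>) * F \<alpha> else 0)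
      = (\<Sum>\<alpha> | g \<alpha> \<noteq> 0 \<and> length \<alpha> = 2. of_real (g \<alpha>) * F \<alpha>)"
    using assms by (simp add: free_polynomial_def flip: sum.inter_filter)
  also have "\<dots> = (\<Sum>\<alpha>\<in>(\<lambda>(i, j). [i, j]) ` UNIV. of_real (g \<alpha>) * F \<alpha>)"
    by (rule sum.mono_neutral_left)
      (auto simp: image_iff length_Suc_conv numeral_2_eq_2)
  also have "\<dots> = (\<Sum>(i, j)\<in>UNIV. of_real (g [i, j]) * F [i, j])"
    by (subst sum.reindex) (auto simp: inj_on_def case_prod_beta)
  also have "\<dots> = (\<Sum>i\<in>UNIV. \<Sum>j\<in>UNIV. of_real (g [i, j]) * F [i, j])"
    by (simp add: sum.cartesian_product)
  finally show ?thesis .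
qed

definition kernel_deriv ::
    "'n series \<Rightarrow> complex ^ 'n \<Rightarrow> complex ^ 'n \<Rightarrow> complex ^ 'n \<Rightarrow> complex" where
  "kernel_deriv g z w u =
     (\<Sum>\<alpha> | g \<alpha> \<noteq> 0. of_real (g \<alpha>) * word_deriv z u \<alpha> * cnj (word_eval w \<alpha>))"

lemma has_vector_derivative_series_kernel:
  assumes "\<And>i. ((\<lambda>t. x t $ i) has_vector_derivative u $ i) (at s)"
  shows "((\<lambda>t. series_kernel g (x t) w) has_vector_derivative kernel_deriv g (x s) w u) (at s)"
  unfolding series_kernel_def kernel_deriv_def
  by (intro has_vector_derivative_sum has_vector_derivative_mult_left has_vector_derivative_mult_right
      has_vector_derivative_word_eval assms)

lemma word_deriv_0: "word_deriv 0 u \<alpha> = (if length \<alpha> = 1 then u $ hd \<alpha> else 0)"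
  by (cases \<alpha>; cases "tl \<alpha>") (auto simp: word_eval_0)

text \<open>A word of length at least 2 still contains a zero factor after one letter has been
  differentiated.\<close>

lemma kernel_deriv_at_0:
  assumes "regular_positive g" "free_polynomial g"
  shows "kernel_deriv g 0 w u = (\<Sum>i\<in>UNIV. of_real (g [i]) * u $ i * cnj (w $ i))"
proof -
  have "kernel_deriv g 0 w u = (\<Sum>\<alpha> | g \<alpha> \<noteq> 0. if length \<alpha> = 1
     then of_real (g \<alpha>) * u $ hd \<alpha> * cnj (word_eval w \<alpha>) else 0)"
    unfolding kernel_deriv_def by (rule sum.cong) (auto simp: word_deriv_0)
  then show ?thesis by (simp only: sum_length_1[OF assms]) simp
qed

section \<open>Rigidity of kernel correspondences\<close>

text \<open>What the rigidity argument retains of an isomorphism: a bijection and a kernel identity,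
  with no continuity of \<open>\<phi>\<close> or \<open>h\<close>.\<close>

locale kernel_correspondence =
  fixes f g :: "'n::finite series" and \<phi> :: "complex ^ 'n \<Rightarrow> complex ^ 'n"
    and h :: "complex ^ 'n \<Rightarrow> complex"
  assumes f: "regular_positive f" "free_polynomial f"
    and g: "regular_positive g" "free_polynomial g"
    and bij: "bij_betw \<phi> (open_domain g) (open_domain f)"
    and h: "\<And>z. z \<in> open_domain g \<Longrightarrow> h z \<noteq> 0"
    and kernel: "\<And>z w. z \<in> open_domain g \<Longrightarrow> w \<in> open_domain g \<Longrightarrow>
      1 - series_kernel f (\<phi> z) (\<phi> w) = h z * cnj (h w) * (1 - series_kernel g z w)"
begin

lemma coeffs: "f [] = 0" "g [] = 0" "f \<alpha> \<ge> 0" "g \<alpha> \<ge> 0" "f [i] > 0" "g [i] > 0"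
    "finite {\<alpha>. f \<alpha> \<noteq> 0}" "finite {\<alpha>. g \<alpha> \<noteq> 0}"
  using f g by (auto simp: regular_positive_def free_polynomial_def)

abbreviation "\<D> \<equiv> open_domain g"

lemma absorbing:
  obtains \<epsilon> :: real where "\<epsilon> > 0" "of_real \<epsilon> *s z \<in> \<D>"
  using open_domain_absorbing[of g z] coeffs by metis

text \<open>The derivative at \<open>t = 0\<close> of \<open>(1 - K\<^sub>f(e\<^bsup>it\<^esup> \<phi> z, \<phi> w)) / (h z (h w)\<^sup>*)\<close>.\<close>

definition rotation_deriv :: "complex ^ 'n \<Rightarrow> complex ^ 'n \<Rightarrow> complex" where
  "rotation_deriv z w = - (\<Sum>\<alpha> | f \<alpha> \<noteq> 0. of_real (f \<alpha>) * (\<i> * of_nat (length \<alpha>))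
      * word_eval (\<phi> z) \<alpha> * cnj (word_eval (\<phi> w) \<alpha>)) / (h z * cnj (h w))"

text \<open>The factors \<open>\<i> * of_nat (length \<alpha>)\<close> are purely imaginary and
  everything else is Hermitian in \<open>(z, w)\<close>.\<close>

lemma rotation_deriv_skew: "rotation_deriv z w = - cnj (rotation_deriv w z)"
proof -
  have "- cnj (rotation_deriv w z) = (\<Sum>\<alpha> | f \<alpha> \<noteq> 0. of_real (f \<alpha>) * (- \<i> * of_nat (length \<alpha>))
      * cnj (word_eval (\<phi> w) \<alpha>) * word_eval (\<phi> z) \<alpha>) / (cnj (h w) * h z)"
    by (simp add: rotation_deriv_def)
  also have "(\<Sum>\<alpha> | f \<alpha> \<noteq> 0. of_real (f \<alpha>) * (- \<i> * of_nat (length \<alpha>))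
      * cnj (word_eval (\<phi> w) \<alpha>) * word_eval (\<phi> z) \<alpha>)
     = - (\<Sum>\<alpha> | f \<alpha> \<noteq> 0. of_real (f \<alpha>) * (\<i> * of_nat (length \<alpha>))
      * word_eval (\<phi> z) \<alpha> * cnj (word_eval (\<phi> w) \<alpha>))"
    unfolding sum_negf[symmetric] by (rule sum.cong) (simp_all add: mult_ac)
  finally show ?thesis by (simp add: rotation_deriv_def mult.commute)
qed

text \<open>\<open>v\<close> is the velocity at \<open>z\<close> of the flow \<open>\<phi>\<^sup>-\<^sup>1(e\<^bsup>it\<^esup> \<phi> z)\<close>. Its differentiability comes for free:
  averaging the transported kernel over roots of unity in \<open>w\<close> isolates each coordinate of the flow.\<close>

lemma ex_generator_at:
  assumes z: "z \<in> \<D>"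
  shows "\<exists>v. \<forall>w\<in>\<D>. rotation_deriv z w
      = rotation_deriv z 0 * (1 - series_kernel g z w) - kernel_deriv g z w v"
proof -
  define \<tau> where "\<tau> \<theta> = inv_into \<D> \<phi> (cis \<theta> *s \<phi> z)" for \<theta>
  have \<phi>z: "\<phi> z \<in> open_domain f" using bij z by (auto simp: bij_betw_def)
  have \<tau>: "\<tau> \<theta> \<in> \<D>" "\<phi> (\<tau> \<theta>) = cis \<theta> *s \<phi> z" for \<theta>
  proof -
    have "cis \<theta> *s \<phi> z \<in> open_domain f" by (rule open_domain_rotate) (simp_all add: \<phi>z)
    then have "cis \<theta> *s \<phi> z \<in> \<phi> ` \<D>" using bij by (simp add: bij_betw_def)
    then show "\<tau> \<theta> \<in> \<D>" "\<phi> (\<tau> \<theta>) = cis \<theta> *s \<phi> z"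
      unfolding \<tau>_def by (rule inv_into_into, rule f_inv_into_f)
  qed
  have \<tau>0: "\<tau> 0 = z"
    using bij z by (simp add: \<tau>_def bij_betw_def)
  \<comment> \<open>\<open>m\<close> is the change of the factor \<open>h\<close> along the orbit
    \<open>\<tau>\<close>. In the identity \<open>e \<theta> w = m \<theta> * (1 - series_kernel g
    (\<tau> \<theta>) w)\<close> the left side is explicit in \<open>\<theta>\<close>, whereas
    \<open>m\<close> and \<open>\<tau>\<close> have to be recovered from it.\<close>
  define m where "m \<theta> = h (\<tau> \<theta>) / h z" for \<theta>
  define e where "e \<theta> w = (1 - series_kernel f (cis \<theta> *s \<phi> z) (\<phi> w)) / (h z * cnj (h w))" for \<theta> w
  have e: "e \<theta> w = m \<theta> * (1 - series_kernel g (\<tau> \<theta>) w)" if "w \<in> \<D>" for \<theta> w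
    using kernel[OF \<tau>(1)[of \<theta>] that] h[OF that] h[OF z]
    by (simp add: e_def m_def \<tau>)
  have de: "((\<lambda>\<theta>. e \<theta> w) has_vector_derivative rotation_deriv z w) (at 0)" for w
  proof -
    have cis: "((\<lambda>\<theta>. cis \<theta> ^ n) has_vector_derivative \<i> * of_nat n) (at 0)" for n
      unfolding Complex.DeMoivre
      by (auto intro!: derivative_eq_intros simp: has_vector_derivative_def scaleR_conv_of_real)
    have "e \<theta> w = (1 - (\<Sum>\<alpha> | f \<alpha> \<noteq> 0. of_real (f \<alpha>) * (cis \<theta> ^ length \<alpha> * (word_eval (\<phi> z) \<alpha>
        * cnj (word_eval (\<phi> w) \<alpha>))))) / (h z * cnj (h w))" for \<theta>
      by (simp add: e_def series_kernel_def word_eval_scale mult.assoc)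
    moreover have "((\<lambda>\<theta>. (1 - (\<Sum>\<alpha> | f \<alpha> \<noteq> 0. of_real (f \<alpha>) * (cis \<theta> ^ length \<alpha> * (word_eval (\<phi> z) \<alpha>
        * cnj (word_eval (\<phi> w) \<alpha>))))) / (h z * cnj (h w))) has_vector_derivative
        (0 - (\<Sum>\<alpha> | f \<alpha> \<noteq> 0. of_real (f \<alpha>) * ((\<i> * of_nat (length \<alpha>)) * (word_eval (\<phi> z) \<alpha>
        * cnj (word_eval (\<phi> w) \<alpha>))))) / (h z * cnj (h w))) (at 0)"
      by (intro has_vector_derivative_divide has_vector_derivative_diff has_vector_derivative_const
          has_vector_derivative_sum has_vector_derivative_mult_right has_vector_derivative_mult_left cis)
    ultimately show ?thesis by (simp add: rotation_deriv_def mult.assoc)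
  qed
  have m0: "m 0 = 1" by (simp add: m_def \<tau>0 h z)
  \<comment> \<open>At \<open>w = 0\<close> the kernel of \<open>g\<close> vanishes, so the
    multiplier is one of the explicit functions \<open>e\<close> and hence differentiable.\<close>
  have m: "m = (\<lambda>\<theta>. e \<theta> 0)"
    using e[of 0] zero_in_open_domain[of g] coeffs by auto
  have dm: "(m has_vector_derivative rotation_deriv z 0) (at 0)"
    unfolding m by (rule de)
  have "\<exists>d. ((\<lambda>\<theta>. \<tau> \<theta> $ i) has_vector_derivative d) (at 0)" for i
  proof -
    obtain \<epsilon> :: real where \<epsilon>: "\<epsilon> > 0" "of_real \<epsilon> *s axis i 1 \<in> \<D>" using absorbing .
    define w :: "complex ^ 'n" where "w = of_real \<epsilon> *s axis i 1"
    \<comment> \<open>Larger than every word length and than the exponent 1, as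
      \<open>avg_root_of_1\<close> requires.\<close>
    define N where "N = 2 + Max (length ` {\<alpha>. g \<alpha> \<noteq> 0})"
    have N: "length \<alpha> < N" if "g \<alpha> \<noteq> 0" for \<alpha>
    proof -
      have "length \<alpha> \<le> Max (length ` {\<alpha>. g \<alpha> \<noteq> 0})"
        using that coeffs by (intro Max_ge) auto
      then show ?thesis by (simp add: N_def)
    qed
    have N2: "Suc 0 < N" by (simp add: N_def)
    \<comment> \<open>Multiplying by one root of unity and averaging over rotations of
      \<open>w\<close> keeps the terms of degree one in the conjugate of \<open>w\<close>. As
      \<open>w\<close> lies on the \<open>i\<close>-th axis, only the coordinate
      \<open>\<tau> \<theta> $ i\<close> survives, so it is a quotient of differentiable
      functions.\<close>
    define c where "c \<theta> = avg N (\<lambda>r. root_of_1 N r * e \<theta> (root_of_1 N r *s w))" for \<theta>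
    have avg1: "avg N (root_of_1 N) = 0"
      using avg_root_of_1[of 1 N 0] by (simp add: N_def)
    have c: "c \<theta> = - m \<theta> * (of_real (g [i]) * \<tau> \<theta> $ i * of_real \<epsilon>)" for \<theta>
    proof -
      have "c \<theta> = avg N (\<lambda>r. m \<theta> * root_of_1 N r - m \<theta> * (\<Sum>\<alpha> | g \<alpha> \<noteq> 0.
          of_real (g \<alpha>) * word_eval (\<tau> \<theta>) \<alpha> * cnj (word_eval w \<alpha>) * (root_of_1 N r ^ 1 * cnj (root_of_1 N r) ^ length \<alpha>)))"
        unfolding c_def
      proof (rule arg_cong[where f = "avg N"], rule ext)
        fix r
        have "root_of_1 N r *s w \<in> \<D>"
          using \<epsilon> by (intro open_domain_rotate) (simp_all add: w_def)
        then show "root_of_1 N r * e \<theta> (root_of_1 N r *s w) = m \<theta> * root_of_1 N r - m \<theta> * (\<Sum>\<alpha> | g \<alpha> \<noteq> 0.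
          of_real (g \<alpha>) * word_eval (\<tau> \<theta>) \<alpha> * cnj (word_eval w \<alpha>) * (root_of_1 N r ^ 1 * cnj (root_of_1 N r) ^ length \<alpha>))"
          by (simp add: e series_kernel_def word_eval_scale sum_distrib_left algebra_simps)
      qed
      also have "\<dots> = m \<theta> * avg N (root_of_1 N) - m \<theta> * (\<Sum>\<alpha> | g \<alpha> \<noteq> 0.
          of_real (g \<alpha>) * word_eval (\<tau> \<theta>) \<alpha> * cnj (word_eval w \<alpha>) *
            avg N (\<lambda>r. root_of_1 N r ^ 1 * cnj (root_of_1 N r) ^ length \<alpha>))"
        by (simp only: avg_diff avg_cmult avg_sum)
      also have "(\<Sum>\<alpha> | g \<alpha> \<noteq> 0.
          of_real (g \<alpha>) * word_eval (\<tau> \<theta>) \<alpha> * cnj (word_eval w \<alpha>) *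
            avg N (\<lambda>r. root_of_1 N r ^ 1 * cnj (root_of_1 N r) ^ length \<alpha>))
         = (\<Sum>\<alpha> | g \<alpha> \<noteq> 0. if length \<alpha> = 1 then
          of_real (g \<alpha>) * word_eval (\<tau> \<theta>) \<alpha> * cnj (word_eval w \<alpha>) else 0)"
        by (intro sum.cong refl, subst avg_root_of_1) (auto simp: N N2)
      also have "\<dots> = (\<Sum>j\<in>UNIV. of_real (g [j]) * \<tau> \<theta> $ j * cnj (w $ j))"
        by (simp only: sum_length_1[OF g]) simp
      also have "\<dots> = (\<Sum>j\<in>UNIV. if j = i then of_real (g [i]) * \<tau> \<theta> $ i * of_real \<epsilon> else 0)"
        by (rule sum.cong) (auto simp: w_def axis_def)
      finally show ?thesis by (simp add: avg1)
    qed
    have "((\<lambda>\<theta>. c \<theta>) has_vector_derivative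
        (\<Sum>r<N. root_of_1 N r * rotation_deriv z (root_of_1 N r *s w)) / of_nat N) (at 0)"
      unfolding c_def avg_def
      by (intro has_vector_derivative_divide has_vector_derivative_sum has_vector_derivative_mult_right de)
    then have dc: "c differentiable at 0" by (simp add: differentiableI_vector)
    have dm': "m differentiable at 0" using dm by (rule differentiableI_vector)
    have ev: "\<forall>\<^sub>F \<theta> in at 0. m \<theta> \<noteq> 0"
      using differentiable_imp_continuous_within[OF dm'] m0
      by (auto simp: continuous_within intro!: tendsto_imp_eventually_ne)
    have \<tau>i: "(\<lambda>\<theta>. \<tau> \<theta> $ i) = (\<lambda>\<theta>. c \<theta> / (- m \<theta> * (of_real (g [i]) * of_real \<epsilon>)))"
    proof
      fix \<theta>
      have "m \<theta> \<noteq> 0" by (simp add: m_def h \<tau> z)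
      then show "\<tau> \<theta> $ i = c \<theta> / (- m \<theta> * (of_real (g [i]) * of_real \<epsilon>))"
        using \<epsilon> coeffs(6)[of i] by (simp add: c)
    qed
    have "(\<lambda>\<theta>. \<tau> \<theta> $ i) differentiable at 0"
      unfolding \<tau>i using m0 \<epsilon> coeffs(6)[of i]
      by (intro differentiable_divide differentiable_mult differentiable_minus dc dm' differentiable_const) auto
    then show ?thesis by (metis vector_derivative_works)
  qed
  then obtain d where "\<And>i. ((\<lambda>\<theta>. \<tau> \<theta> $ i) has_vector_derivative d i) (at 0)" by metis
  then have d\<tau>: "((\<lambda>\<theta>. \<tau> \<theta> $ i) has_vector_derivative (\<chi> i. d i) $ i) (at 0)" for i by simp
  show ?thesis
  proof (intro exI ballI)
    fix w assume w: "w \<in> \<D>"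
    from has_vector_derivative_mult[OF dm has_vector_derivative_diff[OF has_vector_derivative_const[where c = 1]
        has_vector_derivative_series_kernel[OF d\<tau>, of g w]]]
    have "((\<lambda>\<theta>. e \<theta> w) has_vector_derivative
        rotation_deriv z 0 * (1 - series_kernel g z w) - kernel_deriv g z w (\<chi> i. d i)) (at 0)"
      by (simp add: e[OF w] m0 \<tau>0 algebra_simps)
    from vector_derivative_unique_at[OF de this]
    show "rotation_deriv z w
      = rotation_deriv z 0 * (1 - series_kernel g z w) - kernel_deriv g z w (\<chi> i. d i)" .
  qed
qed

section \<open>The generating vector field and its homogeneous components\<close>

definition generator :: "complex ^ 'n \<Rightarrow> complex ^ 'n" where
  "generator z = (SOME v. \<forall>w\<in>\<D>. rotation_deriv z w
      = rotation_deriv z 0 * (1 - series_kernel g z w) - kernel_deriv g z w v)"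

lemma rotation_deriv_eq:
  assumes "z \<in> \<D>" "w \<in> \<D>"
  shows "rotation_deriv z w
    = rotation_deriv z 0 * (1 - series_kernel g z w) - kernel_deriv g z w (generator z)"
  using someI_ex[OF ex_generator_at[OF assms(1)]] assms(2) by (simp add: generator_def)

definition gen_form :: "complex ^ 'n \<Rightarrow> complex" where
  "gen_form z = (\<Sum>i\<in>UNIV. of_real (g [i]) * z $ i * cnj (generator 0 $ i))"

lemma gen_form_scale: "gen_form (c *s z) = c * gen_form z"
  by (simp add: gen_form_def sum_distrib_left mult_ac)

lemma zero_in_dom [simp]: "0 \<in> \<D>"
  by (rule zero_in_open_domain) (rule coeffs)

text \<open>Adding \<open>rotation_deriv_eq\<close> at \<open>(z, w)\<close> to its conjugate at
  \<open>(w, z)\<close> cancels the rotation derivatives by skew symmetry. The same symmetry shows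
  that \<open>rotation_deriv z 0\<close> is \<open>gen_form z\<close> plus a constant, which is
  purely imaginary and so drops out of the sum.\<close>

lemma generator_skew:
  assumes z: "z \<in> \<D>" and w: "w \<in> \<D>"
  shows "kernel_deriv g z w (generator z) + cnj (kernel_deriv g w z (generator w))
    = (gen_form z + cnj (gen_form w)) * (1 - series_kernel g z w)"
proof -
  define \<mu> where "\<mu> z = rotation_deriv z 0" for z
  have \<mu>: "\<mu> z = gen_form z - cnj (\<mu> 0)" if "z \<in> \<D>" for z
  proof -
    have "rotation_deriv 0 z = \<mu> 0 - kernel_deriv g 0 z (generator 0)"
      using rotation_deriv_eq[of 0 z] that by (simp add: \<mu>_def coeffs)
    then have "\<mu> z = - cnj (\<mu> 0 - kernel_deriv g 0 z (generator 0))"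
      unfolding \<mu>_def[of z] by (subst rotation_deriv_skew) (simp only:)
    then show ?thesis
      by (simp add: kernel_deriv_at_0[OF g] gen_form_def mult_ac)
  qed
  have \<mu>0: "\<mu> 0 = - cnj (\<mu> 0)" using \<mu>[OF zero_in_dom] unfolding gen_form_def by (simp only: zero_index) simp
  have sum: "\<mu> z + cnj (\<mu> w) = gen_form z + cnj (gen_form w)"
    unfolding \<mu>[OF z] \<mu>[OF w] complex_cnj_diff complex_cnj_cnj using \<mu>0
    by algebra
  have "kernel_deriv g z w (generator z) = \<mu> z * (1 - series_kernel g z w) - rotation_deriv z w"
    using rotation_deriv_eq[OF z w] by (simp add: \<mu>_def)
  moreover have "cnj (kernel_deriv g w z (generator w))
      = cnj (\<mu> w) * (1 - series_kernel g z w) - cnj (rotation_deriv w z)"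
    using rotation_deriv_eq[OF w z] by (simp add: \<mu>_def cnj_series_kernel)
  moreover note rotation_deriv_skew[of z w]
  ultimately show ?thesis
    unfolding sum[symmetric] by algebra
qed

definition degree :: nat where "degree = Max (length ` {\<alpha>. g \<alpha> \<noteq> 0})"

lemma length_le_degree: "g \<alpha> \<noteq> 0 \<Longrightarrow> length \<alpha> \<le> degree"
  unfolding degree_def using coeffs by (intro Max_ge) auto

text \<open>The exponents in \<open>generator_homogeneous\<close> reach \<open>degree + 1\<close>
  and must stay below \<open>N\<close>.\<close>

definition N :: nat where "N = degree + 3"

text \<open>The factor \<open>1\<close> gives the body the shape expected by
  \<open>word_deriv_linear\<close>.\<close>

definition gen0 :: "complex ^ 'n \<Rightarrow> complex ^ 'n" where
  "gen0 w = (\<chi> i. avg N (\<lambda>r. 1 * generator (root_of_1 N r *s w) $ i))"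

definition gen2 :: "complex ^ 'n \<Rightarrow> complex ^ 'n" where
  "gen2 z = (\<chi> i. avg N (\<lambda>r. cnj (root_of_1 N r) ^ 2 * generator (root_of_1 N r *s z) $ i))"

abbreviation homog_sum :: "nat \<Rightarrow> ('n list \<Rightarrow> complex) \<Rightarrow> complex" where
  "homog_sum k F \<equiv> (\<Sum>\<alpha> | g \<alpha> \<noteq> 0. if length \<alpha> = k then of_real (g \<alpha>) * F \<alpha> else 0)"

text \<open>The terms of degree \<open>B + 1\<close> in \<open>z\<close> and \<open>B\<close> in the conjugate of \<open>w\<close>. No expansion of the vector
  field is needed: \<open>gen0\<close> and \<open>gen2\<close> are what averaging leaves of its components of degree 0 and 2.\<close>

lemma generator_homogeneous:
  assumes z: "z \<in> \<D>" and w: "w \<in> \<D>" and B: "B \<le> degree"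
  shows "homog_sum B (\<lambda>\<alpha>. word_deriv z (gen2 z) \<alpha> * cnj (word_eval w \<alpha>))
      + homog_sum (Suc B) (\<lambda>\<alpha>. word_eval z \<alpha> * cnj (word_deriv w (gen0 w) \<alpha>))
    = gen_form z * ((if B = 0 then 1 else 0) - homog_sum B (\<lambda>\<alpha>. word_eval z \<alpha> * cnj (word_eval w \<alpha>)))"
proof -
  define s where "s = root_of_1 N"
  have s1: "s r * cnj (s r) = 1" "cnj (s r) * s r = 1" for r by (simp_all add: s_def mult.commute)
  define A where "A F = avg N (\<lambda>r. avg N (\<lambda>q. F r q))" for F :: "nat \<Rightarrow> nat \<Rightarrow> complex"
  have len: "length \<alpha> + 2 < N" if "g \<alpha> \<noteq> 0" for \<alpha>
    using length_le_degree[OF that] by (simp add: N_def)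
  have BN: "B + 2 < N" using B by (simp add: N_def)
  have ne: "length \<alpha> \<noteq> 0" if "g \<alpha> \<noteq> 0" for \<alpha> using that coeffs by auto
  have orth: "avg N (\<lambda>r. s r ^ a * cnj (s r) ^ b) = (if a = b then 1 else 0)" if "a < N" "b < N" for a b
    unfolding s_def by (rule avg_root_of_1) fact+
  have orth': "avg N (\<lambda>r. cnj (s r) ^ b * s r ^ a) = (if a = b then 1 else 0)" if "a < N" "b < N" for a b
    using orth[OF that] by (simp add: mult.commute)

  \<comment> \<open>The \<open>w\<close>-average selects words of length \<open>B\<close>. Their
    derivative at the rotated \<open>z\<close> carries the power \<open>B - 1\<close> of the root,
    so two conjugate roots remain against \<open>generator\<close>, which is the average defining
    \<open>gen2\<close>.\<close>
  have L1: "A (\<lambda>r q. cnj (s r) ^ Suc B * s q ^ B * kernel_deriv g (s r *s z) (s q *s w) (generator (s r *s z)))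
      = homog_sum B (\<lambda>\<alpha>. word_deriv z (gen2 z) \<alpha> * cnj (word_eval w \<alpha>))" (is "?l = _")
  proof -
    have "?l = A (\<lambda>r q. \<Sum>\<alpha> | g \<alpha> \<noteq> 0. (of_real (g \<alpha>) * cnj (word_eval w \<alpha>)) *
        ((cnj (s r) ^ Suc B * s r ^ (length \<alpha> - 1) * word_deriv z (generator (s r *s z)) \<alpha>)
          * (s q ^ B * cnj (s q) ^ length \<alpha>)))"
      unfolding kernel_deriv_def sum_distrib_left word_deriv_scale word_eval_scale complex_cnj_mult complex_cnj_power
      by (intro arg_cong[where f = A] ext sum.cong refl) (simp only: mult_ac)
    also have "\<dots> = (\<Sum>\<alpha> | g \<alpha> \<noteq> 0. (of_real (g \<alpha>) * cnj (word_eval w \<alpha>)) *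
        (avg N (\<lambda>r. cnj (s r) ^ Suc B * s r ^ (length \<alpha> - 1) * word_deriv z (generator (s r *s z)) \<alpha>)
          * avg N (\<lambda>q. s q ^ B * cnj (s q) ^ length \<alpha>)))"
      unfolding A_def by (rule avg_avg_sum)
    also have "\<dots> = homog_sum B (\<lambda>\<alpha>. word_deriv z (gen2 z) \<alpha> * cnj (word_eval w \<alpha>))"
    proof (rule sum.cong)
      fix \<alpha> assume "\<alpha> \<in> {\<alpha>. g \<alpha> \<noteq> 0}"
      then have \<alpha>: "length \<alpha> + 2 < N" "length \<alpha> \<noteq> 0" using len ne by auto
      have "avg N (\<lambda>r. cnj (s r) ^ Suc B * s r ^ (length \<alpha> - 1) * word_deriv z (generator (s r *s z)) \<alpha>)
          = word_deriv z (gen2 z) \<alpha>" if lenB: "length \<alpha> = B"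
      proof -
        obtain b where b: "B = Suc b" using lenB \<alpha>(2) by (metis not0_implies_Suc)
        have "cnj (s r) ^ Suc B * s r ^ (length \<alpha> - 1) = cnj (s r) ^ 2" for r
        proof -
          have "cnj (s r) ^ Suc B * s r ^ (length \<alpha> - 1) = cnj (s r) ^ 2 * (cnj (s r) * s r) ^ b"
            unfolding lenB b by (simp only: power_mult_distrib power2_eq_square power_Suc diff_Suc_1 mult_ac)
          then show ?thesis by (simp add: s1)
        qed
        then show ?thesis
          unfolding gen2_def word_deriv_linear by (simp add: s1 s_def)
      qed
      then show "of_real (g \<alpha>) * cnj (word_eval w \<alpha>) *
        (avg N (\<lambda>r. cnj (s r) ^ Suc B * s r ^ (length \<alpha> - 1) * word_deriv z (generator (s r *s z)) \<alpha>)
          * avg N (\<lambda>q. s q ^ B * cnj (s q) ^ length \<alpha>))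
        = (if length \<alpha> = B then of_real (g \<alpha>) * (word_deriv z (gen2 z) \<alpha> * cnj (word_eval w \<alpha>)) else 0)"
        using \<alpha> BN by (simp add: orth)
    qed simp
    finally show ?thesis .
  qed

  \<comment> \<open>Here the \<open>z\<close>-average selects length \<open>B + 1\<close>. The
    powers of the root in the \<open>w\<close>-average then cancel completely, leaving
    \<open>gen0\<close>.\<close>
  have L2: "A (\<lambda>r q. cnj (s r) ^ Suc B * s q ^ B * cnj (kernel_deriv g (s q *s w) (s r *s z) (generator (s q *s w))))
      = homog_sum (Suc B) (\<lambda>\<alpha>. word_eval z \<alpha> * cnj (word_deriv w (gen0 w) \<alpha>))" (is "?l = _")
  proof -
    have "?l = A (\<lambda>r q. \<Sum>\<alpha> | g \<alpha> \<noteq> 0. (of_real (g \<alpha>) * word_eval z \<alpha>) *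
        ((cnj (s r) ^ Suc B * s r ^ length \<alpha>)
          * (s q ^ B * cnj (s q) ^ (length \<alpha> - 1) * cnj (word_deriv w (generator (s q *s w)) \<alpha>))))"
      unfolding kernel_deriv_def cnj_sum sum_distrib_left word_deriv_scale word_eval_scale complex_cnj_mult complex_cnj_power
        complex_cnj_complex_of_real complex_cnj_cnj
      by (intro arg_cong[where f = A] ext sum.cong refl) (simp only: mult_ac)
    also have "\<dots> = (\<Sum>\<alpha> | g \<alpha> \<noteq> 0. (of_real (g \<alpha>) * word_eval z \<alpha>) *
        (avg N (\<lambda>r. cnj (s r) ^ Suc B * s r ^ length \<alpha>)
          * avg N (\<lambda>q. s q ^ B * cnj (s q) ^ (length \<alpha> - 1) * cnj (word_deriv w (generator (s q *s w)) \<alpha>))))"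
      unfolding A_def by (rule avg_avg_sum)
    also have "\<dots> = homog_sum (Suc B) (\<lambda>\<alpha>. word_eval z \<alpha> * cnj (word_deriv w (gen0 w) \<alpha>))"
    proof (rule sum.cong)
      fix \<alpha> assume "\<alpha> \<in> {\<alpha>. g \<alpha> \<noteq> 0}"
      then have \<alpha>: "length \<alpha> + 2 < N" using len by auto
      have "avg N (\<lambda>q. s q ^ B * cnj (s q) ^ (length \<alpha> - 1) * cnj (word_deriv w (generator (s q *s w)) \<alpha>))
          = cnj (word_deriv w (gen0 w) \<alpha>)" if "length \<alpha> = Suc B"
      proof -
        have "s q ^ B * cnj (s q) ^ (length \<alpha> - 1) = 1" for q
          by (simp add: that s1 flip: power_mult_distrib)
        then show ?thesis
          unfolding gen0_def word_deriv_linear by (simp add: cnj_avg s_def)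
      qed
      then show "of_real (g \<alpha>) * word_eval z \<alpha> *
        (avg N (\<lambda>r. cnj (s r) ^ Suc B * s r ^ length \<alpha>)
          * avg N (\<lambda>q. s q ^ B * cnj (s q) ^ (length \<alpha> - 1) * cnj (word_deriv w (generator (s q *s w)) \<alpha>)))
        = (if length \<alpha> = Suc B then of_real (g \<alpha>) * (word_eval z \<alpha> * cnj (word_deriv w (gen0 w) \<alpha>)) else 0)"
        using \<alpha> BN by (simp add: orth' del: power_Suc)
    qed simp
    finally show ?thesis .
  qed

  have R: "A (\<lambda>r q. cnj (s r) ^ Suc B * s q ^ B * ((gen_form (s r *s z) + cnj (gen_form (s q *s w)))
        * (1 - series_kernel g (s r *s z) (s q *s w))))
     = gen_form z * ((if B = 0 then 1 else 0) - homog_sum B (\<lambda>\<alpha>. word_eval z \<alpha> * cnj (word_eval w \<alpha>)))"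
    (is "?l = _")
  proof -
    let ?c = "\<lambda>\<alpha>. of_real (g \<alpha>) * (word_eval z \<alpha> * cnj (word_eval w \<alpha>))"
    have "?l = A (\<lambda>r q. gen_form z * ((s r ^ 1 * cnj (s r) ^ Suc B) * (s q ^ B * cnj (s q) ^ 0))
       + cnj (gen_form w) * ((s r ^ 0 * cnj (s r) ^ Suc B) * (s q ^ B * cnj (s q) ^ 1))
       - gen_form z * (\<Sum>\<alpha> | g \<alpha> \<noteq> 0. ?c \<alpha> * ((s r ^ Suc (length \<alpha>) * cnj (s r) ^ Suc B) * (s q ^ B * cnj (s q) ^ length \<alpha>)))
       - cnj (gen_form w) * (\<Sum>\<alpha> | g \<alpha> \<noteq> 0. ?c \<alpha> * ((s r ^ length \<alpha> * cnj (s r) ^ Suc B) * (s q ^ B * cnj (s q) ^ Suc (length \<alpha>)))))"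
    proof (rule arg_cong[where f = A], intro ext)
      fix r q
      define S where "S = (\<Sum>\<alpha> | g \<alpha> \<noteq> 0. ?c \<alpha> * (s r ^ length \<alpha> * cnj (s q) ^ length \<alpha>))"
      have S: "series_kernel g (s r *s z) (s q *s w) = S"
        unfolding series_kernel_def S_def word_eval_scale
        by (intro sum.cong refl) (simp add: mult_ac)
      have S1: "(cnj (s r) ^ Suc B * s q ^ B * s r) * S
          = (\<Sum>\<alpha> | g \<alpha> \<noteq> 0. ?c \<alpha> * ((s r ^ Suc (length \<alpha>) * cnj (s r) ^ Suc B) * (s q ^ B * cnj (s q) ^ length \<alpha>)))"
        unfolding S_def sum_distrib_left by (intro sum.cong refl) (simp add: mult_ac)
      have S2: "(cnj (s r) ^ Suc B * s q ^ B * cnj (s q)) * S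
          = (\<Sum>\<alpha> | g \<alpha> \<noteq> 0. ?c \<alpha> * ((s r ^ length \<alpha> * cnj (s r) ^ Suc B) * (s q ^ B * cnj (s q) ^ Suc (length \<alpha>))))"
        unfolding S_def sum_distrib_left by (intro sum.cong refl) (simp add: mult_ac)
      show "cnj (s r) ^ Suc B * s q ^ B * ((gen_form (s r *s z) + cnj (gen_form (s q *s w)))
        * (1 - series_kernel g (s r *s z) (s q *s w)))
        = gen_form z * ((s r ^ 1 * cnj (s r) ^ Suc B) * (s q ^ B * cnj (s q) ^ 0))
       + cnj (gen_form w) * ((s r ^ 0 * cnj (s r) ^ Suc B) * (s q ^ B * cnj (s q) ^ 1))
       - gen_form z * (\<Sum>\<alpha> | g \<alpha> \<noteq> 0. ?c \<alpha> * ((s r ^ Suc (length \<alpha>) * cnj (s r) ^ Suc B) * (s q ^ B * cnj (s q) ^ length \<alpha>)))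
       - cnj (gen_form w) * (\<Sum>\<alpha> | g \<alpha> \<noteq> 0. ?c \<alpha> * ((s r ^ length \<alpha> * cnj (s r) ^ Suc B) * (s q ^ B * cnj (s q) ^ Suc (length \<alpha>))))"
        unfolding S1[symmetric] S2[symmetric] S gen_form_scale complex_cnj_mult power_0 power_one_right mult_1_left mult_1_right
        by (simp only: algebra_simps mult_1_left mult_1_right)
    qed
    also have "\<dots> = gen_form z * (avg N (\<lambda>r. s r ^ 1 * cnj (s r) ^ Suc B) * avg N (\<lambda>q. s q ^ B * cnj (s q) ^ 0))
       + cnj (gen_form w) * (avg N (\<lambda>r. s r ^ 0 * cnj (s r) ^ Suc B) * avg N (\<lambda>q. s q ^ B * cnj (s q) ^ 1))
       - gen_form z * (\<Sum>\<alpha> | g \<alpha> \<noteq> 0. ?c \<alpha> * (avg N (\<lambda>r. s r ^ Suc (length \<alpha>) * cnj (s r) ^ Suc B) * avg N (\<lambda>q. s q ^ B * cnj (s q) ^ length \<alpha>)))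
       - cnj (gen_form w) * (\<Sum>\<alpha> | g \<alpha> \<noteq> 0. ?c \<alpha> * (avg N (\<lambda>r. s r ^ length \<alpha> * cnj (s r) ^ Suc B) * avg N (\<lambda>q. s q ^ B * cnj (s q) ^ Suc (length \<alpha>))))"
      unfolding A_def by (simp only: avg_add avg_diff avg_cmult[of N "gen_form z"]
          avg_cmult[of N "cnj (gen_form w)"] avg_mult avg_avg_sum)
    also have "(\<Sum>\<alpha> | g \<alpha> \<noteq> 0. ?c \<alpha> * (avg N (\<lambda>r. s r ^ Suc (length \<alpha>) * cnj (s r) ^ Suc B) * avg N (\<lambda>q. s q ^ B * cnj (s q) ^ length \<alpha>)))
       = homog_sum B (\<lambda>\<alpha>. word_eval z \<alpha> * cnj (word_eval w \<alpha>))"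
    proof (rule sum.cong)
      fix \<alpha> assume "\<alpha> \<in> {\<alpha>. g \<alpha> \<noteq> 0}"
      then have "length \<alpha> + 2 < N" using len by auto
      then show "?c \<alpha> * (avg N (\<lambda>r. s r ^ Suc (length \<alpha>) * cnj (s r) ^ Suc B) * avg N (\<lambda>q. s q ^ B * cnj (s q) ^ length \<alpha>))
        = (if length \<alpha> = B then of_real (g \<alpha>) * (word_eval z \<alpha> * cnj (word_eval w \<alpha>)) else 0)"
        using BN by (simp add: orth del: power_Suc)
    qed simp
    \<comment> \<open>A surviving word would need length \<open>B + 1\<close> from the first average
      and length \<open>B - 1\<close> from the second.\<close>
    also have "(\<Sum>\<alpha> | g \<alpha> \<noteq> 0. ?c \<alpha> * (avg N (\<lambda>r. s r ^ length \<alpha> * cnj (s r) ^ Suc B) * avg N (\<lambda>q. s q ^ B * cnj (s q) ^ Suc (length \<alpha>)))) = 0"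
    proof (rule sum.neutral, rule ballI)
      fix \<alpha> assume "\<alpha> \<in> {\<alpha>. g \<alpha> \<noteq> 0}"
      then have "length \<alpha> + 2 < N" using len by auto
      then show "?c \<alpha> * (avg N (\<lambda>r. s r ^ length \<alpha> * cnj (s r) ^ Suc B) * avg N (\<lambda>q. s q ^ B * cnj (s q) ^ Suc (length \<alpha>))) = 0"
        using BN by (simp add: orth del: power_Suc)
    qed
    also have "avg N (\<lambda>r. s r ^ 1 * cnj (s r) ^ Suc B) * avg N (\<lambda>q. s q ^ B * cnj (s q) ^ 0) = (if B = 0 then 1 else 0)"
      using BN by (subst (1 2) orth) auto
    also have "avg N (\<lambda>r. s r ^ 0 * cnj (s r) ^ Suc B) = 0"
      using BN by (subst orth) auto
    finally show ?thesis by (simp add: right_diff_distrib)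
  qed

  have "A (\<lambda>r q. cnj (s r) ^ Suc B * s q ^ B * kernel_deriv g (s r *s z) (s q *s w) (generator (s r *s z)))
    + A (\<lambda>r q. cnj (s r) ^ Suc B * s q ^ B * cnj (kernel_deriv g (s q *s w) (s r *s z) (generator (s q *s w))))
    = A (\<lambda>r q. cnj (s r) ^ Suc B * s q ^ B * ((gen_form (s r *s z) + cnj (gen_form (s q *s w)))
        * (1 - series_kernel g (s r *s z) (s q *s w))))"
    using generator_skew[OF open_domain_rotate[OF _ z] open_domain_rotate[OF _ w]]
    unfolding A_def avg_add[symmetric] distrib_left[symmetric] by (simp add: s_def)
  then show ?thesis unfolding L1 L2 R .
qed

text \<open>This is bidegree \<open>(1, 0)\<close>: the support has no empty word, so only the
  linear terms in \<open>z\<close> remain, and \<open>z\<close> on an axis singles out one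
  coordinate. It acts as a mean value property of the vector field at the origin.\<close>

lemma gen0_eq:
  assumes w: "w \<in> \<D>"
  shows "gen0 w = generator 0"
proof (rule vec_eq_iff[THEN iffD2], rule allI)
  fix i
  obtain \<epsilon> :: real where \<epsilon>: "\<epsilon> > 0" "of_real \<epsilon> *s axis i 1 \<in> \<D>" using absorbing .
  define z :: "complex ^ 'n" where "z = of_real \<epsilon> *s axis i 1"
  have z: "z \<in> \<D>" using \<epsilon> by (simp add: z_def)
  have "homog_sum 0 F = 0" for F
    by (rule sum.neutral) (auto simp: coeffs)
  moreover have "homog_sum (Suc 0) (\<lambda>\<alpha>. word_eval z \<alpha> * cnj (word_deriv w (gen0 w) \<alpha>))
      = (\<Sum>j\<in>UNIV. of_real (g [j]) * (z $ j * cnj (gen0 w $ j)))"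
    using sum_length_1[OF g, of "\<lambda>\<alpha>. of_real (g \<alpha>) * (word_eval z \<alpha> * cnj (word_deriv w (gen0 w) \<alpha>))"] by simp
  ultimately have "(\<Sum>j\<in>UNIV. of_real (g [j]) * (z $ j * cnj (gen0 w $ j))) = gen_form z"
    using generator_homogeneous[OF z w, of 0] by simp
  moreover have "of_real (g [j]) * (z $ j * cnj (u $ j)) = (if j = i then of_real (g [i]) * (of_real \<epsilon> * cnj (u $ i)) else 0)" for j u
    by (simp add: z_def axis_def)
  ultimately show "gen0 w $ i = generator 0 $ i"
    using \<epsilon> coeffs(6)[of i] by (simp add: gen_form_def mult.assoc)
qed

text \<open>Bidegree \<open>(2, 1)\<close> with \<open>w\<close> on the \<open>i\<close>-th axis. A
  two-letter word contributes when \<open>i\<close> is its first or its last letter, whence the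
  symmetrised coefficient \<open>g [j, i] + g [i, j]\<close>.\<close>

lemma gen2_eq:
  assumes z: "z \<in> \<D>" and d: "degree \<ge> 2"
  shows "gen2 z $ i = - (gen_form z + (\<Sum>j\<in>UNIV. of_real (g [j, i] + g [i, j]) * (z $ j * cnj (generator 0 $ j)))
           / of_real (g [i])) * z $ i"
proof -
  obtain \<epsilon> :: real where \<epsilon>: "\<epsilon> > 0" "of_real \<epsilon> *s axis i 1 \<in> \<D>" using absorbing .
  define w :: "complex ^ 'n" where "w = of_real \<epsilon> *s axis i 1"
  define a where "a = generator 0"
  have w: "w \<in> \<D>" using \<epsilon> by (simp add: w_def)
  have wj: "w $ j = (if j = i then of_real \<epsilon> else 0)" for j by (simp add: w_def axis_def)
  have 1: "homog_sum 1 (\<lambda>\<alpha>. word_deriv z u \<alpha> * cnj (word_eval w \<alpha>))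
      = of_real (g [i]) * u $ i * of_real \<epsilon>" for u
  proof -
    have "homog_sum 1 (\<lambda>\<alpha>. word_deriv z u \<alpha> * cnj (word_eval w \<alpha>))
        = (\<Sum>j\<in>UNIV. of_real (g [j]) * (u $ j * cnj (w $ j)))"
      using sum_length_1[OF g, of "\<lambda>\<alpha>. of_real (g \<alpha>) * (word_deriv z u \<alpha> * cnj (word_eval w \<alpha>))"] by simp
    also have "\<dots> = (\<Sum>j\<in>UNIV. if j = i then of_real (g [i]) * u $ i * of_real \<epsilon> else 0)"
      by (rule sum.cong) (auto simp: wj)
    finally show ?thesis by simp
  qed
  have 2: "homog_sum 2 (\<lambda>\<alpha>. word_eval z \<alpha> * cnj (word_deriv w a \<alpha>))
      = of_real \<epsilon> * z $ i * (\<Sum>j\<in>UNIV. of_real (g [j, i] + g [i, j]) * (z $ j * cnj (a $ j)))"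
  proof -
    have "homog_sum 2 (\<lambda>\<alpha>. word_eval z \<alpha> * cnj (word_deriv w a \<alpha>))
        = (\<Sum>j\<in>UNIV. \<Sum>k\<in>UNIV. of_real (g [j, k]) * (z $ j * z $ k * cnj (a $ j * w $ k + w $ j * a $ k)))"
      by (simp add: sum_length_2[OF g(2)] mult.assoc)
    also have "\<dots> = (\<Sum>j\<in>UNIV. \<Sum>k\<in>UNIV. if k = i then of_real (g [j, i]) * (z $ j * z $ i * cnj (a $ j) * of_real \<epsilon>) else 0)
      + (\<Sum>j\<in>UNIV. \<Sum>k\<in>UNIV. if j = i then of_real (g [i, k]) * (z $ i * z $ k * cnj (a $ k) * of_real \<epsilon>) else 0)"
      unfolding sum.distrib[symmetric] by (intro sum.cong refl) (auto simp: wj algebra_simps)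
    also have "(\<Sum>j\<in>UNIV. \<Sum>k\<in>UNIV. if j = i then of_real (g [i, k]) * (z $ i * z $ k * cnj (a $ k) * of_real \<epsilon>) else 0)
      = (\<Sum>k\<in>UNIV. of_real (g [i, k]) * (z $ i * z $ k * cnj (a $ k) * of_real \<epsilon>))"
      by (subst sum.swap) simp
    finally show ?thesis
      by (simp add: sum_distrib_left sum.distrib[symmetric] algebra_simps)
  qed
  have 3: "homog_sum 1 (\<lambda>\<alpha>. word_eval z \<alpha> * cnj (word_eval w \<alpha>)) = of_real (g [i]) * z $ i * of_real \<epsilon>"
  proof -
    have "homog_sum 1 (\<lambda>\<alpha>. word_eval z \<alpha> * cnj (word_eval w \<alpha>))
        = homog_sum 1 (\<lambda>\<alpha>. word_deriv z z \<alpha> * cnj (word_eval w \<alpha>))"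
      by (rule sum.cong) (auto simp: length_Suc_conv)
    then show ?thesis by (simp only: 1)
  qed
  have Suc1: "Suc 1 = 2" by simp
  have "of_real (g [i]) * gen2 z $ i * of_real \<epsilon>
      + of_real \<epsilon> * z $ i * (\<Sum>j\<in>UNIV. of_real (g [j, i] + g [i, j]) * (z $ j * cnj (a $ j)))
      = gen_form z * (0 - of_real (g [i]) * z $ i * of_real \<epsilon>)"
    using generator_homogeneous[OF z w, of 1] d unfolding gen0_eq[OF w] a_def[symmetric] Suc1 1 2 3
    by simp
  \<comment> \<open>The rearrangement is stated for free variables so that the sums are opaque to
    \<open>algebra\<close>.\<close>
  moreover have "G * u * e + e * c * S = l * (0 - G * c * e) \<Longrightarrow> e * (G * u) = e * (- c * S - l * G * c)"
    for e G u c S l :: complex by algebra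
  ultimately have "of_real \<epsilon> * (of_real (g [i]) * gen2 z $ i) = of_real \<epsilon> * (- z $ i * (\<Sum>j\<in>UNIV. of_real (g [j, i] + g [i, j]) * (z $ j * cnj (a $ j)))
      - gen_form z * of_real (g [i]) * z $ i)" by blast
  then have "of_real (g [i]) * gen2 z $ i = - z $ i * (\<Sum>j\<in>UNIV. of_real (g [j, i] + g [i, j]) * (z $ j * cnj (a $ j)))
      - gen_form z * of_real (g [i]) * z $ i" using \<epsilon> by simp
  moreover have "G * u = - c * S - l * G * c \<Longrightarrow> G \<noteq> 0 \<Longrightarrow> u = - (l + S / G) * c"
    for G u c S l :: complex by (simp add: field_simps)
  moreover have "complex_of_real (g [i]) \<noteq> 0"
    using coeffs(6)[of i] by simp
  ultimately show ?thesis
    unfolding a_def[symmetric] by blast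
qed

text \<open>At a suitable \<open>z\<close> the field \<open>gen2\<close> scales coordinate
  \<open>i\<close> by \<open>- \<rho> i\<close>, where \<open>\<rho> i \<ge> L\<close> and
  \<open>L \<ge> 0\<close> is the value of \<open>gen_form z\<close>. Words of length
  \<open>degree\<close> are therefore scaled by at most \<open>- degree * L\<close>, but since no
  longer words exist the identity in bidegree \<open>(degree + 1, degree)\<close> demands
  \<open>- L\<close> on their positively weighted sum. With \<open>degree \<ge> 2\<close> this
  forces \<open>L = 0\<close>, and \<open>L\<close> is a positive combination of the squares
  \<open>(cmod (a $ j))\<^sup>2\<close>.\<close>

lemma generator_0:
  assumes \<gamma>: "g \<gamma> \<noteq> 0" "length \<gamma> \<ge> 2"
  shows "generator 0 = 0"
proof -
  have d: "degree \<ge> 2" using length_le_degree[OF \<gamma>(1)] \<gamma>(2) by simp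
  obtain \<delta> where \<delta>: "g \<delta> \<noteq> 0" "length \<delta> = degree"
  proof -
    have "degree \<in> length ` {\<alpha>. g \<alpha> \<noteq> 0}"
      unfolding degree_def using coeffs \<gamma> by (intro Max_in) auto
    then show thesis using that by auto
  qed
  define a where "a = generator 0"
  \<comment> \<open>Aligned with \<open>a\<close>, so that each \<open>z $ j * cnj (a $ j)\<close>
    is nonnegative. The entry 1 where \<open>a\<close> vanishes keeps every
    \<open>word_eval z \<alpha>\<close> nonzero.\<close>
  define u :: "complex ^ 'n" where "u = (\<chi> j. if a $ j = 0 then 1 else a $ j)"
  obtain \<epsilon> :: real where \<epsilon>: "\<epsilon> > 0" "of_real \<epsilon> *s u \<in> \<D>" using absorbing .
  define z where "z = of_real \<epsilon> *s u"
  have z: "z \<in> \<D>" using \<epsilon> by (simp add: z_def)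
  have znz: "z $ j \<noteq> 0" for j using \<epsilon> by (auto simp: z_def u_def)
  define x where "x j = \<epsilon> * (cmod (a $ j))\<^sup>2" for j
  have x: "x j \<ge> 0" for j using \<epsilon> by (simp add: x_def)
  have zx: "z $ j * cnj (a $ j) = of_real (x j)" for j
    by (auto simp: z_def u_def x_def complex_norm_square mult.assoc simp del: of_real_power)
  define L where "L = (\<Sum>j\<in>UNIV. g [j] * x j)"
  have L: "gen_form z = of_real L"
    by (simp add: gen_form_def L_def zx mult.assoc flip: a_def)
  have L0: "L \<ge> 0" unfolding L_def by (intro sum_nonneg mult_nonneg_nonneg x coeffs)
  define \<rho> where "\<rho> i = L + (\<Sum>j\<in>UNIV. (g [j, i] + g [i, j]) * x j) / g [i]" for i
  have \<rho>: "\<rho> i \<ge> L" for i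
    unfolding \<rho>_def using x coeffs(4,6) by (auto intro!: divide_nonneg_pos sum_nonneg)
  have g2: "gen2 z $ i = of_real (- \<rho> i) * z $ i" for i
    unfolding gen2_eq[OF z d] a_def[symmetric] L zx \<rho>_def by simp
  define R where "R \<alpha> = sum_list (map \<rho> \<alpha>)" for \<alpha>
  have R: "R \<alpha> \<ge> length \<alpha> * L" for \<alpha>
    unfolding R_def by (induction \<alpha>) (auto simp: algebra_simps intro: add_mono \<rho>)
  have wd: "word_deriv z (gen2 z) \<alpha> = - of_real (R \<alpha>) * word_eval z \<alpha>" for \<alpha>
  proof -
    have "sum_list (map (\<lambda>i. complex_of_real (- \<rho> i)) \<alpha>) = - of_real (R \<alpha>)"
      unfolding R_def by (induction \<alpha>) auto
    then show ?thesis using word_deriv_eigen[OF g2] by simp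
  qed
  have "homog_sum (Suc degree) F = 0" for F
  proof (rule sum.neutral, rule ballI)
    fix \<alpha> assume "\<alpha> \<in> {\<alpha>. g \<alpha> \<noteq> 0}"
    then have "length \<alpha> \<le> degree" using length_le_degree by auto
    then show "(if length \<alpha> = Suc degree then of_real (g \<alpha>) * F \<alpha> else 0) = 0" by simp
  qed
  then have "homog_sum degree (\<lambda>\<alpha>. word_deriv z (gen2 z) \<alpha> * cnj (word_eval z \<alpha>))
      = - of_real L * homog_sum degree (\<lambda>\<alpha>. word_eval z \<alpha> * cnj (word_eval z \<alpha>))"
    using generator_homogeneous[OF z z, of degree] d by (simp add: L)
  then have "homog_sum degree (\<lambda>\<alpha>. word_deriv z (gen2 z) \<alpha> * cnj (word_eval z \<alpha>))
      + of_real L * homog_sum degree (\<lambda>\<alpha>. word_eval z \<alpha> * cnj (word_eval z \<alpha>)) = 0" by simp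
  also have "homog_sum degree (\<lambda>\<alpha>. word_deriv z (gen2 z) \<alpha> * cnj (word_eval z \<alpha>))
      + of_real L * homog_sum degree (\<lambda>\<alpha>. word_eval z \<alpha> * cnj (word_eval z \<alpha>))
     = of_real (- (\<Sum>\<alpha> | g \<alpha> \<noteq> 0. if length \<alpha> = degree then g \<alpha> * (cmod (word_eval z \<alpha>))\<^sup>2 * (R \<alpha> - L) else 0))"
    unfolding sum_distrib_left sum.distrib[symmetric] of_real_minus of_real_sum sum_negf[symmetric]
    by (rule sum.cong) (auto simp: wd complex_norm_square algebra_simps simp del: of_real_power)
  finally have "(\<Sum>\<alpha> | g \<alpha> \<noteq> 0. if length \<alpha> = degree then g \<alpha> * (cmod (word_eval z \<alpha>))\<^sup>2 * (R \<alpha> - L) else 0) = 0"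
    by (simp only: of_real_eq_0_iff neg_equal_0_iff_equal)
  moreover have "(if length \<alpha> = degree then g \<alpha> * (cmod (word_eval z \<alpha>))\<^sup>2 * (R \<alpha> - L) else 0) \<ge> 0" for \<alpha>
  proof -
    have "R \<alpha> \<ge> L" if "length \<alpha> = degree"
    proof -
      have "1 * L \<le> real (length \<alpha>) * L" using d that L0 by (intro mult_right_mono) auto
      then show ?thesis using R[of \<alpha>] by simp
    qed
    then show ?thesis using coeffs(4) by auto
  qed
  ultimately have "(if length \<delta> = degree then g \<delta> * (cmod (word_eval z \<delta>))\<^sup>2 * (R \<delta> - L) else 0) = 0"
    using sum_nonneg_0[OF coeffs(8), where f = "\<lambda>\<alpha>. if length \<alpha> = degree
      then g \<alpha> * (cmod (word_eval z \<alpha>))\<^sup>2 * (R \<alpha> - L) else 0" and i = \<delta>] \<delta>(1)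
    by (simp only: mem_Collect_eq not_False_eq_True)
  moreover have "word_eval z \<delta> \<noteq> 0"
    using znz by (induction \<delta>) auto
  ultimately have "R \<delta> = L" using \<delta> by simp
  then have "real degree * L \<le> L" using R[of \<delta>] \<delta> by simp
  moreover have "2 * L \<le> real degree * L" using d L0 by (intro mult_right_mono) auto
  ultimately have "L = 0" using L0 by linarith
  then have "g [j] * x j = 0" for j
    unfolding L_def using sum_nonneg_eq_0_iff[of UNIV "\<lambda>j. g [j] * x j"] x coeffs(4) by simp
  then have "x j = 0" for j using coeffs(6)[of j] by (metis less_irrefl mult_eq_0_iff)
  then have "a $ j = 0" for j using \<epsilon> by (simp add: x_def)
  then show ?thesis by (simp add: a_def vec_eq_iff)
qed

text \<open>Since \<open>generator 0 = 0\<close>, the derivative \<open>rotation_deriv 0 w\<close>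
  is the same for all \<open>w\<close>. By surjectivity \<open>y = \<phi> w\<close> ranges over the
  whole domain of \<open>f\<close>, and \<open>y = 0\<close> shows that this constant is zero. What
  remains is an identity in \<open>y\<close> whose linear part at \<open>y = p\<close> is
  \<open>\<i>\<close> times the sum of \<open>f [i] * (cmod (p $ i))\<^sup>2\<close>.\<close>

theorem image_0:
  assumes "g \<gamma> \<noteq> 0" "length \<gamma> \<ge> 2"
  shows "\<phi> 0 = 0"
proof -
  define p where "p = \<phi> 0"
  define \<mu> where "\<mu> = rotation_deriv 0 0"
  have eq: "(\<Sum>\<alpha> | f \<alpha> \<noteq> 0. of_real (f \<alpha>) * (\<i> * of_nat (length \<alpha>)) * word_eval p \<alpha> * cnj (word_eval y \<alpha>))
      = - \<mu> * (1 - series_kernel f p y)" if "y \<in> open_domain f" for y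
  proof -
    obtain w where w: "w \<in> \<D>" "y = \<phi> w"
      using \<open>y \<in> open_domain f\<close> bij_betw_imp_surj_on[OF bij] by blast
    have "kernel_deriv g 0 w 0 = 0"
      by (simp add: kernel_deriv_at_0[OF g])
    then have "rotation_deriv 0 w = \<mu>"
      using rotation_deriv_eq[of 0 w] w(1) generator_0[OF assms]
      by (simp add: \<mu>_def coeffs)
    then show ?thesis
      using kernel[of 0 w] w h[of 0] h[OF w(1)]
      by (simp add: rotation_deriv_def coeffs p_def divide_eq_eq minus_equation_iff)
  qed
  have "\<mu> = 0"
  proof -
    have "word_eval 0 \<alpha> = (0 :: complex)" if "f \<alpha> \<noteq> 0" for \<alpha> :: "'n list"
      using that coeffs(1) by (metis word_eval_0)
    then show ?thesis
      using eq[OF zero_in_open_domain[of f, OF coeffs(1)]] by (simp add: coeffs)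
  qed
  define K where "K = 2 + Max (length ` {\<alpha>. f \<alpha> \<noteq> 0})"
  have K: "length \<alpha> < K" if "f \<alpha> \<noteq> 0" for \<alpha>
  proof -
    have "length \<alpha> \<le> Max (length ` {\<alpha>. f \<alpha> \<noteq> 0})"
      using that coeffs by (intro Max_ge) auto
    then show ?thesis by (simp add: K_def)
  qed
  have K2: "Suc 0 < K" by (simp add: K_def)
  have p: "p \<in> open_domain f" using bij by (auto simp: p_def bij_betw_def)
  \<comment> \<open>Averaging over the rotations of \<open>y = p\<close> extracts that linear
    part.\<close>
  have "0 = avg K (\<lambda>r. root_of_1 K r * (\<Sum>\<alpha> | f \<alpha> \<noteq> 0. of_real (f \<alpha>) * (\<i> * of_nat (length \<alpha>)) * word_eval p \<alpha> * cnj (word_eval (root_of_1 K r *s p) \<alpha>)))"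
    by (subst eq) (simp_all add: open_domain_rotate p \<open>\<mu> = 0\<close> avg_def)
  also have "\<dots> = avg K (\<lambda>r. \<Sum>\<alpha> | f \<alpha> \<noteq> 0. of_real (f \<alpha>) * (\<i> * of_nat (length \<alpha>)) * word_eval p \<alpha> * cnj (word_eval p \<alpha>)
      * (root_of_1 K r ^ 1 * cnj (root_of_1 K r) ^ length \<alpha>))"
    by (simp add: word_eval_scale sum_distrib_left mult_ac)
  also have "\<dots> = (\<Sum>\<alpha> | f \<alpha> \<noteq> 0. if length \<alpha> = 1 then of_real (f \<alpha>) * (\<i> * of_nat (length \<alpha>)) * word_eval p \<alpha> * cnj (word_eval p \<alpha>) else 0)"
    unfolding avg_sum avg_cmult
    by (intro sum.cong refl, subst avg_root_of_1) (auto simp: K K2)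
  also have "\<dots> = (\<Sum>i\<in>UNIV. of_real (f [i]) * \<i> * p $ i * cnj (p $ i))"
    by (simp only: sum_length_1[OF f]) simp
  also have "\<dots> = \<i> * of_real (\<Sum>i\<in>UNIV. f [i] * (cmod (p $ i))\<^sup>2)"
    by (simp add: sum_distrib_left complex_norm_square mult_ac del: of_real_power)
  finally have "(\<Sum>i\<in>UNIV. f [i] * (cmod (p $ i))\<^sup>2) = 0"
    by (simp only: mult_eq_0_iff[where 'a = complex] of_real_eq_0_iff complex_i_not_zero simp_thms eq_commute[of 0])
  then have "f [i] * (cmod (p $ i))\<^sup>2 = 0" for i
    using sum_nonneg_eq_0_iff[of UNIV "\<lambda>i. f [i] * (cmod (p $ i))\<^sup>2"] coeffs(3) by simp
  then have "p $ i = 0" for i using coeffs(5)[of i] by (metis less_irrefl mult_eq_0_iff norm_eq_zero power_eq_0_iff)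
  then show ?thesis by (simp add: p_def vec_eq_iff)
qed

end

section \<open>Operators in the noncommutative domain algebra\<close>

lemma ell2_eqI: "(\<And>i. ell2_coord x i = ell2_coord y i) \<Longrightarrow> x = y"
  by (rule ell2_coord_inject[THEN iffD1], rule ext)

lemmas ell2_coord_simps [simp] = plus_ell2.rep_eq minus_ell2.rep_eq uminus_ell2.rep_eq
  zero_ell2.rep_eq scaleR_ell2.rep_eq scaleC_ell2.rep_eq ell2_basis.rep_eq

lemma ell2_coord_sum: "ell2_coord (\<Sum>a\<in>S. x a) i = (\<Sum>a\<in>S. ell2_coord (x a) i)"
  by (induction S rule: infinite_finite_induct) auto

lemma norm_ell2_coord_le: "cmod (ell2_coord x i) \<le> norm x"
proof -
  have "(cmod (ell2_coord x i))\<^sup>2 \<le> (\<Sum>\<^sub>\<infinity>i. (cmod (ell2_coord x i))\<^sup>2)"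
    using finite_sum_le_infsum[OF ell2_coord_summable[of x], of "{i}"] by simp
  then show ?thesis unfolding norm_ell2_eq by (rule real_le_rsqrt)
qed

lemma bounded_linear_ell2_coord: "bounded_linear (\<lambda>x. ell2_coord x i)"
  by (rule bounded_linear_intro[of _ 1])
    (auto simp: norm_ell2_coord_le scaleR_conv_of_real)

lemma scaleC_ell2_add: "scaleC_ell2 c (x + y) = scaleC_ell2 c x + scaleC_ell2 c y"
  by (rule ell2_eqI) (simp add: distrib_left)

text \<open>The inner product of the type \<open>ell2\<close> is only the real part of this one
  (\<open>Re_cinner\<close>), while reproducing kernels need the complex value.\<close>

definition cinner :: "'a ell2 \<Rightarrow> 'a ell2 \<Rightarrow> complex" where
  "cinner x y = (\<Sum>\<^sub>\<infinity>i. ell2_coord x i * cnj (ell2_coord y i))"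

lemma cinner_summable: "(\<lambda>i. ell2_coord x i * cnj (ell2_coord y i)) summable_on UNIV"
proof (rule Infinite_Sum.abs_summable_summable, rule Infinite_Sum.abs_summable_on_comparison_test')
  show "(\<lambda>i. (cmod (ell2_coord x i))\<^sup>2 + (cmod (ell2_coord y i))\<^sup>2) summable_on UNIV"
    by (intro summable_on_add ell2_coord_summable)
  fix i
  have "norm (ell2_coord x i * cnj (ell2_coord y i)) \<le> 2 * cmod (ell2_coord x i) * cmod (ell2_coord y i)"
    by (simp add: norm_mult)
  also have "\<dots> \<le> (cmod (ell2_coord x i))\<^sup>2 + (cmod (ell2_coord y i))\<^sup>2"
    by (rule sum_squares_bound)
  finally show "norm (ell2_coord x i * cnj (ell2_coord y i))
      \<le> (cmod (ell2_coord x i))\<^sup>2 + (cmod (ell2_coord y i))\<^sup>2" .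
qed

lemma has_sum_cinner: "((\<lambda>i. ell2_coord x i * cnj (ell2_coord y i)) has_sum cinner x y) UNIV"
  unfolding cinner_def using cinner_summable by (rule has_sum_infsum)

lemma Re_cinner: "Re (cinner x y) = x \<bullet> y"
  unfolding cinner_def infsum_Re[OF cinner_summable, symmetric] inner_ell2.rep_eq
  by (simp add: inner_complex_def)

lemma cinner_add_left: "cinner (x + y) z = cinner x z + cinner y z"
  by (simp add: cinner_def distrib_right infsum_add cinner_summable)

lemma cinner_scaleC_left: "cinner (scaleC_ell2 c x) y = c * cinner x y"
  by (simp add: cinner_def mult.assoc infsum_cmult_right')

lemma cinner_commute: "cinner y x = cnj (cinner x y)"
  unfolding cinner_def infsum_cnj[symmetric] by (simp add: mult.commute)

lemma cinner_scaleC_right: "cinner x (scaleC_ell2 c y) = cnj c * cinner x y"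
  by (simp add: cinner_commute[of x] cinner_scaleC_left)

lemma norm_cinner_le: "cmod (cinner x y) \<le> norm x * norm y"
proof (cases "cinner x y = 0")
  case False
  \<comment> \<open>A unimodular factor that rotates the inner product onto the positive real axis,
    where the real Cauchy-Schwarz inequality applies.\<close>
  define c where "c = cnj (cinner x y) / cmod (cinner x y)"
  have "cmod (cinner x y) = Re (c * cinner x y)"
  proof -
    have "c * cinner x y = (cinner x y * cnj (cinner x y)) / cmod (cinner x y)"
      by (simp add: c_def mult.commute)
    also have "\<dots> = of_real ((cmod (cinner x y))\<^sup>2 / cmod (cinner x y))"
      by (simp only: complex_norm_square of_real_divide)
    finally show ?thesis by (simp add: power2_eq_square)
  qed
  also have "\<dots> = scaleC_ell2 c x \<bullet> y"
    by (simp only: cinner_scaleC_left[symmetric] Re_cinner)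
  also have "\<dots> \<le> norm (scaleC_ell2 c x) * norm y" by (rule norm_cauchy_schwarz)
  also have "norm (scaleC_ell2 c x) = norm x"
    using False by (simp add: norm_scaleC_ell2 c_def norm_divide)
  finally show ?thesis .
qed simp

lemma bounded_linear_cinner: "bounded_linear (\<lambda>x. cinner x y)"
proof (rule bounded_linear_intro)
  show "cinner (r *\<^sub>R x) y = r *\<^sub>R cinner x y" for r x
    using cinner_scaleC_left[of "of_real r" x y]
    by (simp add: scaleR_conv_of_real) (metis ell2_eqI scaleC_ell2.rep_eq scaleR_ell2.rep_eq)
qed (rule cinner_add_left, rule norm_cinner_le)

section \<open>The weights as coefficients of a geometric series\<close>

definition word_factorizations :: "'n list \<Rightarrow> 'n list list set" where
  "word_factorizations \<alpha> = {\<gamma>s. concat \<gamma>s = \<alpha> \<and> [] \<notin> set \<gamma>s}"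

lemma word_factorizations_Nil [simp]: "word_factorizations [] = {[]}"
  by (auto simp: word_factorizations_def) (metis list.set_intros(1) neq_Nil_conv)

lemma length_word_factorization:
  assumes "\<gamma>s \<in> word_factorizations \<alpha>"
  shows "length \<gamma>s \<le> length \<alpha>"
proof -
  have "[] \<notin> set \<gamma>s \<Longrightarrow> length \<gamma>s \<le> length (concat \<gamma>s)"
  proof (induction \<gamma>s)
    case (Cons \<gamma> \<gamma>s)
    then show ?case by (cases \<gamma>) auto
  qed simp
  then show ?thesis using assms by (auto simp: word_factorizations_def)
qed

lemma word_factorizations_eq: "word_factorizations \<alpha> = (\<Union>j\<le>length \<alpha>. factorizations \<alpha> j)"
proof -
  have "[] \<notin> A \<longleftrightarrow> (\<forall>\<gamma>\<in>A. length \<gamma> \<ge> 1)" for A :: "'a list set"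
    by (metis One_nat_def length_greater_0_conv less_eq_Suc_le)
  then show ?thesis
    using length_word_factorization[of _ \<alpha>]
    unfolding word_factorizations_def factorizations_def by auto
qed

lemma finite_word_factorizations: "finite (word_factorizations (\<alpha> :: 'n::finite list))"
  by (simp add: word_factorizations_eq finite_factorizations)

lemma weight_eq:
  fixes f :: "'n::finite series"
  shows "weight f \<alpha> = (\<Sum>\<gamma>s\<in>word_factorizations \<alpha>. prod_list (map f \<gamma>s))"
proof (cases "\<alpha> = []")
  case False
  have "(\<Sum>\<gamma>s\<in>word_factorizations \<alpha>. prod_list (map f \<gamma>s))
      = (\<Sum>j\<le>length \<alpha>. \<Sum>\<gamma>s\<in>factorizations \<alpha> j. prod_list (map f \<gamma>s))"
    unfolding word_factorizations_eq
    by (rule sum.UNION_disjoint) (auto simp: finite_factorizations, auto simp: factorizations_def)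
  also have "\<dots> = (\<Sum>j=1..length \<alpha>. \<Sum>\<gamma>s\<in>factorizations \<alpha> j. prod_list (map f \<gamma>s))"
  proof (rule sum.mono_neutral_right)
    have "factorizations \<alpha> 0 = {}" using False by (auto simp: factorizations_def)
    then show "\<forall>j\<in>{..length \<alpha>} - {1..length \<alpha>}. (\<Sum>\<gamma>s\<in>factorizations \<alpha> j. prod_list (map f \<gamma>s)) = 0"
      by (auto simp: not_le)
  qed auto
  finally show ?thesis using False by (simp add: weight_def)
qed (simp add: weight_def)

text \<open>Splits off the first factor of a factorization, which is a nonempty prefix of the
  word.\<close>

lemma weight_split:
  fixes f :: "'n::finite series"
  assumes "\<beta> \<noteq> []"
  shows "weight f \<beta> = (\<Sum>k = 1..length \<beta>. f (take k \<beta>) * weight f (drop k \<beta>))"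
proof -
  have "word_factorizations \<beta> = (\<Union>k\<in>{1..length \<beta>}. (#) (take k \<beta>) ` word_factorizations (drop k \<beta>))"
  proof (intro equalityI subsetI)
    fix \<gamma>s assume \<gamma>s: "\<gamma>s \<in> word_factorizations \<beta>"
    with assms obtain \<gamma> \<delta>s where c: "\<gamma>s = \<gamma> # \<delta>s"
      by (cases \<gamma>s) (auto simp: word_factorizations_def)
    with \<gamma>s have "\<beta> = \<gamma> @ concat \<delta>s" "\<gamma> \<noteq> []" "[] \<notin> set \<delta>s"
      by (auto simp: word_factorizations_def)
    then have "length \<gamma> \<in> {1..length \<beta>}" "\<gamma>s \<in> (#) (take (length \<gamma>) \<beta>) ` word_factorizations (drop (length \<gamma>) \<beta>)"
      using c by (auto simp: word_factorizations_def Suc_le_eq)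
    then show "\<gamma>s \<in> (\<Union>k\<in>{1..length \<beta>}. (#) (take k \<beta>) ` word_factorizations (drop k \<beta>))" by blast
  qed (use assms in \<open>auto simp: word_factorizations_def\<close>)
  then have "weight f \<beta> = (\<Sum>k = 1..length \<beta>. \<Sum>\<gamma>s\<in>(#) (take k \<beta>) ` word_factorizations (drop k \<beta>).
      prod_list (map f \<gamma>s))"
    unfolding weight_eq
    by (simp only:, intro sum.UNION_disjoint)
      (auto simp: finite_word_factorizations, metis length_take min.absorb2)
  also have "\<dots> = (\<Sum>k = 1..length \<beta>. f (take k \<beta>) * weight f (drop k \<beta>))"
    by (rule sum.cong) (auto simp: weight_eq sum.reindex sum_distrib_left)
  finally show ?thesis .
qed

text \<open>Coefficient form of \<open>b = 1 + f b\<close>: the weights are the coefficients of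
  \<open>1 / (1 - f)\<close>. Indexing by the support of \<open>f\<close>, rather than by prefix
  lengths, lets this sum be exchanged with sums over \<open>\<beta>\<close>.\<close>

lemma weight_prefixes:
  fixes f :: "'n::finite series"
  assumes f: "regular_positive f" "free_polynomial f" and "\<beta> \<noteq> []"
  shows "weight f \<beta> = (\<Sum>\<alpha> | f \<alpha> \<noteq> 0. if take (length \<alpha>) \<beta> = \<alpha> then f \<alpha> * weight f (drop (length \<alpha>) \<beta>) else 0)"
proof -
  have f0: "f [] = 0" using f by (simp add: regular_positive_def)
  have "weight f \<beta> = (\<Sum>k\<in>{k. 1 \<le> k \<and> k \<le> length \<beta> \<and> f (take k \<beta>) \<noteq> 0}. f (take k \<beta>) * weight f (drop k \<beta>))"
    unfolding weight_split[OF assms(3)] by (rule sum.mono_neutral_right) auto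
  also have "\<dots> = (\<Sum>\<alpha> | f \<alpha> \<noteq> 0 \<and> take (length \<alpha>) \<beta> = \<alpha>. f \<alpha> * weight f (drop (length \<alpha>) \<beta>))"
  proof (rule sum.reindex_bij_witness[of _ length "\<lambda>k. take k \<beta>"])
    fix \<alpha> assume \<alpha>: "\<alpha> \<in> {\<alpha>. f \<alpha> \<noteq> 0 \<and> take (length \<alpha>) \<beta> = \<alpha>}"
    then have "length \<alpha> \<le> length \<beta>" by (metis (mono_tags) length_take mem_Collect_eq min.cobounded1)
    moreover have "\<alpha> \<noteq> []" using \<alpha> f0 by auto
    ultimately show "length \<alpha> \<in> {k. 1 \<le> k \<and> k \<le> length \<beta> \<and> f (take k \<beta>) \<noteq> 0}"
      using \<alpha> by (auto simp: Suc_le_eq)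
  qed auto
  also have "\<dots> = (\<Sum>\<alpha> | f \<alpha> \<noteq> 0. if take (length \<alpha>) \<beta> = \<alpha> then f \<alpha> * weight f (drop (length \<alpha>) \<beta>) else 0)"
    using f(2) by (simp add: free_polynomial_def flip: sum.inter_filter)
  finally show ?thesis .
qed

lemma has_sum_prefix:
  assumes "(F has_sum s) UNIV"
  shows "((\<lambda>\<beta>. if take (length \<alpha>) \<beta> = \<alpha> then F (drop (length \<alpha>) \<beta>) else 0) has_sum s) UNIV"
    (is "(?G has_sum s) UNIV")
proof -
  have "(?G has_sum s) (range ((@) \<alpha>))"
    by (subst has_sum_reindex) (use assms in \<open>auto simp: o_def inj_on_def\<close>)
  also have "(?G has_sum s) (range ((@) \<alpha>)) \<longleftrightarrow> (?G has_sum s) UNIV"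
  proof (rule has_sum_cong_neutral)
    fix \<beta> assume "\<beta> \<in> UNIV - range ((@) \<alpha>)"
    then show "?G \<beta> = 0" by auto (metis append_take_drop_id rangeI)
  qed auto
  finally show ?thesis .
qed

lemma has_sum_finite_sum:
  fixes F :: "'a \<Rightarrow> 'b \<Rightarrow> 'c::topological_comm_monoid_add"
  assumes "\<And>a. a \<in> S \<Longrightarrow> (F a has_sum s a) A"
  shows "((\<lambda>x. \<Sum>a\<in>S. F a x) has_sum (\<Sum>a\<in>S. s a)) A"
  using assms
proof (induction S rule: infinite_finite_induct)
  case (insert a S)
  then show ?case by (simp add: has_sum_add)
qed simp_all

text \<open>The weight quotients of the successive letters telescope. The test on
  \<open>take\<close> also fails for words shorter than \<open>\<alpha>\<close>.\<close>

lemma weighted_shift_word_coord: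
  fixes f :: "'n::finite series"
  assumes f: "regular_positive f"
  shows "ell2_coord (weighted_shift_word f \<alpha> x) \<beta> =
    (if take (length \<alpha>) \<beta> = \<alpha>
     then of_real (sqrt (weight f (drop (length \<alpha>) \<beta>) / weight f \<beta>)) * ell2_coord x (drop (length \<alpha>) \<beta>) else 0)"
proof (induction \<alpha> arbitrary: \<beta>)
  case Nil
  then show ?case using weight_pos[OF f, of \<beta>] by (simp add: weighted_shift_word_def)
next
  case (Cons i \<alpha>)
  have "weighted_shift_word f (i # \<alpha>) x = weighted_shift f i (weighted_shift_word f \<alpha> x)"
    by (simp add: weighted_shift_word_def)
  then have "ell2_coord (weighted_shift_word f (i # \<alpha>) x) \<beta>
     = weighted_shift_coord f i (ell2_coord (weighted_shift_word f \<alpha> x)) \<beta>"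
    by (simp add: weighted_shift_apply[OF f])
  also have "\<dots> = (if take (length (i # \<alpha>)) \<beta> = i # \<alpha>
     then of_real (sqrt (weight f (drop (length (i # \<alpha>)) \<beta>) / weight f \<beta>)) * ell2_coord x (drop (length (i # \<alpha>)) \<beta>) else 0)"
  proof (cases \<beta>)
    case (Cons j \<gamma>)
    then show ?thesis
      using weight_pos[OF f, of \<gamma>] weight_pos[OF f, of "i # \<gamma>"]
      by (auto simp: weighted_shift_coord_def Cons.IH simp flip: of_real_mult real_sqrt_mult)
  qed (simp add: weighted_shift_coord_def)
  finally show ?case .
qed

lemma weighted_shift_word_Cons:
  "weighted_shift_word f (i # \<alpha>) = weighted_shift f i o\<^sub>L weighted_shift_word f \<alpha>"
  by (simp add: weighted_shift_word_def)

lemma weighted_shift_word_Nil: "weighted_shift_word f [] = id_blinfun"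
  by (simp add: weighted_shift_word_def)

lemma weighted_shift_word_single: "weighted_shift_word f [i] = weighted_shift f i"
  by (rule blinfun_eqI) (simp add: weighted_shift_word_def)

lemma blinfun_compose_assoc: "(R o\<^sub>L S) o\<^sub>L T = R o\<^sub>L (S o\<^sub>L T)"
  by (rule blinfun_eqI) simp

lemma weighted_shift_word_append:
  "weighted_shift_word f (\<alpha> @ \<beta>) = weighted_shift_word f \<alpha> o\<^sub>L weighted_shift_word f \<beta>"
  by (induction \<alpha>) (simp_all add: weighted_shift_word_Cons weighted_shift_word_Nil blinfun_eqI blinfun_compose_assoc)

section \<open>The algebra as a closed complex algebra\<close>

lemma scaleC_op_apply: "scaleC_op c T x = scaleC_ell2 c (T x)"
  by (simp add: scaleC_op_def scalar_op.rep_eq)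

lemma bounded_linear_scaleC_op: "bounded_linear (scaleC_op c)"
  unfolding scaleC_op_def by (rule bounded_bilinear.bounded_linear_right[OF bounded_bilinear_blinfun_compose])

lemma scaleC_op_add: "scaleC_op c (S + T) = scaleC_op c S + scaleC_op c T"
  by (rule linear_add[OF bounded_linear.linear[OF bounded_linear_scaleC_op]])

lemma scaleC_op_scaleC_op: "scaleC_op c (scaleC_op d T) = scaleC_op (c * d) T"
  by (rule blinfun_eqI, rule ell2_eqI) (simp add: scaleC_op_apply mult.assoc)

lemma scaleC_op_of_real: "scaleC_op (of_real r) T = r *\<^sub>R T"
  by (rule blinfun_eqI, rule ell2_eqI) (simp add: scaleC_op_apply blinfun.scaleR_left)

lemma scaleC_op_0 [simp]: "scaleC_op 0 T = 0"
  using scaleC_op_of_real[of 0 T] by simp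

lemma scaleC_op_1 [simp]: "scaleC_op 1 T = T"
  using scaleC_op_of_real[of 1 T] by simp

lemma scaleC_op_compose: "scaleC_op c S o\<^sub>L T = scaleC_op c (S o\<^sub>L T)"
  by (simp add: scaleC_op_def blinfun_compose_assoc)

lemma domain_algebra_induct [consumes 1, case_names closed zero add word]:
  assumes T: "T \<in> domain_algebra f" and closed: "closed {T. P T}"
    and zero: "P 0" and add: "\<And>S T. P S \<Longrightarrow> P T \<Longrightarrow> P (S + T)"
    and word: "\<And>c \<alpha>. P (scaleC_op c (weighted_shift_word f \<alpha>))"
  shows "P T"
proof -
  have "domain_algebra f \<subseteq> {T. P T}"
    unfolding domain_algebra_def
  proof (rule closure_minimal[OF _ closed], safe)
    fix F :: "'a list set" and c assume "finite F"
    then show "P (\<Sum>\<alpha>\<in>F. scaleC_op (c \<alpha>) (weighted_shift_word f \<alpha>))"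
      by (induction F) (auto intro: zero add word)
  qed
  then show ?thesis using T by auto
qed

lemma closed_domain_algebra [simp]: "closed (domain_algebra f)"
  by (simp add: domain_algebra_def)

lemma span_subset_domain_algebra:
  "finite F \<Longrightarrow> (\<Sum>\<alpha>\<in>F. scaleC_op (c \<alpha>) (weighted_shift_word f \<alpha>)) \<in> domain_algebra f"
  unfolding domain_algebra_def by (rule subsetD[OF closure_subset]) auto

lemma domain_algebra_scaleC_word: "scaleC_op c (weighted_shift_word f \<alpha>) \<in> domain_algebra f"
  using span_subset_domain_algebra[of "{\<alpha>}" "\<lambda>_. c" f] by simp

lemma domain_algebra_0: "0 \<in> domain_algebra f"
  using span_subset_domain_algebra[of "{}"] by simp

lemma domain_algebra_add:
  assumes "S \<in> domain_algebra f" "T \<in> domain_algebra f"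
  shows "S + T \<in> domain_algebra f"
proof -
  define X where "X = {\<Sum>\<alpha>\<in>F. scaleC_op (c \<alpha>) (weighted_shift_word f \<alpha>) | F c. finite F}"
  have X: "S + T \<in> X" if ST: "S \<in> X" "T \<in> X" for S T
  proof -
    from ST obtain F G c d where *: "finite F" "finite G"
      "S = (\<Sum>\<alpha>\<in>F. scaleC_op (c \<alpha>) (weighted_shift_word f \<alpha>))"
      "T = (\<Sum>\<alpha>\<in>G. scaleC_op (d \<alpha>) (weighted_shift_word f \<alpha>))"
      unfolding X_def by auto
    have "S = (\<Sum>\<alpha>\<in>F\<union>G. scaleC_op (if \<alpha> \<in> F then c \<alpha> else 0) (weighted_shift_word f \<alpha>))"
      unfolding * by (rule sum.mono_neutral_cong_left) (use * in auto)
    moreover have "T = (\<Sum>\<alpha>\<in>F\<union>G. scaleC_op (if \<alpha> \<in> G then d \<alpha> else 0) (weighted_shift_word f \<alpha>))"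
      unfolding * by (rule sum.mono_neutral_cong_left) (use * in auto)
    moreover have "scaleC_op c T + scaleC_op d T = scaleC_op (c + d) T" for c d and T :: "'a list op"
      by (rule blinfun_eqI, rule ell2_eqI) (simp add: scaleC_op_apply blinfun.add_left distrib_right)
    ultimately have "S + T = (\<Sum>\<alpha>\<in>F\<union>G. scaleC_op ((if \<alpha> \<in> F then c \<alpha> else 0) + (if \<alpha> \<in> G then d \<alpha> else 0)) (weighted_shift_word f \<alpha>))"
      by (simp add: sum.distrib[symmetric])
    then show ?thesis unfolding X_def using *(1,2)
      by (intro CollectI exI[of _ "F \<union> G"] exI[of _ "\<lambda>\<alpha>. (if \<alpha> \<in> F then c \<alpha> else 0) + (if \<alpha> \<in> G then d \<alpha> else 0)"]) auto
  qed
  obtain s where s: "\<And>k. s k \<in> X" "s \<longlonglongrightarrow> S"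
    using assms(1) unfolding domain_algebra_def closure_sequential X_def by blast
  obtain t where t: "\<And>k. t k \<in> X" "t \<longlonglongrightarrow> T"
    using assms(2) unfolding domain_algebra_def closure_sequential X_def by blast
  show ?thesis
    unfolding domain_algebra_def closure_sequential X_def[symmetric]
    by (rule exI[of _ "\<lambda>k. s k + t k"]) (auto intro: X s t tendsto_add)
qed

lemma domain_algebra_scaleC:
  assumes "T \<in> domain_algebra f"
  shows "scaleC_op c T \<in> domain_algebra f"
  using assms
proof (induction rule: domain_algebra_induct)
  case closed
  have "continuous_on UNIV (scaleC_op c :: 'a list op \<Rightarrow> _)"
    by (intro linear_continuous_on bounded_linear_scaleC_op)
  from closed_vimage[OF closed_domain_algebra this] show ?case
    by (simp add: vimage_def)
next
  case zero
  show ?case using domain_algebra_0 linear_0[OF bounded_linear.linear[OF bounded_linear_scaleC_op]] by metis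
qed (simp_all add: scaleC_op_add domain_algebra_add scaleC_op_scaleC_op domain_algebra_scaleC_word)

lemma domain_algebra_diff:
  assumes "S \<in> domain_algebra f" "T \<in> domain_algebra f"
  shows "S - T \<in> domain_algebra f"
  using domain_algebra_add[OF assms(1) domain_algebra_scaleC[OF assms(2), of "-1"]]
    scaleC_op_of_real[of "-1" T] by simp

lemma domain_algebra_sum:
  "(\<And>a. a \<in> S \<Longrightarrow> T a \<in> domain_algebra f) \<Longrightarrow> (\<Sum>a\<in>S. T a) \<in> domain_algebra f"
  by (induction S rule: infinite_finite_induct) (auto intro: domain_algebra_add domain_algebra_0)

lemma domain_algebra_word: "weighted_shift_word f \<alpha> \<in> domain_algebra f"
  using domain_algebra_scaleC_word[of 1 f \<alpha>] by simp

lemma domain_algebra_shift: "weighted_shift f i \<in> domain_algebra f"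
  using domain_algebra_word[of f "[i]"] by (simp add: weighted_shift_word_single)

lemma domain_algebra_id: "id_blinfun \<in> domain_algebra f"
  using domain_algebra_word[of f "[]"] by (simp add: weighted_shift_word_Nil)

lemma weighted_shift_word_scaleC:
  fixes f :: "'n::finite series"
  assumes "regular_positive f"
  shows "weighted_shift_word f \<alpha> (scaleC_ell2 c x) = scaleC_ell2 c (weighted_shift_word f \<alpha> x)"
  by (rule ell2_eqI) (simp add: weighted_shift_word_coord[OF assms])

text \<open>Operators of type \<open>op\<close> are a priori only real-linear. Complex linearity
  holds for word operators and survives sums and limits.\<close>

lemma domain_algebra_complex_linear:
  fixes f :: "'n::finite series"
  assumes f: "regular_positive f" and T: "T \<in> domain_algebra f"
  shows "T (scaleC_ell2 c x) = scaleC_ell2 c (T x)"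
  using T
proof (induction rule: domain_algebra_induct)
  case closed
  have "continuous_on UNIV (\<lambda>T :: 'n list op. T (scaleC_ell2 c x))"
    "continuous_on UNIV (\<lambda>T :: 'n list op. scaleC_op c T x)"
    by (intro continuous_intros linear_continuous_on bounded_linear_scaleC_op)+
  from closed_Collect_eq[OF this] show ?case by (simp add: scaleC_op_apply)
next
  case zero show ?case by (rule ell2_eqI) simp
qed (auto simp: blinfun.add_left scaleC_ell2_add scaleC_op_apply weighted_shift_word_scaleC[OF f]
    intro!: ell2_eqI)

lemma scaleC_op_compose_right:
  fixes f :: "'n::finite series"
  assumes "regular_positive f" "S \<in> domain_algebra f"
  shows "S o\<^sub>L scaleC_op c T = scaleC_op c (S o\<^sub>L T)"
  by (rule blinfun_eqI) (simp add: scaleC_op_apply domain_algebra_complex_linear[OF assms])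

lemma domain_algebra_compose:
  fixes f :: "'n::finite series"
  assumes f: "regular_positive f" and S: "S \<in> domain_algebra f" and T: "T \<in> domain_algebra f"
  shows "S o\<^sub>L T \<in> domain_algebra f"
  using S
proof (induction rule: domain_algebra_induct)
  case closed
  have "continuous_on UNIV (\<lambda>S. S o\<^sub>L T)"
    by (intro linear_continuous_on bounded_bilinear.bounded_linear_left[OF bounded_bilinear_blinfun_compose])
  from closed_vimage[OF closed_domain_algebra this] show ?case by (simp add: vimage_def)
next
  case (word c \<alpha>)
  have "weighted_shift_word f \<alpha> o\<^sub>L T \<in> domain_algebra f"
    using T
  proof (induction rule: domain_algebra_induct)
    case closed
    have "continuous_on UNIV (\<lambda>T. weighted_shift_word f \<alpha> o\<^sub>L T)"
      by (intro linear_continuous_on bounded_bilinear.bounded_linear_right[OF bounded_bilinear_blinfun_compose])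
    from closed_vimage[OF closed_domain_algebra this] show ?case by (simp add: vimage_def)
  next
    case (word d \<beta>)
    then show ?case
      by (simp add: scaleC_op_compose_right[OF f domain_algebra_word] domain_algebra_scaleC_word
          flip: weighted_shift_word_append)
  qed (simp_all add: domain_algebra_0 bounded_bilinear.add_right[OF bounded_bilinear_blinfun_compose] domain_algebra_add)
  then show ?case by (simp add: scaleC_op_compose domain_algebra_scaleC)
qed (simp_all add: domain_algebra_0 bounded_bilinear.add_left[OF bounded_bilinear_blinfun_compose] domain_algebra_add)

text \<open>Every \<open>T\<close> in the algebra commutes with the weighted right shifts, hence acts as a
  convolution with its value at the vacuum vector.\<close>

lemma domain_algebra_coord:
  fixes f :: "'n::finite series"
  assumes f: "regular_positive f" and T: "T \<in> domain_algebra f"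
  shows "ell2_coord (T x) \<gamma> = (\<Sum>k\<le>length \<gamma>.
      of_real (sqrt (weight f (take k \<gamma>) * weight f (drop k \<gamma>) / weight f \<gamma>))
        * ell2_coord (T (ell2_basis [])) (take k \<gamma>) * ell2_coord x (drop k \<gamma>))"
  using T
proof (induction rule: domain_algebra_induct)
  case closed
  show ?case
    by (intro closed_Collect_eq continuous_intros bounded_linear.continuous_on[OF bounded_linear_ell2_coord])
next
  case (word c \<alpha>)
  let ?W = "weighted_shift_word f \<alpha>"
  \<comment> \<open>A word operator sends the vacuum to a multiple of the basis vector of
    \<open>\<alpha>\<close>, so only the splitting at \<open>k = length \<alpha>\<close>
    contributes.\<close>
  have "of_real (sqrt (weight f (take k \<gamma>) * weight f (drop k \<gamma>) / weight f \<gamma>))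
        * ell2_coord (?W (ell2_basis [])) (take k \<gamma>) * ell2_coord x (drop k \<gamma>)
     = (if k = length \<alpha> then if take (length \<alpha>) \<gamma> = \<alpha> then
        of_real (sqrt (weight f (drop (length \<alpha>) \<gamma>) / weight f \<gamma>)) * ell2_coord x (drop (length \<alpha>) \<gamma>) else 0 else 0)"
    if "k \<le> length \<gamma>" for k
    using that weight_pos[OF f, of \<alpha>]
    by (auto simp: weighted_shift_word_coord[OF f] min_def weight_def[of f "[]"] real_sqrt_mult real_sqrt_divide)
  then have "(\<Sum>k\<le>length \<gamma>. of_real (sqrt (weight f (take k \<gamma>) * weight f (drop k \<gamma>) / weight f \<gamma>))
        * ell2_coord (?W (ell2_basis [])) (take k \<gamma>) * ell2_coord x (drop k \<gamma>))
     = (if length \<alpha> \<le> length \<gamma> then if take (length \<alpha>) \<gamma> = \<alpha> then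
        of_real (sqrt (weight f (drop (length \<alpha>) \<gamma>) / weight f \<gamma>)) * ell2_coord x (drop (length \<alpha>) \<gamma>) else 0 else 0)"
    by simp
  also have "\<dots> = ell2_coord (?W x) \<gamma>"
    by (auto simp: weighted_shift_word_coord[OF f])
  finally have "c * ell2_coord (?W x) \<gamma> = c * (\<Sum>k\<le>length \<gamma>.
      of_real (sqrt (weight f (take k \<gamma>) * weight f (drop k \<gamma>) / weight f \<gamma>))
        * ell2_coord (?W (ell2_basis [])) (take k \<gamma>) * ell2_coord x (drop k \<gamma>))" by simp
  then show ?case
    by (simp add: scaleC_op_apply sum_distrib_left mult_ac)
qed (simp_all add: blinfun.add_left distrib_left distrib_right sum.distrib)

lemma domain_algebra_eqI:
  fixes f :: "'n::finite series"
  assumes f: "regular_positive f" and "S \<in> domain_algebra f" "T \<in> domain_algebra f"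
    and "S (ell2_basis []) = T (ell2_basis [])"
  shows "S = T"
  by (rule blinfun_eqI, rule ell2_eqI) (simp add: domain_algebra_coord[OF f] assms)

section \<open>Kernel vectors and point evaluations\<close>
lemma word_eval_prefix:
  "take (length \<alpha>) \<beta> = \<alpha> \<Longrightarrow> word_eval z \<beta> = word_eval z \<alpha> * word_eval z (drop (length \<alpha>) \<beta>)"
  by (metis append_take_drop_id word_eval_append)

lemma norm_ell2_power2: "((\<lambda>i. (cmod (ell2_coord x i))\<^sup>2) has_sum (norm x)\<^sup>2) UNIV"
  unfolding norm_ell2_eq using has_sum_infsum[OF ell2_coord_summable[of x]]
  by (simp add: infsum_nonneg)

text \<open>The recursion for the weights bounds the sum \<open>S\<close> over words of length at
  most \<open>M\<close> by \<open>1 + p * S\<close> with \<open>p < 1\<close>, hence by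
  \<open>1 / (1 - p)\<close> uniformly in \<open>M\<close>.\<close>

lemma open_domain_kernel_summable:
  fixes f :: "'n::finite series"
  assumes f: "regular_positive f" "free_polynomial f" and z: "z \<in> open_domain f"
  shows "(\<lambda>\<alpha>. weight f \<alpha> * (cmod (word_eval z \<alpha>))\<^sup>2) summable_on UNIV"
proof -
  define t where "t \<alpha> = weight f \<alpha> * (cmod (word_eval z \<alpha>))\<^sup>2" for \<alpha>
  define p where "p = (\<Sum>\<alpha> | f \<alpha> \<noteq> 0. f \<alpha> * (cmod (word_eval z \<alpha>))\<^sup>2)"
  have f0: "f \<alpha> \<ge> 0" for \<alpha> using f by (simp add: regular_positive_def)
  have t0: "t \<alpha> \<ge> 0" for \<alpha> using weight_pos[OF f(1), of \<alpha>] by (simp add: t_def)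
  have p: "p < 1" using z by (simp add: p_def open_domain_def)
  have bound: "(\<Sum>\<beta> | length \<beta> \<le> M. t \<beta>) \<le> 1 / (1 - p)" for M
  proof -
    let ?A = "{\<beta> :: 'n list. length \<beta> \<le> M}"
    have fin: "finite ?A" using finite_lists_length_le[of "UNIV :: 'n set" M] by simp
    have split: "t \<beta> = (\<Sum>\<alpha> | f \<alpha> \<noteq> 0. if take (length \<alpha>) \<beta> = \<alpha>
        then f \<alpha> * (cmod (word_eval z \<alpha>))\<^sup>2 * t (drop (length \<alpha>) \<beta>) else 0)" if "\<beta> \<noteq> []" for \<beta>
      unfolding t_def weight_prefixes[OF f that] sum_distrib_right
    proof (intro sum.cong refl)
      fix \<alpha>
      show "(if take (length \<alpha>) \<beta> = \<alpha> then f \<alpha> * weight f (drop (length \<alpha>) \<beta>) else 0) * (cmod (word_eval z \<beta>))\<^sup>2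
        = (if take (length \<alpha>) \<beta> = \<alpha> then f \<alpha> * (cmod (word_eval z \<alpha>))\<^sup>2
          * (weight f (drop (length \<alpha>) \<beta>) * (cmod (word_eval z (drop (length \<alpha>) \<beta>)))\<^sup>2) else 0)"
        by (simp add: norm_mult power_mult_distrib word_eval_prefix[of \<alpha> \<beta>])
    qed
    \<comment> \<open>Removing the prefix \<open>\<alpha>\<close> is injective on words that have it
      and does not increase the length.\<close>
    have inner: "(\<Sum>\<beta>\<in>?A. if take (length \<alpha>) \<beta> = \<alpha> then c * t (drop (length \<alpha>) \<beta>) else 0) \<le> c * sum t ?A"
      if "c \<ge> 0" for c \<alpha>
    proof -
      have "(\<Sum>\<beta>\<in>?A. if take (length \<alpha>) \<beta> = \<alpha> then c * t (drop (length \<alpha>) \<beta>) else 0)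
          = (\<Sum>\<beta>\<in>{\<beta>\<in>?A. take (length \<alpha>) \<beta> = \<alpha>}. c * t (drop (length \<alpha>) \<beta>))"
        by (rule sum.inter_filter[symmetric]) (rule fin)
      also have "\<dots> = (\<Sum>\<gamma>\<in>drop (length \<alpha>) ` {\<beta>\<in>?A. take (length \<alpha>) \<beta> = \<alpha>}. c * t \<gamma>)"
        by (subst sum.reindex) (auto simp: inj_on_def, metis append_take_drop_id)
      also have "\<dots> \<le> (\<Sum>\<gamma>\<in>?A. c * t \<gamma>)"
        using that t0 fin by (intro sum_mono2) auto
      finally show ?thesis by (simp add: sum_distrib_left)
    qed
    have "sum t ?A = t [] + sum t (?A - {[]})"
      by (rule sum.remove[OF fin]) simp
    also have "sum t (?A - {[]}) \<le> p * sum t ?A"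
    proof -
      have "sum t (?A - {[]}) = (\<Sum>\<beta>\<in>?A - {[]}. \<Sum>\<alpha> | f \<alpha> \<noteq> 0. if take (length \<alpha>) \<beta> = \<alpha>
        then f \<alpha> * (cmod (word_eval z \<alpha>))\<^sup>2 * t (drop (length \<alpha>) \<beta>) else 0)"
        by (rule sum.cong) (auto intro: split)
      also have "\<dots> \<le> (\<Sum>\<beta>\<in>?A. \<Sum>\<alpha> | f \<alpha> \<noteq> 0. if take (length \<alpha>) \<beta> = \<alpha>
        then f \<alpha> * (cmod (word_eval z \<alpha>))\<^sup>2 * t (drop (length \<alpha>) \<beta>) else 0)"
        using fin t0 f0 by (intro sum_mono2) (auto intro!: sum_nonneg)
      also have "\<dots> \<le> (\<Sum>\<alpha> | f \<alpha> \<noteq> 0. f \<alpha> * (cmod (word_eval z \<alpha>))\<^sup>2 * sum t ?A)"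
        by (subst sum.swap) (auto intro!: sum_mono inner f0 mult_nonneg_nonneg)
      finally show ?thesis by (simp add: p_def sum_distrib_right)
    qed
    also have "t [] = 1" by (simp add: t_def weight_def)
    finally have "(1 - p) * sum t ?A \<le> 1" by (simp add: algebra_simps)
    then show ?thesis using p by (simp add: pos_le_divide_eq mult.commute)
  qed
  show ?thesis
    unfolding t_def[symmetric]
  proof (rule nonneg_bdd_above_summable_on)
    show "bdd_above (sum t ` {F. F \<subseteq> UNIV \<and> finite F})"
    proof (rule bdd_aboveI2)
      fix F :: "'n list set" assume F: "F \<in> {F. F \<subseteq> UNIV \<and> finite F}"
      define M where "M = Max (insert 0 (length ` F))"
      have "sum t F \<le> (\<Sum>\<beta> | length \<beta> \<le> M. t \<beta>)"
      proof (rule sum_mono2)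
        show "finite {\<beta> :: 'n list. length \<beta> \<le> M}"
          using finite_lists_length_le[of "UNIV :: 'n set" M] by simp
        show "F \<subseteq> {\<beta>. length \<beta> \<le> M}" using F by (auto simp: M_def intro: Max_ge)
      qed (rule t0)
      also note bound
      finally show "sum t F \<le> 1 / (1 - p)" .
    qed
  qed (rule t0)
qed

text \<open>Meaningful for \<open>z \<in> open_domain f\<close>, where these coordinates are square-summable.\<close>

definition kernel_vector :: "'n series \<Rightarrow> complex ^ 'n \<Rightarrow> 'n list ell2" where
  "kernel_vector f z = Abs_ell2 (\<lambda>\<alpha>. of_real (sqrt (weight f \<alpha>)) * cnj (word_eval z \<alpha>))"

lemma kernel_vector_coord:
  fixes f :: "'n::finite series"
  assumes f: "regular_positive f" "free_polynomial f" and z: "z \<in> open_domain f"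
  shows "ell2_coord (kernel_vector f z) \<alpha> = of_real (sqrt (weight f \<alpha>)) * cnj (word_eval z \<alpha>)"
proof -
  have "(cmod (of_real (sqrt (weight f \<alpha>)) * cnj (word_eval z \<alpha>)))\<^sup>2 = weight f \<alpha> * (cmod (word_eval z \<alpha>))\<^sup>2" for \<alpha>
    using weight_pos[OF f(1), of \<alpha>] by (simp add: norm_mult power_mult_distrib)
  then show ?thesis
    unfolding kernel_vector_def
    by (subst Abs_ell2_inverse) (simp_all add: open_domain_kernel_summable[OF assms])
qed

text \<open>Summing the recursion for the weights against the words gives
  \<open>K = 1 + series_kernel f z w * K\<close>. The product form also yields that neither factor
  vanishes.\<close>

lemma cinner_kernel_vectors:
  fixes f :: "'n::finite series"
  assumes f: "regular_positive f" "free_polynomial f"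
    and z: "z \<in> open_domain f" and w: "w \<in> open_domain f"
  shows "cinner (kernel_vector f w) (kernel_vector f z) * (1 - series_kernel f z w) = 1"
proof -
  define F where "F \<alpha> = of_real (weight f \<alpha>) * (word_eval z \<alpha> * cnj (word_eval w \<alpha>))" for \<alpha>
  define K where "K = cinner (kernel_vector f w) (kernel_vector f z)"
  have F: "(F has_sum K) UNIV"
  proof -
    have "ell2_coord (kernel_vector f w) \<alpha> * cnj (ell2_coord (kernel_vector f z) \<alpha>) = F \<alpha>" for \<alpha>
      using weight_pos[OF f(1), of \<alpha>]
      by (simp add: kernel_vector_coord[OF f] z w F_def mult_ac flip: of_real_mult)
    then show ?thesis using has_sum_cinner[of "kernel_vector f w" "kernel_vector f z"] by (simp add: K_def)
  qed
  let ?G = "\<lambda>\<beta>. \<Sum>\<alpha> | f \<alpha> \<noteq> 0. of_real (f \<alpha>) * word_eval z \<alpha> * cnj (word_eval w \<alpha>) *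
      (if take (length \<alpha>) \<beta> = \<alpha> then F (drop (length \<alpha>) \<beta>) else 0)"
  have "(?G has_sum (\<Sum>\<alpha> | f \<alpha> \<noteq> 0. of_real (f \<alpha>) * word_eval z \<alpha> * cnj (word_eval w \<alpha>) * K)) UNIV"
    by (intro has_sum_finite_sum has_sum_cmult_right has_sum_prefix F)
  then have G: "(?G has_sum (series_kernel f z w * K)) UNIV"
    by (simp add: series_kernel_def sum_distrib_right)
  have "F \<beta> - ?G \<beta> = (if \<beta> = [] then 1 else 0)" for \<beta>
  proof (cases "\<beta> = []")
    case True
    have "f [] = 0" using f by (simp add: regular_positive_def)
    then have "?G \<beta> = 0" unfolding True by (intro sum.neutral) auto
    then show ?thesis unfolding \<open>?G \<beta> = 0\<close> using True by (simp add: F_def weight_def)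
  next
    case False
    have "F \<beta> = ?G \<beta>"
      unfolding F_def weight_prefixes[OF f False] of_real_sum sum_distrib_right
      by (rule sum.cong) (auto simp: word_eval_prefix[of _ \<beta>])
    then show ?thesis using False by simp
  qed
  then have "((\<lambda>\<beta> :: 'n list. if \<beta> = [] then 1 else 0 :: complex) has_sum (K - series_kernel f z w * K)) UNIV"
    using has_sum_add[OF F has_sum_cmult_right[OF G, of "-1"]] by simp
  moreover have "((\<lambda>\<beta> :: 'n list. if \<beta> = [] then 1 else 0 :: complex) has_sum 1) UNIV"
    by (rule has_sum_finite_neutralI[of "{[]}"]) auto
  ultimately have "K - series_kernel f z w * K = 1" by (rule has_sum_unique)
  then show ?thesis by (simp add: K_def algebra_simps)
qed

text \<open>A concrete candidate for \<open>point_eval\<close>, free of definite descriptions. It is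
  a character when \<open>z\<close> lies in \<open>open_domain f\<close>.\<close>

definition point_char :: "'n series \<Rightarrow> complex ^ 'n \<Rightarrow> 'n list op \<Rightarrow> complex" where
  "point_char f z T = cinner (T (ell2_basis [])) (kernel_vector f z)"

lemma cinner_vacuum_kernel_vector:
  fixes f :: "'n::finite series"
  assumes f: "regular_positive f" "free_polynomial f" and z: "z \<in> open_domain f"
  shows "cinner (ell2_basis []) (kernel_vector f z) = 1"
proof -
  have "((\<lambda>\<alpha>. ell2_coord (ell2_basis []) \<alpha> * cnj (ell2_coord (kernel_vector f z) \<alpha>)) has_sum 1) UNIV"
    by (rule has_sum_finite_neutralI[of "{[]}"]) (auto simp: kernel_vector_coord[OF f z] weight_def)
  then show ?thesis by (rule has_sum_unique[OF has_sum_cinner])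
qed

text \<open>In terms of adjoints, kernel vectors are joint eigenvectors: the weights in the kernel
  vector cancel those of the shift.\<close>

lemma cinner_weighted_shift_word:
  fixes f :: "'n::finite series"
  assumes f: "regular_positive f" "free_polynomial f" and z: "z \<in> open_domain f"
  shows "cinner (weighted_shift_word f \<alpha> x) (kernel_vector f z) = word_eval z \<alpha> * cinner x (kernel_vector f z)"
proof -
  define F where "F \<gamma> = word_eval z \<alpha> * (ell2_coord x \<gamma> * cnj (ell2_coord (kernel_vector f z) \<gamma>))" for \<gamma>
  have "(F has_sum (word_eval z \<alpha> * cinner x (kernel_vector f z))) UNIV"
    unfolding F_def by (intro has_sum_cmult_right has_sum_cinner)
  from has_sum_prefix[OF this]
  have "((\<lambda>\<beta>. if take (length \<alpha>) \<beta> = \<alpha> then F (drop (length \<alpha>) \<beta>) else 0)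
      has_sum (word_eval z \<alpha> * cinner x (kernel_vector f z))) UNIV" .
  moreover have "(if take (length \<alpha>) \<beta> = \<alpha> then F (drop (length \<alpha>) \<beta>) else 0)
     = ell2_coord (weighted_shift_word f \<alpha> x) \<beta> * cnj (ell2_coord (kernel_vector f z) \<beta>)" for \<beta>
    using weight_pos[OF f(1), of \<beta>]
    by (auto simp: weighted_shift_word_coord[OF f(1)] kernel_vector_coord[OF f z] F_def
        word_eval_prefix[of \<alpha> \<beta> z] real_sqrt_divide)
  ultimately show ?thesis by (simp only: has_sum_unique[OF has_sum_cinner])
qed

text \<open>The eigenvector property passes from words to the closed span. Applied to
  \<open>x = T' (ell2_basis [])\<close> for another operator \<open>T'\<close>, it gives
  multiplicativity of \<open>point_char\<close>.\<close>

lemma point_char_mult: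
  fixes f :: "'n::finite series"
  assumes f: "regular_positive f" "free_polynomial f" and z: "z \<in> open_domain f" and T: "T \<in> domain_algebra f"
  shows "cinner (T x) (kernel_vector f z) = point_char f z T * cinner x (kernel_vector f z)"
  using T
proof (induction rule: domain_algebra_induct)
  case closed
  show ?case
    unfolding point_char_def
    by (intro closed_Collect_eq continuous_intros bounded_linear.continuous_on[OF bounded_linear_cinner])
next
  case zero
  have "cinner 0 y = 0" for y :: "'n list ell2" by (simp add: cinner_def)
  then show ?case by (simp add: point_char_def)
next
  case (word c \<alpha>)
  show ?case
    by (simp add: point_char_def scaleC_op_apply cinner_scaleC_left cinner_weighted_shift_word[OF f z]
        cinner_vacuum_kernel_vector[OF f z])
qed (simp_all add: blinfun.add_left cinner_add_left point_char_def distrib_right)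

text \<open>In coordinate \<open>\<beta>\<close> the sum runs over prefixes \<open>\<alpha>\<close>
  with coefficients whose squares add up to at most 1, by the recursion for the weights.
  Cauchy-Schwarz in each coordinate and summation over \<open>\<beta>\<close> finish.\<close>

lemma row_contraction:
  fixes f :: "'n::finite series"
  assumes f: "regular_positive f" "free_polynomial f"
  shows "(norm (\<Sum>\<alpha> | f \<alpha> \<noteq> 0. sqrt (f \<alpha>) *\<^sub>R weighted_shift_word f \<alpha> (y \<alpha>)))\<^sup>2
     \<le> (\<Sum>\<alpha> | f \<alpha> \<noteq> 0. (norm (y \<alpha>))\<^sup>2)"
proof -
  let ?v = "\<Sum>\<alpha> | f \<alpha> \<noteq> 0. sqrt (f \<alpha>) *\<^sub>R weighted_shift_word f \<alpha> (y \<alpha>)"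
  let ?G = "\<lambda>\<beta>. \<Sum>\<alpha> | f \<alpha> \<noteq> 0. (if take (length \<alpha>) \<beta> = \<alpha> then (cmod (ell2_coord (y \<alpha>) (drop (length \<alpha>) \<beta>)))\<^sup>2 else 0)"
  have G: "(?G has_sum (\<Sum>\<alpha> | f \<alpha> \<noteq> 0. (norm (y \<alpha>))\<^sup>2)) UNIV"
    by (intro has_sum_finite_sum has_sum_prefix norm_ell2_power2)
  have "(cmod (ell2_coord ?v \<beta>))\<^sup>2 \<le> ?G \<beta>" for \<beta>
  proof -
    define u where "u \<alpha> = (if take (length \<alpha>) \<beta> = \<alpha> then sqrt (f \<alpha>) * sqrt (weight f (drop (length \<alpha>) \<beta>) / weight f \<beta>) else 0)" for \<alpha>
    define v where "v \<alpha> = (if take (length \<alpha>) \<beta> = \<alpha> then cmod (ell2_coord (y \<alpha>) (drop (length \<alpha>) \<beta>)) else 0)" for \<alpha>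
    have f0: "f \<alpha> \<ge> 0" for \<alpha> using f by (simp add: regular_positive_def)
    have u0: "u \<alpha> \<ge> 0" for \<alpha> using f0 weight_pos[OF f(1)] by (auto simp: u_def less_imp_le)
    have "cmod (ell2_coord ?v \<beta>) \<le> (\<Sum>\<alpha> | f \<alpha> \<noteq> 0. u \<alpha> * v \<alpha>)"
      unfolding ell2_coord_sum
    proof (intro sum_norm_le)
      fix \<alpha>
      have "cmod (ell2_coord (sqrt (f \<alpha>) *\<^sub>R weighted_shift_word f \<alpha> (y \<alpha>)) \<beta>) = u \<alpha> * v \<alpha>"
        using f0[of \<alpha>] weight_pos[OF f(1)]
        by (auto simp: u_def v_def weighted_shift_word_coord[OF f(1)] norm_mult less_imp_le)
      then show "cmod (ell2_coord (sqrt (f \<alpha>) *\<^sub>R weighted_shift_word f \<alpha> (y \<alpha>)) \<beta>) \<le> u \<alpha> * v \<alpha>" by simp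
    qed
    then have "(cmod (ell2_coord ?v \<beta>))\<^sup>2 \<le> (\<Sum>\<alpha> | f \<alpha> \<noteq> 0. u \<alpha> * v \<alpha>)\<^sup>2"
      by (intro power_mono) auto
    also have "\<dots> \<le> (\<Sum>\<alpha> | f \<alpha> \<noteq> 0. (u \<alpha>)\<^sup>2) * (\<Sum>\<alpha> | f \<alpha> \<noteq> 0. (v \<alpha>)\<^sup>2)"
      by (rule Cauchy_Schwarz_ineq_sum)
    also have "\<dots> \<le> 1 * (\<Sum>\<alpha> | f \<alpha> \<noteq> 0. (v \<alpha>)\<^sup>2)"
    proof (intro mult_right_mono sum_nonneg)
      show "(\<Sum>\<alpha> | f \<alpha> \<noteq> 0. (u \<alpha>)\<^sup>2) \<le> 1"
      proof (cases "\<beta> = []")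
        case True
        have "f [] = 0" using f by (simp add: regular_positive_def)
        then show ?thesis using True by (auto simp: u_def intro!: order_trans[OF sum_nonpos])
      next
        case False
        have "(\<Sum>\<alpha> | f \<alpha> \<noteq> 0. (u \<alpha>)\<^sup>2) = weight f \<beta> / weight f \<beta>"
          unfolding weight_prefixes[OF f False] sum_divide_distrib
          using f0 weight_pos[OF f(1)]
          by (intro sum.cong) (auto simp: u_def power_mult_distrib less_imp_le weight_prefixes[OF f False, symmetric])
        then show ?thesis using weight_pos[OF f(1), of \<beta>] by simp
      qed
    qed auto
    also have "\<dots> = ?G \<beta>" by (simp, intro sum.cong) (auto simp: v_def)
    finally show ?thesis .
  qed
  then show ?thesis using has_sum_mono[OF norm_ell2_power2 G] by auto
qed

section \<open>Operator matrix norms and completely isometric isomorphisms\<close>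

lemma op_matrix_norm_upper:
  fixes A :: "nat \<Rightarrow> nat \<Rightarrow> 'a::real_normed_vector \<Rightarrow>\<^sub>L 'a"
  assumes x: "(\<Sum>j<m. (norm (x j))\<^sup>2) \<le> 1"
  shows "sqrt (\<Sum>i<m. (norm (\<Sum>j<m. A i j (x j)))\<^sup>2) \<le> op_matrix_norm m A"
  unfolding op_matrix_norm_def
proof (rule cSup_upper)
  show "bdd_above {sqrt (\<Sum>i<m. (norm (\<Sum>j<m. A i j (x j)))\<^sup>2) | x. (\<Sum>j<m. (norm (x j))\<^sup>2) \<le> 1}"
  proof (rule bdd_aboveI, safe)
    fix x :: "nat \<Rightarrow> 'a" assume x: "(\<Sum>j<m. (norm (x j))\<^sup>2) \<le> 1"
    have x1: "norm (x j) \<le> 1" if "j < m" for j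
    proof -
      have "(norm (x j))\<^sup>2 \<le> (\<Sum>j<m. (norm (x j))\<^sup>2)"
        using that by (intro member_le_sum) auto
      then have "(norm (x j))\<^sup>2 \<le> 1\<^sup>2" using x by simp
      then show ?thesis by (rule power2_le_imp_le) simp
    qed
    have "norm (\<Sum>j<m. A i j (x j)) \<le> (\<Sum>j<m. norm (A i j))" for i
    proof (rule sum_norm_le)
      fix j assume "j \<in> {..<m}"
      then have "norm (A i j) * norm (x j) \<le> norm (A i j) * 1"
        by (intro mult_left_mono x1) auto
      then show "norm (A i j (x j)) \<le> norm (A i j)"
        using norm_blinfun[of "A i j" "x j"] by simp
    qed
    then show "sqrt (\<Sum>i<m. (norm (\<Sum>j<m. A i j (x j)))\<^sup>2) \<le> sqrt (\<Sum>i<m. (\<Sum>j<m. norm (A i j))\<^sup>2)"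
      by (intro real_sqrt_le_mono sum_mono power_mono) auto
  qed
qed (use x in blast)

lemma op_matrix_norm_least:
  fixes A :: "nat \<Rightarrow> nat \<Rightarrow> 'a::real_normed_vector \<Rightarrow>\<^sub>L 'a"
  assumes "\<And>x. (\<Sum>j<m. (norm (x j))\<^sup>2) \<le> 1 \<Longrightarrow> sqrt (\<Sum>i<m. (norm (\<Sum>j<m. A i j (x j)))\<^sup>2) \<le> C"
  shows "op_matrix_norm m A \<le> C"
  unfolding op_matrix_norm_def
proof (rule cSup_least)
  show "{sqrt (\<Sum>i<m. (norm (\<Sum>j<m. A i j (x j)))\<^sup>2) | x. (\<Sum>j<m. (norm (x j))\<^sup>2) \<le> 1} \<noteq> {}"
    by (auto intro!: exI[of _ "\<lambda>_. 0"])
qed (use assms in auto)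

lemma op_matrix_norm_1:
  fixes T :: "'a::real_normed_vector \<Rightarrow>\<^sub>L 'a"
  shows "op_matrix_norm (Suc 0) (\<lambda>i j. T) = norm T"
proof (rule antisym)
  show "op_matrix_norm (Suc 0) (\<lambda>i j. T) \<le> norm T"
  proof (rule op_matrix_norm_least)
    fix x :: "nat \<Rightarrow> 'a" assume "(\<Sum>j<Suc 0. (norm (x j))\<^sup>2) \<le> 1"
    then have "norm (x 0) \<le> 1" by (simp add: power2_le_imp_le[of "norm (x 0)" 1])
    then have "norm T * norm (x 0) \<le> norm T" by (simp add: mult_left_le)
    then show "sqrt (\<Sum>i<Suc 0. (norm (\<Sum>j<Suc 0. T (x j)))\<^sup>2) \<le> norm T"
      using norm_blinfun[of T "x 0"] by simp
  qed
  show "norm T \<le> op_matrix_norm (Suc 0) (\<lambda>i j. T)"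
  proof (rule norm_blinfun_bound)
    have *: "norm (T x) \<le> op_matrix_norm (Suc 0) (\<lambda>i j. T)" if "norm x \<le> 1" for x
      using op_matrix_norm_upper[where m = "Suc 0" and x = "\<lambda>_. x" and A = "\<lambda>i j. T"] that by (simp add: power_le_one)
    show "0 \<le> op_matrix_norm (Suc 0) (\<lambda>i j. T)" using *[of 0] by simp
    show "norm (T x) \<le> op_matrix_norm (Suc 0) (\<lambda>i j. T) * norm x" for x
      using *[of "x /\<^sub>R norm x"] by (cases "x = 0") (auto simp: blinfun.scaleR_right field_simps)
  qed
qed

lemma ci_isomorphismD:
  assumes "ci_isomorphism A B \<Phi>"
  shows "bij_betw \<Phi> A B" "\<Phi> id_blinfun = id_blinfun"
    "S \<in> A \<Longrightarrow> T \<in> A \<Longrightarrow> \<Phi> (S + T) = \<Phi> S + \<Phi> T"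
    "S \<in> A \<Longrightarrow> T \<in> A \<Longrightarrow> \<Phi> (S o\<^sub>L T) = \<Phi> S o\<^sub>L \<Phi> T"
    "T \<in> A \<Longrightarrow> \<Phi> (scaleC_op c T) = scaleC_op c (\<Phi> T)"
    "T \<in> A \<Longrightarrow> \<Phi> T \<in> B"
    "m \<ge> 1 \<Longrightarrow> (\<And>i j. i < m \<Longrightarrow> j < m \<Longrightarrow> X i j \<in> A) \<Longrightarrow>
      op_matrix_norm m (\<lambda>i j. \<Phi> (X i j)) = op_matrix_norm m X"
  using assms unfolding ci_isomorphism_def by (auto dest: bij_betwE)

lemma ci_isomorphism_norm:
  assumes "ci_isomorphism A B \<Phi>" "T \<in> A"
  shows "norm (\<Phi> T) = norm T"
  using ci_isomorphismD(7)[OF assms(1), of "Suc 0" "\<lambda>_ _. T"] assms(2) by (simp add: op_matrix_norm_1)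

lemma ci_isomorphism_inverse:
  assumes iso: "ci_isomorphism A B \<Phi>" and id: "id_blinfun \<in> A"
    and add: "\<And>S T. S \<in> A \<Longrightarrow> T \<in> A \<Longrightarrow> S + T \<in> A"
    and comp: "\<And>S T. S \<in> A \<Longrightarrow> T \<in> A \<Longrightarrow> S o\<^sub>L T \<in> A"
    and scale: "\<And>c T. T \<in> A \<Longrightarrow> scaleC_op c T \<in> A"
  shows "ci_isomorphism B A (inv_into A \<Phi>)"
proof -
  let ?\<Psi> = "inv_into A \<Phi>"
  note D = ci_isomorphismD[OF iso]
  have \<Psi>: "?\<Psi> S \<in> A" "\<Phi> (?\<Psi> S) = S" if "S \<in> B" for S
    using that D(1) by (auto simp: bij_betw_def intro: inv_into_into f_inv_into_f)
  have \<Psi>\<Phi>: "?\<Psi> (\<Phi> T) = T" if "T \<in> A" for T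
    using that D(1) by (simp add: bij_betw_def)
  have eq: "?\<Psi> S = T" if "T \<in> A" "\<Phi> T = S" for S T using \<Psi>\<Phi> that by auto
  show ?thesis
    unfolding ci_isomorphism_def
  proof (intro conjI ballI allI impI)
    show "bij_betw ?\<Psi> B A" using D(1) by (rule bij_betw_inv_into)
    show "?\<Psi> id_blinfun = id_blinfun" by (rule eq) (simp_all add: id D(2))
    show "?\<Psi> (S + T) = ?\<Psi> S + ?\<Psi> T" if "S \<in> B" "T \<in> B" for S T
      by (rule eq) (simp_all add: add \<Psi> that D(3))
    show "?\<Psi> (S o\<^sub>L T) = ?\<Psi> S o\<^sub>L ?\<Psi> T" if "S \<in> B" "T \<in> B" for S T
      by (rule eq) (simp_all add: comp \<Psi> that D(4))
    show "?\<Psi> (scaleC_op c T) = scaleC_op c (?\<Psi> T)" if "T \<in> B" for c T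
      by (rule eq) (simp_all add: scale \<Psi> that D(5))
    show "op_matrix_norm m (\<lambda>i j. ?\<Psi> (X i j)) = op_matrix_norm m X"
      if "m \<ge> 1" "\<forall>i<m. \<forall>j<m. X i j \<in> B" for m X
    proof -
      have "op_matrix_norm m (\<lambda>i j. ?\<Psi> (X i j)) = op_matrix_norm m (\<lambda>i j. \<Phi> (?\<Psi> (X i j)))"
        using that by (intro D(7)[symmetric]) (auto simp: \<Psi>)
      also have "\<dots> = op_matrix_norm m X"
        unfolding op_matrix_norm_def using that by (simp add: \<Psi>)
      finally show ?thesis .
    qed
  qed
qed

section \<open>Bounded functionals determined by their values on words\<close>

definition bounded_functional :: "'a op set \<Rightarrow> ('a op \<Rightarrow> complex) \<Rightarrow> bool" where
  "bounded_functional A \<eta> \<longleftrightarrow>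
    (\<forall>S\<in>A. \<forall>T\<in>A. \<eta> (S + T) = \<eta> S + \<eta> T) \<and> (\<forall>c. \<forall>T\<in>A. \<eta> (scaleC_op c T) = c * \<eta> T) \<and>
    (\<exists>C. \<forall>T\<in>A. cmod (\<eta> T) \<le> C * norm T)"

lemma bounded_functional_continuous:
  assumes \<eta>: "bounded_functional (domain_algebra f) \<eta>"
  shows "continuous_on (domain_algebra f) \<eta>"
proof -
  from \<eta> obtain C where C: "\<And>T. T \<in> domain_algebra f \<Longrightarrow> cmod (\<eta> T) \<le> C * norm T"
    unfolding bounded_functional_def by blast
  have add: "\<eta> (S + T) = \<eta> S + \<eta> T" if "S \<in> domain_algebra f" "T \<in> domain_algebra f" for S T
    using \<eta> that by (auto simp: bounded_functional_def)
  have "dist (\<eta> S) (\<eta> T) \<le> \<bar>C\<bar> * dist S T" if "S \<in> domain_algebra f" "T \<in> domain_algebra f" for S T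
  proof -
    have "S - T \<in> domain_algebra f" by (rule domain_algebra_diff) fact+
    then have "\<eta> S - \<eta> T = \<eta> (S - T)" "cmod (\<eta> (S - T)) \<le> C * norm (S - T)"
      using add[of "S - T" T] that C by auto
    moreover have "C * norm (S - T) \<le> \<bar>C\<bar> * norm (S - T)" by (intro mult_right_mono) auto
    ultimately show ?thesis by (simp add: dist_norm)
  qed
  then have "\<bar>C\<bar>-lipschitz_on (domain_algebra f) \<eta>" by (auto simp: lipschitz_on_def)
  then show ?thesis by (rule lipschitz_on_continuous_on)
qed

lemma bounded_functional_eqI:
  assumes 1: "bounded_functional (domain_algebra f) \<eta>" and 2: "bounded_functional (domain_algebra f) \<eta>'"
    and eq: "\<And>\<alpha>. \<eta> (weighted_shift_word f \<alpha>) = \<eta>' (weighted_shift_word f \<alpha>)"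
    and T: "T \<in> domain_algebra f"
  shows "\<eta> T = \<eta>' T"
proof -
  \<comment> \<open>Membership is part of the induction predicate because the functionals are known
    to be continuous only on the algebra, and the predicate must define a closed set.\<close>
  have "T \<in> domain_algebra f \<and> \<eta> T = \<eta>' T"
    using T
  proof (induction rule: domain_algebra_induct)
    case closed
    have "closed {T \<in> domain_algebra f. \<eta> T - \<eta>' T = 0}"
      by (intro continuous_closed_preimage_constant continuous_on_diff bounded_functional_continuous 1 2
          closed_domain_algebra)
    then show ?case by simp
  next
    case zero
    have "\<eta> (scaleC_op 0 0) = 0" "\<eta>' (scaleC_op 0 0) = 0"
      using 1 2 domain_algebra_0[of f] unfolding bounded_functional_def by auto
    then show ?case by (simp add: domain_algebra_0)
  next
    case (add S T)
    then show ?case using 1 2 by (auto simp: bounded_functional_def domain_algebra_add)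
  next
    case (word c \<alpha>)
    show ?case using 1 2 eq domain_algebra_word[of f \<alpha>]
      by (auto simp: bounded_functional_def domain_algebra_scaleC)
  qed
  then show ?thesis by simp
qed

lemma bounded_functional_vector:
  assumes add: "\<And>x y. L (x + y) = L x + L y" and scale: "\<And>c x. L (scaleC_ell2 c x) = c * L x"
    and bound: "\<And>x. cmod (L x) \<le> C * norm x"
  shows "bounded_functional A (\<lambda>T. L (T x))"
proof -
  have "cmod (L (T x)) \<le> (\<bar>C\<bar> * norm x) * norm T" for T :: "'a op"
  proof -
    have "cmod (L (T x)) \<le> C * norm (T x)" by (rule bound)
    also have "\<dots> \<le> \<bar>C\<bar> * norm (T x)" by (intro mult_right_mono) auto
    also have "\<dots> \<le> \<bar>C\<bar> * (norm T * norm x)" by (intro mult_left_mono norm_blinfun) auto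
    finally show ?thesis by (simp add: mult_ac)
  qed
  then show ?thesis
    unfolding bounded_functional_def
    by (intro conjI exI[of _ "\<bar>C\<bar> * norm x"]) (auto simp: blinfun.add_left scaleC_op_apply add scale)
qed

lemma bounded_functional_comp:
  assumes iso: "ci_isomorphism A B \<Phi>" and \<eta>: "bounded_functional B \<eta>"
  shows "bounded_functional A (\<lambda>T. \<eta> (\<Phi> T))"
proof -
  from \<eta> obtain C where "\<And>T. T \<in> B \<Longrightarrow> cmod (\<eta> T) \<le> C * norm T"
    unfolding bounded_functional_def by blast
  then have "\<forall>T\<in>A. cmod (\<eta> (\<Phi> T)) \<le> C * norm T"
    using ci_isomorphism_norm[OF iso] ci_isomorphismD(6)[OF iso] by metis
  then show ?thesis
    using \<eta> ci_isomorphismD[OF iso] unfolding bounded_functional_def by auto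
qed

lemma bounded_functional_point_char: "bounded_functional A (point_char f z)"
  unfolding point_char_def[abs_def]
  by (rule bounded_functional_vector[of "\<lambda>x. cinner x (kernel_vector f z)" "norm (kernel_vector f z)"])
    (simp_all add: cinner_add_left cinner_scaleC_left norm_cinner_le mult.commute[of "norm (kernel_vector f z)"])

lemma bounded_functional_coord: "bounded_functional A (\<lambda>T. ell2_coord (T x) \<gamma>)"
  by (rule bounded_functional_vector[of "\<lambda>x. ell2_coord x \<gamma>" 1]) (simp_all add: norm_ell2_coord_le)

lemma point_char_compose:
  fixes f :: "'n::finite series"
  assumes "regular_positive f" "free_polynomial f" "z \<in> open_domain f" "S \<in> domain_algebra f"
  shows "point_char f z (S o\<^sub>L T) = point_char f z S * point_char f z T"
  using point_char_mult[OF assms, of "T (ell2_basis [])"] by (simp add: point_char_def)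

lemma point_char_shift:
  fixes f :: "'n::finite series"
  assumes "regular_positive f" "free_polynomial f" "z \<in> open_domain f"
  shows "point_char f z (weighted_shift f i) = z $ i" "point_char f z id_blinfun = 1"
  using cinner_weighted_shift_word[OF assms, of "[i]" "ell2_basis []"]
  by (simp_all add: point_char_def weighted_shift_word_single cinner_vacuum_kernel_vector[OF assms])

section \<open>The kernel identity of an isomorphism\<close>

text \<open>Three points suffice: \<open>minor\<close> compares two and \<open>rank_one_step\<close>
  adds one. The transposed arguments match the Gram matrix, since \<open>cinner\<close> of the
  kernel vectors at \<open>x i\<close> and \<open>x j\<close> is the kernel at
  \<open>(x j, x i)\<close>.\<close>

definition psd3 :: "'a set \<Rightarrow> ('a \<Rightarrow> 'a \<Rightarrow> complex) \<Rightarrow> bool" where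
  "psd3 D H \<longleftrightarrow> (\<forall>x c. (\<forall>i<3. x i \<in> D) \<longrightarrow>
    0 \<le> Re (\<Sum>i<3::nat. \<Sum>j<3. c i * cnj (c j) * H (x j) (x i)))"

lemma psd3D:
  assumes "psd3 D H" "x \<in> D" "y \<in> D" "z \<in> D"
  shows "0 \<le> Re (a * cnj a * H x x + a * cnj b * H y x + a * cnj c * H z x
    + b * cnj a * H x y + b * cnj b * H y y + b * cnj c * H z y
    + c * cnj a * H x z + c * cnj b * H y z + c * cnj c * H z z)"
proof -
  define p where "p = (\<lambda>i::nat. if i = 0 then x else if i = 1 then y else z)"
  define q where "q = (\<lambda>i::nat. if i = 0 then a else if i = 1 then b else c)"
  have "0 \<le> Re (\<Sum>i<3::nat. \<Sum>j<3. q i * cnj (q j) * H (p j) (p i))"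
  proof -
    have "\<forall>i<3. p i \<in> D" using assms by (simp add: p_def)
    then show ?thesis using assms(1) unfolding psd3_def by blast
  qed
  then show ?thesis
    by (simp add: eval_nat_numeral p_def q_def add.assoc)
qed

text \<open>\<open>psd3\<close> constrains only real parts, so Hermitian symmetry is assumed
  separately.\<close>

locale hermitian_psd =
  fixes D :: "'a set" and H :: "'a \<Rightarrow> 'a \<Rightarrow> complex"
  assumes psd: "psd3 D H" and herm: "\<And>x y. x \<in> D \<Longrightarrow> y \<in> D \<Longrightarrow> H y x = cnj (H x y)"
begin

lemma diag:
  assumes "x \<in> D"
  shows "H x x = of_real (Re (H x x))" "Re (H x x) \<ge> 0"
proof -
  have "H x x = cnj (H x x)" using herm assms by blast
  then have "Im (H x x) = 0" by (metis complex_cnj complex_surj Im_complex_of_real add_eq_0_iff complex.sel(2) equal_neg_zero)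
  then show "H x x = of_real (Re (H x x))" by (simp add: complex_eq_iff)
  show "Re (H x x) \<ge> 0"
    using psd3D[OF psd assms assms assms, of 1 0 0] by simp
qed

lemma two_point:
  assumes "x \<in> D" "y \<in> D"
  shows "0 \<le> (cmod a)\<^sup>2 * Re (H x x) + (cmod b)\<^sup>2 * Re (H y y) + 2 * Re (b * cnj a * H x y)"
proof -
  define h where "h = b * cnj a * H x y"
  have "0 \<le> Re (a * cnj a * H x x + a * cnj b * H y x + h + b * cnj b * H y y)"
    using psd3D[OF psd assms assms(2), of a b 0] by (simp add: h_def)
  also have "a * cnj b * H y x = cnj h"
    using herm[OF assms] by (simp add: h_def)
  also have "a * cnj a * H x x = of_real ((cmod a)\<^sup>2 * Re (H x x))"
    using diag(1)[OF assms(1)] by (simp add: complex_norm_square del: of_real_power)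
  also have "b * cnj b * H y y = of_real ((cmod b)\<^sup>2 * Re (H y y))"
    using diag(1)[OF assms(2)] by (simp add: complex_norm_square del: of_real_power)
  finally show ?thesis by (simp flip: h_def)
qed

lemma vanish:
  assumes "x \<in> D" "y \<in> D" "H x x = 0"
  shows "H x y = 0"
proof (rule ccontr)
  assume h: "H x y \<noteq> 0"
  \<comment> \<open>Large enough for the cross term, \<open>- 2 * (Re (H y y) + 1)\<close>, to
    outweigh \<open>Re (H y y)\<close>.\<close>
  define s where "s = (Re (H y y) + 1) / (cmod (H x y))\<^sup>2"
  have "0 \<le> Re (H y y) + 2 * Re (cnj (- of_real s * H x y) * H x y)"
    using two_point[OF assms(1,2), of "- of_real s * H x y" 1] assms(3) by simp
  also have "cnj (- of_real s * H x y) * H x y = - of_real (s * (cmod (H x y))\<^sup>2)"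
    by (simp add: complex_norm_square mult_ac del: of_real_power)
  also have "s * (cmod (H x y))\<^sup>2 = Re (H y y) + 1" using h by (simp add: s_def)
  finally show False using diag(2)[OF assms(2)] by simp
qed

lemma minor:
  assumes "x \<in> D" "y \<in> D"
  shows "(cmod (H x y))\<^sup>2 \<le> Re (H x x) * Re (H y y)"
proof (cases "Re (H x x) = 0")
  case True
  then show ?thesis using vanish[OF assms] diag(1)[OF assms(1)] by simp
next
  case False
  let ?a = "Re (H x x)"
  have a: "?a > 0" using False diag(2)[OF assms(1)] by simp
  \<comment> \<open>The test vector \<open>(- H x y, H x x)\<close> is the one that becomes null
    when the minor vanishes.\<close>
  have "0 \<le> (cmod (H x y))\<^sup>2 * ?a + ?a\<^sup>2 * Re (H y y) + 2 * Re (of_real ?a * cnj (- H x y) * H x y)"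
    using two_point[OF assms, of "- H x y" "of_real ?a"] by simp
  also have "of_real ?a * cnj (- H x y) * H x y = of_real (- ?a * (cmod (H x y))\<^sup>2)"
    by (simp add: complex_norm_square mult_ac del: of_real_power)
  finally have "0 \<le> ?a * (?a * Re (H y y) - (cmod (H x y))\<^sup>2)"
    by (simp add: algebra_simps power2_eq_square)
  then show ?thesis using a by (simp add: zero_le_mult_iff)
qed

text \<open>Equality in the two-point minor for \<open>(a, w)\<close> gives a null vector of the form, and a null
  vector of a positive form lies in its kernel.\<close>

lemma rank_one_step:
  assumes D: "a \<in> D" "w \<in> D" "z \<in> D" and eq: "(cmod (H a w))\<^sup>2 = Re (H a a) * Re (H w w)"
  shows "H z w * H a a = H z a * H a w"
proof (cases "Re (H z z) = 0")
  case True
  then have "H z w = 0" "H z a = 0" using vanish[OF D(3)] D diag(1)[OF D(3)] by auto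
  then show ?thesis by simp
next
  case False
  then have zz: "Re (H z z) > 0" using diag(2)[OF D(3)] by simp
  define \<alpha> where "\<alpha> = Re (H a a)"
  define L where "L = H z w * H a a - H z a * H a w"
  \<comment> \<open>\<open>L\<close> is the pairing of the null vector
    \<open>(- H a w, \<alpha>)\<close> with \<open>z\<close>. This coefficient at \<open>z\<close>
    minimises the form, with minimum \<open>- (cmod L)\<^sup>2 / Re (H z z)\<close>.\<close>
  define e where "e = - L / of_real (Re (H z z))"
  have al: "H a a = of_real \<alpha>" using diag(1)[OF D(1)] by (simp add: \<alpha>_def)
  have "0 \<le> Re ((- H a w) * cnj (- H a w) * H a a + (- H a w) * cnj (of_real \<alpha>) * H w a + (- H a w) * cnj e * H z a
    + of_real \<alpha> * cnj (- H a w) * H a w + of_real \<alpha> * cnj (of_real \<alpha>) * H w w + of_real \<alpha> * cnj e * H z w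
    + e * cnj (- H a w) * H a z + e * cnj (of_real \<alpha>) * H w z + e * cnj e * H z z)"
    by (rule psd3D[OF psd D])
  also have "(- H a w) * cnj (- H a w) * H a a + (- H a w) * cnj (of_real \<alpha>) * H w a + (- H a w) * cnj e * H z a
    + of_real \<alpha> * cnj (- H a w) * H a w + of_real \<alpha> * cnj (of_real \<alpha>) * H w w + of_real \<alpha> * cnj e * H z w
    + e * cnj (- H a w) * H a z + e * cnj (of_real \<alpha>) * H w z + e * cnj e * H z z
    = (of_real \<alpha> * (of_real \<alpha> * H w w - H a w * cnj (H a w))) + (cnj e * L + e * cnj L + e * cnj e * H z z)"
    unfolding L_def using herm[OF D(1,2)] herm[OF D(3,1)] herm[OF D(3,2)] by (simp add: al algebra_simps)
  also have "of_real \<alpha> * H w w - H a w * cnj (H a w) = of_real (\<alpha> * Re (H w w) - (cmod (H a w))\<^sup>2)"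
    using diag(1)[OF D(2)] by (simp add: complex_norm_square del: of_real_power)
  also have "\<dots> = 0" using eq by (simp add: \<alpha>_def)
  also have "cnj e * L + e * cnj L + e * cnj e * H z z = of_real (- (cmod L)\<^sup>2 / Re (H z z))"
  proof -
    have "e * cnj e * H z z = (L * cnj L) / of_real (Re (H z z))"
      using zz by (subst diag(1)[OF D(3)]) (simp add: e_def)
    moreover have "cnj e * L = - (L * cnj L) / of_real (Re (H z z))" "e * cnj L = - (L * cnj L) / of_real (Re (H z z))"
      by (simp_all add: e_def)
    ultimately show ?thesis
      by (simp add: complex_norm_square del: of_real_power)
  qed
  finally have "(cmod L)\<^sup>2 / Re (H z z) \<le> 0" by simp
  then have "L = 0" using zz by (simp add: divide_le_0_iff)
  then show ?thesis by (simp add: L_def)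
qed

end

text \<open>The two-point minor of \<open>H\<close> bounds \<open>(cmod (H a w))\<^sup>2\<close> by
  the product of the diagonal entries, and the minor of the entrywise reciprocal gives the reverse
  inequality.\<close>

lemma rank_one_kernel:
  assumes H: "hermitian_psd D H" and inv: "hermitian_psd D (\<lambda>x y. 1 / H x y)"
    and nz: "\<And>x y. x \<in> D \<Longrightarrow> y \<in> D \<Longrightarrow> H x y \<noteq> 0" and D: "a \<in> D" "w \<in> D" "z \<in> D"
  shows "H z w * H a a = H z a * H a w"
proof (rule hermitian_psd.rank_one_step[OF H D])
  have pos: "Re (H x x) > 0" if "x \<in> D" for x
    using hermitian_psd.diag[OF H that] nz[OF that that] by (metis less_eq_real_def of_real_0)
  have inv_diag: "Re (1 / H x x) = 1 / Re (H x x)" if "x \<in> D" for x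
  proof -
    have "1 / H x x = of_real (1 / Re (H x x))"
      using hermitian_psd.diag(1)[OF H that] by (metis of_real_1 of_real_divide)
    then show ?thesis by (metis Re_complex_of_real)
  qed
  have "(cmod (1 / H a w))\<^sup>2 \<le> Re (1 / H a a) * Re (1 / H w w)"
    by (rule hermitian_psd.minor[OF inv D(1,2)])
  then have "1 / (cmod (H a w))\<^sup>2 \<le> 1 / (Re (H a a) * Re (H w w))"
    by (simp add: inv_diag D norm_divide power_divide)
  then have "Re (H a a) * Re (H w w) \<le> (cmod (H a w))\<^sup>2"
    using pos[OF D(1)] pos[OF D(2)] nz[OF D(1,2)] by (simp add: field_simps)
  with hermitian_psd.minor[OF H D(1,2)]
  show "(cmod (H a w))\<^sup>2 = Re (H a a) * Re (H w w)" by simp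
qed

lemma cinner_sum_left: "cinner (\<Sum>a\<in>S. x a) y = (\<Sum>a\<in>S. cinner (x a) y)"
  by (rule linear_sum[OF bounded_linear.linear[OF bounded_linear_cinner]])

lemma cinner_sum_right: "cinner y (\<Sum>a\<in>S. x a) = (\<Sum>a\<in>S. cinner y (x a))"
  unfolding cinner_commute[of y] by (simp add: cinner_sum_left)

lemma series_kernel_diag_Re: "Re (series_kernel h z z) = (\<Sum>\<alpha> | h \<alpha> \<noteq> 0. h \<alpha> * (cmod (word_eval z \<alpha>))\<^sup>2)"
  by (simp add: series_kernel_diag del: of_real_sum of_real_mult of_real_power)

lemma series_kernel_diag_of_real: "series_kernel h z z = of_real (Re (series_kernel h z z))"
  by (simp add: series_kernel_diag del: of_real_sum of_real_mult of_real_power)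

section \<open>Point maps and quotient kernels of an isomorphism\<close>

locale domain_isomorphism =
  fixes f g :: "'n::finite series" and \<Phi> :: "'n list op \<Rightarrow> 'n list op"
  assumes f: "regular_positive f" "free_polynomial f"
    and g: "regular_positive g" "free_polynomial g"
    and iso: "ci_isomorphism (domain_algebra f) (domain_algebra g) \<Phi>"
begin

lemma coeffs: "f [] = 0" "g [] = 0" "f \<alpha> \<ge> 0" "g \<alpha> \<ge> 0" "f [i] > 0" "g [i] > 0"
    "finite {\<alpha>. f \<alpha> \<noteq> 0}" "finite {\<alpha>. g \<alpha> \<noteq> 0}"
  using f g by (auto simp: regular_positive_def free_polynomial_def)

definition inverse_map :: "'n list op \<Rightarrow> 'n list op" where
  "inverse_map = inv_into (domain_algebra f) \<Phi>"

lemma inverse: "domain_isomorphism g f inverse_map"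
  unfolding inverse_map_def
  by unfold_locales
    (intro f g ci_isomorphism_inverse[OF iso] domain_algebra_id domain_algebra_add domain_algebra_scaleC
      domain_algebra_compose[OF f(1)]; assumption)+

lemma inverse_map [simp]:
  "S \<in> domain_algebra g \<Longrightarrow> inverse_map S \<in> domain_algebra f"
  "S \<in> domain_algebra g \<Longrightarrow> \<Phi> (inverse_map S) = S"
  "T \<in> domain_algebra f \<Longrightarrow> inverse_map (\<Phi> T) = T"
  using ci_isomorphismD(1)[OF iso]
  by (auto simp: inverse_map_def bij_betw_def intro: inv_into_into f_inv_into_f)

lemma \<Phi>_mem [simp]: "T \<in> domain_algebra f \<Longrightarrow> \<Phi> T \<in> domain_algebra g"
  by (rule ci_isomorphismD(6)[OF iso])

lemma \<Phi>_word_Cons: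
  "\<Phi> (weighted_shift_word f (i # \<alpha>)) = \<Phi> (weighted_shift f i) o\<^sub>L \<Phi> (weighted_shift_word f \<alpha>)"
  unfolding weighted_shift_word_Cons
  by (intro ci_isomorphismD(4)[OF iso] domain_algebra_shift domain_algebra_word)

lemma \<Phi>_word_Nil: "\<Phi> (weighted_shift_word f []) = id_blinfun"
  by (simp add: weighted_shift_word_Nil ci_isomorphismD(2)[OF iso])

text \<open>\<open>dual_map\<close> with \<open>point_char\<close> in place of
  \<open>point_eval\<close>. The two are compared only at the origin.\<close>

definition point_map :: "complex ^ 'n \<Rightarrow> complex ^ 'n" where
  "point_map z = (\<chi> i. point_char g z (\<Phi> (weighted_shift f i)))"

lemma point_char_word:
  assumes "z \<in> open_domain g"
  shows "point_char g z (\<Phi> (weighted_shift_word f \<alpha>)) = word_eval (point_map z) \<alpha>"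
proof (induction \<alpha>)
  case Nil
  show ?case by (simp add: \<Phi>_word_Nil point_char_shift[OF g assms])
next
  case (Cons i \<alpha>)
  then show ?case
    by (simp add: \<Phi>_word_Cons point_char_compose[OF g assms] domain_algebra_shift point_map_def)
qed

text \<open>Both sides are bounded functionals of \<open>T\<close> that agree on words. The
  assumption on \<open>point_map z\<close> is established for all \<open>z\<close> in
  \<open>point_map_mem\<close>.\<close>

lemma point_char_agree:
  assumes z: "z \<in> open_domain g" and pz: "point_map z \<in> open_domain f" and T: "T \<in> domain_algebra f"
  shows "point_char g z (\<Phi> T) = point_char f (point_map z) T"
proof (rule bounded_functional_eqI[OF _ bounded_functional_point_char _ T])
  show "bounded_functional (domain_algebra f) (\<lambda>T. point_char g z (\<Phi> T))"
    by (rule bounded_functional_comp[OF iso bounded_functional_point_char])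
  show "point_char g z (\<Phi> (weighted_shift_word f \<alpha>)) = point_char f (point_map z) (weighted_shift_word f \<alpha>)" for \<alpha>
    using cinner_weighted_shift_word[OF f pz, of \<alpha> "ell2_basis []"] cinner_vacuum_kernel_vector[OF f pz]
    by (simp add: point_char_word[OF z]) (simp add: point_char_def)
qed

lemma point_map_inj:
  assumes z: "z \<in> open_domain g" and w: "w \<in> open_domain g" and eq: "point_map z = point_map w"
  shows "z = w"
proof -
  have "point_char g z (\<Phi> T) = point_char g w (\<Phi> T)" if "T \<in> domain_algebra f" for T
    by (rule bounded_functional_eqI[OF bounded_functional_comp[OF iso bounded_functional_point_char]
          bounded_functional_comp[OF iso bounded_functional_point_char] _ that])
      (simp add: point_char_word z w eq)
  from this[of "inverse_map (weighted_shift g i)" for i]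
  have "z $ i = w $ i" for i
    by (simp add: domain_algebra_shift point_char_shift[OF g z] point_char_shift[OF g w])
  then show ?thesis by (simp add: vec_eq_iff)
qed

text \<open>Complete isometry speaks of square matrices, so the row is placed as the first row of an
  otherwise zero matrix whose size is the number of words in the support.\<close>

lemma row_contraction_image:
  "(norm (\<Sum>\<alpha> | f \<alpha> \<noteq> 0. sqrt (f \<alpha>) *\<^sub>R \<Phi> (weighted_shift_word f \<alpha>) (y \<alpha>)))\<^sup>2
     \<le> (\<Sum>\<alpha> | f \<alpha> \<noteq> 0. (norm (y \<alpha>))\<^sup>2)"
proof -
  let ?S = "{\<alpha>. f \<alpha> \<noteq> 0}"
  define m where "m = card ?S"
  have "[undefined] \<in> ?S" using coeffs(5)[of undefined] by simp
  then have m: "m \<ge> 1" unfolding m_def using coeffs(7) by (metis One_nat_def Suc_leI card_gt_0_iff empty_iff)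
  obtain e where e: "bij_betw e {..<m} ?S"
    using ex_bij_betw_nat_finite[OF coeffs(7)] unfolding m_def atLeast0LessThan by blast
  have re: "(\<Sum>\<alpha> | f \<alpha> \<noteq> 0. F \<alpha>) = (\<Sum>j<m. F (e j))" for F :: "'n list \<Rightarrow> 'z::comm_monoid_add"
    using sum.reindex_bij_betw[OF e, of F] by simp
  define X where "X = (\<lambda>(i::nat) j. scaleC_op (if i = 0 then of_real (sqrt (f (e j))) else 0) (weighted_shift_word f (e j)))"
  have X: "X i j \<in> domain_algebra f" for i j
    by (simp add: X_def domain_algebra_scaleC domain_algebra_word del: scaleC_op_0)
  have \<Phi>X: "\<Phi> (X i j) = scaleC_op (if i = 0 then of_real (sqrt (f (e j))) else 0) (\<Phi> (weighted_shift_word f (e j)))" for i j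
    unfolding X_def by (rule ci_isomorphismD(5)[OF iso domain_algebra_word])
  have row: "sqrt (\<Sum>i<m. (norm (\<Sum>j<m. scaleC_op (if i = 0 then of_real (sqrt (f (e j))) else 0) (V j) (x j)))\<^sup>2)
      = norm (\<Sum>j<m. sqrt (f (e j)) *\<^sub>R V j (x j))" for V :: "nat \<Rightarrow> 'n list op" and x
  proof -
    have row_i: "(norm (\<Sum>j<m. scaleC_op (if i = 0 then of_real (sqrt (f (e j))) else 0) (V j) (x j)))\<^sup>2
        = (if i = 0 then (norm (\<Sum>j<m. sqrt (f (e j)) *\<^sub>R V j (x j)))\<^sup>2 else 0)" for i
      by (simp add: scaleC_op_of_real blinfun.scaleR_left)
    show ?thesis unfolding row_i using m by simp
  qed
  have "op_matrix_norm m X \<le> 1"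
  proof (rule op_matrix_norm_least)
    fix x :: "nat \<Rightarrow> 'n list ell2" assume x: "(\<Sum>j<m. (norm (x j))\<^sup>2) \<le> 1"
    define y where "y \<alpha> = x (inv_into {..<m} e \<alpha>)" for \<alpha>
    have ye: "y (e j) = x j" if "j < m" for j
      using that e by (simp add: y_def bij_betw_def)
    have "(norm (\<Sum>j<m. sqrt (f (e j)) *\<^sub>R weighted_shift_word f (e j) (x j)))\<^sup>2 \<le> 1\<^sup>2"
      using row_contraction[OF f, of y] x unfolding re by (simp add: ye)
    then have "norm (\<Sum>j<m. sqrt (f (e j)) *\<^sub>R weighted_shift_word f (e j) (x j)) \<le> 1"
      by (rule power2_le_imp_le) simp
    then show "sqrt (\<Sum>i<m. (norm (\<Sum>j<m. X i j (x j)))\<^sup>2) \<le> 1"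
      unfolding X_def row .
  qed
  then have le: "op_matrix_norm m (\<lambda>i j. \<Phi> (X i j)) \<le> 1"
    using ci_isomorphismD(7)[OF iso m, of X] X by simp
  have bound: "norm (\<Sum>j<m. sqrt (f (e j)) *\<^sub>R \<Phi> (weighted_shift_word f (e j)) (x j)) \<le> 1"
    if x: "(\<Sum>j<m. (norm (x j))\<^sup>2) \<le> 1" for x
    using order_trans[OF op_matrix_norm_upper[OF x, of "\<lambda>i j. \<Phi> (X i j)"] le] unfolding \<Phi>X row .
  \<comment> \<open>Rescaling: the matrix norm tests only vectors in the unit ball.\<close>
  define s where "s = sqrt (\<Sum>j<m. (norm (y (e j)))\<^sup>2)"
  have s2: "s\<^sup>2 = (\<Sum>j<m. (norm (y (e j)))\<^sup>2)" unfolding s_def by (simp add: sum_nonneg)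
  have "norm (\<Sum>j<m. sqrt (f (e j)) *\<^sub>R \<Phi> (weighted_shift_word f (e j)) (y (e j))) \<le> s"
  proof (cases "s = 0")
    case True
    then have "(norm (y (e j)))\<^sup>2 = 0" if "j < m" for j
      using sum_nonneg_0[of "{..<m}" "\<lambda>j. (norm (y (e j)))\<^sup>2" j] s2 that by simp
    then show ?thesis using True by (simp add: blinfun.zero_right)
  next
    case False
    then have s: "s > 0" unfolding s_def by (simp add: sum_nonneg order_less_le)
    have "(\<Sum>j<m. (norm ((1 / s) *\<^sub>R y (e j)))\<^sup>2) \<le> 1"
      using s s2 by (simp add: power_mult_distrib power_divide flip: sum_divide_distrib)
    from bound[OF this]
    have "norm ((1 / s) *\<^sub>R (\<Sum>j<m. sqrt (f (e j)) *\<^sub>R \<Phi> (weighted_shift_word f (e j)) (y (e j)))) \<le> 1"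
      by (simp add: blinfun.scaleR_right scaleR_sum_right mult.commute)
    then show ?thesis using s by (simp add: divide_le_eq)
  qed
  then have "(norm (\<Sum>j<m. sqrt (f (e j)) *\<^sub>R \<Phi> (weighted_shift_word f (e j)) (y (e j))))\<^sup>2 \<le> s\<^sup>2"
    by (rule power_mono) simp
  then show ?thesis unfolding re s2 .
qed

definition quotient_kernel :: "complex ^ 'n \<Rightarrow> complex ^ 'n \<Rightarrow> complex" where
  "quotient_kernel z w = (1 - series_kernel f (point_map z) (point_map w)) / (1 - series_kernel g z w)"

lemma quotient_kernel_eq:
  assumes "z \<in> open_domain g" "w \<in> open_domain g"
  shows "1 - series_kernel g z w \<noteq> 0"
    "quotient_kernel z w = cinner (kernel_vector g w) (kernel_vector g z)
      * (1 - series_kernel f (point_map z) (point_map w))"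
proof -
  from cinner_kernel_vectors[OF g assms] show nz: "1 - series_kernel g z w \<noteq> 0" by auto
  from cinner_kernel_vectors[OF g assms]
  have "cinner (kernel_vector g w) (kernel_vector g z) = 1 / (1 - series_kernel g z w)"
    using nz by (simp add: eq_divide_eq)
  then show "quotient_kernel z w = cinner (kernel_vector g w) (kernel_vector g z)
      * (1 - series_kernel f (point_map z) (point_map w))"
    by (simp add: quotient_kernel_def)
qed

text \<open>The adjoint of \<open>\<Phi> (W\<^sub>\<alpha>)\<close> maps \<open>kernel_vector g z\<close> to a multiple of itself, so the
  row contraction, tested on combinations of kernel vectors, is a positivity statement about
  the quotient kernel.\<close>

lemma quotient_kernel_psd: "psd3 (open_domain g) quotient_kernel"
  unfolding psd3_def
proof (intro allI impI)
  fix x :: "nat \<Rightarrow> complex ^ 'n" and c :: "nat \<Rightarrow> complex"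
  assume x: "\<forall>i<3. x i \<in> open_domain g"
  let ?I = "{..<3::nat}"
  define k where "k i = kernel_vector g (x i)" for i
  define u where "u = (\<Sum>i\<in>?I. scaleC_ell2 (c i) (k i))"
  \<comment> \<open>\<open>v \<alpha>\<close> is the image of \<open>u\<close> under the adjoint of
    \<open>\<Phi> (weighted_shift_word f \<alpha>)\<close>, which acts diagonally on kernel
    vectors.\<close>
  define v where "v \<alpha> = (\<Sum>i\<in>?I. scaleC_ell2 (c i * cnj (word_eval (point_map (x i)) \<alpha>)) (k i))" for \<alpha>
  define N where "N = (\<Sum>\<alpha> | f \<alpha> \<noteq> 0. f \<alpha> * (norm (v \<alpha>))\<^sup>2)"
  define y where "y \<alpha> = sqrt (f \<alpha>) *\<^sub>R v \<alpha>" for \<alpha>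
  define s where "s = (\<Sum>\<alpha> | f \<alpha> \<noteq> 0. sqrt (f \<alpha>) *\<^sub>R \<Phi> (weighted_shift_word f \<alpha>) (y \<alpha>))"
  have N0: "N \<ge> 0" unfolding N_def by (intro sum_nonneg mult_nonneg_nonneg coeffs) auto
  have "(norm s)\<^sup>2 \<le> (\<Sum>\<alpha> | f \<alpha> \<noteq> 0. (norm (y \<alpha>))\<^sup>2)"
    unfolding s_def by (rule row_contraction_image)
  also have "\<dots> = N"
    unfolding N_def y_def by (rule sum.cong) (auto simp: power_mult_distrib coeffs)
  finally have sN: "(norm s)\<^sup>2 \<le> N" .
  have ev: "cinner (\<Phi> (weighted_shift_word f \<alpha>) w) (k i) = word_eval (point_map (x i)) \<alpha> * cinner w (k i)"
    if "i \<in> ?I" for i \<alpha> w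
    using point_char_mult[OF g, of "x i" "\<Phi> (weighted_shift_word f \<alpha>)" w] x that
    by (simp add: k_def point_char_word domain_algebra_word)
  have v_right: "cinner w (v \<alpha>) = (\<Sum>i\<in>?I. cnj (c i * cnj (word_eval (point_map (x i)) \<alpha>)) * cinner w (k i))" for w \<alpha>
    unfolding v_def cinner_sum_right cinner_scaleC_right ..
  have vu: "\<Phi> (weighted_shift_word f \<alpha>) (v \<alpha>) \<bullet> u = (norm (v \<alpha>))\<^sup>2" for \<alpha>
  proof -
    have "cinner (\<Phi> (weighted_shift_word f \<alpha>) (v \<alpha>)) u = cinner (v \<alpha>) (v \<alpha>)"
      unfolding u_def v_right cinner_sum_right cinner_scaleC_right
      by (intro sum.cong refl) (simp add: ev)
    then have "\<Phi> (weighted_shift_word f \<alpha>) (v \<alpha>) \<bullet> u = v \<alpha> \<bullet> v \<alpha>" by (metis Re_cinner)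
    then show ?thesis by (simp add: power2_norm_eq_inner)
  qed
  have "s \<bullet> u = N"
    unfolding s_def y_def inner_sum_left N_def
    by (intro sum.cong refl) (simp add: blinfun.scaleR_right vu coeffs flip: mult.assoc)
  \<comment> \<open>From here on this is the argument that the adjoint of a contraction is a
    contraction: \<open>N\<^sup>2 \<le> N * (norm u)\<^sup>2\<close>.\<close>
  then have "N \<le> norm s * norm u" using norm_cauchy_schwarz[of s u] by simp
  then have "N\<^sup>2 \<le> (norm s)\<^sup>2 * (norm u)\<^sup>2"
    using N0 by (metis power_mono power_mult_distrib)
  also have "\<dots> \<le> N * (norm u)\<^sup>2" by (intro mult_right_mono sN) simp
  finally have "N * N \<le> N * (norm u)\<^sup>2" by (simp add: power2_eq_square)
  then have "N \<le> (norm u)\<^sup>2" using N0 by (cases "N = 0") auto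
  moreover have "(norm u)\<^sup>2 = Re (\<Sum>i\<in>?I. \<Sum>j\<in>?I. c i * cnj (c j) * cinner (k i) (k j))"
    unfolding power2_norm_eq_inner Re_cinner[symmetric] u_def cinner_sum_left cinner_sum_right
      cinner_scaleC_left cinner_scaleC_right sum_distrib_left
    by (subst sum.swap, intro arg_cong[where f = Re] sum.cong refl) (simp add: mult_ac)
  moreover have "N = Re (\<Sum>i\<in>?I. \<Sum>j\<in>?I. c i * cnj (c j) * cinner (k i) (k j) * series_kernel f (point_map (x j)) (point_map (x i)))"
  proof -
    have "of_real N = (\<Sum>\<alpha> | f \<alpha> \<noteq> 0. of_real (f \<alpha>) * cinner (v \<alpha>) (v \<alpha>))"
    proof -
      have "cinner (v \<alpha>) (v \<alpha>) = of_real ((norm (v \<alpha>))\<^sup>2)" for \<alpha>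
      proof -
        have "cnj (cinner (v \<alpha>) (v \<alpha>)) = cinner (v \<alpha>) (v \<alpha>)" using cinner_commute[of "v \<alpha>" "v \<alpha>"] by simp
        then have "Im (cinner (v \<alpha>) (v \<alpha>)) = 0" by (simp add: complex_eq_iff)
        then show ?thesis by (simp add: complex_eq_iff Re_cinner power2_norm_eq_inner del: of_real_power)
      qed
      then show ?thesis by (simp add: N_def del: of_real_power)
    qed
    also have "\<dots> = (\<Sum>\<alpha> | f \<alpha> \<noteq> 0. \<Sum>i\<in>?I. \<Sum>j\<in>?I. c i * cnj (c j) * cinner (k i) (k j)
        * (of_real (f \<alpha>) * word_eval (point_map (x j)) \<alpha> * cnj (word_eval (point_map (x i)) \<alpha>)))"
      unfolding v_def cinner_sum_left cinner_sum_right cinner_scaleC_left cinner_scaleC_right sum_distrib_left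
      by (rule sum.cong[OF refl], subst sum.swap, intro sum.cong refl) (simp add: mult_ac)
    also have "\<dots> = (\<Sum>i\<in>?I. \<Sum>j\<in>?I. c i * cnj (c j) * cinner (k i) (k j) * series_kernel f (point_map (x j)) (point_map (x i)))"
      unfolding series_kernel_def sum_distrib_left
      by (subst sum.swap, intro sum.cong refl, subst sum.swap, rule refl)
    finally show ?thesis by (metis Re_complex_of_real)
  qed
  ultimately have "0 \<le> Re (\<Sum>i\<in>?I. \<Sum>j\<in>?I. c i * cnj (c j) * cinner (k i) (k j))
      - Re (\<Sum>i\<in>?I. \<Sum>j\<in>?I. c i * cnj (c j) * cinner (k i) (k j) * series_kernel f (point_map (x j)) (point_map (x i)))"
    by simp
  also have "\<dots> = Re (\<Sum>i\<in>?I. \<Sum>j\<in>?I. c i * cnj (c j) * quotient_kernel (x j) (x i))"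
    unfolding minus_complex.sel[symmetric] sum_subtractf[symmetric]
    using x by (intro arg_cong[where f = Re] sum.cong refl) (simp add: quotient_kernel_eq(2) k_def algebra_simps)
  finally show "0 \<le> Re (\<Sum>i<3. \<Sum>j<3. c i * cnj (c j) * quotient_kernel (x j) (x i))" .
qed

lemma quotient_kernel_hermitian: "hermitian_psd (open_domain g) quotient_kernel"
  by (unfold_locales, rule quotient_kernel_psd) (simp add: quotient_kernel_def cnj_series_kernel)

text \<open>A maximum principle. Positivity on the diagonal puts the image into the closed domain.
  At a boundary point the diagonal entry is zero, so the quotient kernel vanishes along
  \<open>z\<close>. Then \<open>point_map\<close> is constant, contradicting injectivity.\<close>

lemma point_map_mem:
  assumes z: "z \<in> open_domain g"
  shows "point_map z \<in> open_domain f"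
proof (rule ccontr)
  let ?p = "\<lambda>z w. series_kernel f (point_map z) (point_map w)"
  interpret H: hermitian_psd "open_domain g" quotient_kernel by (rule quotient_kernel_hermitian)
  have le: "Re (?p w w) \<le> 1" if w: "w \<in> open_domain g" for w
  proof -
    have "Re (series_kernel g w w) < 1" using w by (simp add: series_kernel_diag_Re open_domain_def)
    moreover have "quotient_kernel w w = of_real ((1 - Re (?p w w)) / (1 - Re (series_kernel g w w)))"
      unfolding quotient_kernel_def
      by (metis (no_types) series_kernel_diag_of_real of_real_1 of_real_diff of_real_divide)
    then have "(1 - Re (?p w w)) / (1 - Re (series_kernel g w w)) \<ge> 0"
      using H.diag(2)[OF w] by simp
    ultimately show ?thesis by (simp add: zero_le_divide_iff)
  qed
  assume "point_map z \<notin> open_domain f"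
  then have "Re (?p z z) = 1" using le[OF z] by (simp add: series_kernel_diag_Re open_domain_def)
  then have pz: "?p z z = 1" using series_kernel_diag_of_real[of f "point_map z"] by simp
  then have "quotient_kernel z z = 0" by (simp add: quotient_kernel_def)
  then have pzw: "?p z w = 1" if w: "w \<in> open_domain g" for w
    using H.vanish[OF z w] quotient_kernel_eq(1)[OF z w] by (simp add: quotient_kernel_def)
  have const: "point_map w = point_map z" if w: "w \<in> open_domain g" for w
  proof -
    let ?d = "\<lambda>\<alpha>. f \<alpha> * (cmod (word_eval (point_map w) \<alpha> - word_eval (point_map z) \<alpha>))\<^sup>2"
    \<comment> \<open>Expanding the square gives \<open>Re (?p w w) - 1\<close>, which is at most
      zero, so every weighted distance vanishes.\<close>
    have "of_real (\<Sum>\<alpha> | f \<alpha> \<noteq> 0. ?d \<alpha>) = ?p w w - ?p w z - ?p z w + ?p z z"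
      unfolding series_kernel_def sum_subtractf[symmetric] sum.distrib[symmetric] of_real_sum of_real_mult complex_norm_square
      by (intro sum.cong refl) (simp add: algebra_simps)
    also have "?p w z = 1" using pzw[OF w] cnj_series_kernel[of f "point_map z" "point_map w"] by simp
    also have "?p w w - 1 - ?p z w + ?p z z = of_real (Re (?p w w) - 1)"
      using pzw[OF w] pz series_kernel_diag_of_real[of f "point_map w"] by simp
    finally have "(\<Sum>\<alpha> | f \<alpha> \<noteq> 0. ?d \<alpha>) = Re (?p w w) - 1" by (rule of_real_eq_iff[THEN iffD1])
    then have "(\<Sum>\<alpha> | f \<alpha> \<noteq> 0. ?d \<alpha>) = 0"
      using le[OF w] sum_nonneg[of "{\<alpha>. f \<alpha> \<noteq> 0}" ?d] coeffs(3) by fastforce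
    then have "?d [i] = 0" for i
      by (rule sum_nonneg_0[OF coeffs(7), rotated]) (use coeffs(3) coeffs(5)[of i] in auto)
    then have "point_map w $ i = point_map z $ i" for i
      using coeffs(5)[of i] by (metis eq_iff_diff_eq_0 less_irrefl mult_eq_0_iff norm_eq_zero power_eq_0_iff
          word_eval_simps mult.right_neutral)
    then show ?thesis by (simp add: vec_eq_iff)
  qed
  then have all: "w = z" if "w \<in> open_domain g" for w
    using point_map_inj[OF that z] that by blast
  obtain \<epsilon> :: real where \<epsilon>: "\<epsilon> > 0" "of_real \<epsilon> *s axis undefined 1 \<in> open_domain g"
    using open_domain_absorbing[of g "axis undefined 1"] coeffs by metis
  have "of_real \<epsilon> *s axis undefined 1 = (0 :: complex ^ 'n)"
    using all[OF \<epsilon>(2)] all[OF zero_in_open_domain[of g, OF coeffs(2)]] by simp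
  then show False using \<epsilon>(1) by (simp add: axis_eq_0_iff)
qed

lemma inverse_point_map:
  assumes z: "z \<in> open_domain g"
  shows "domain_isomorphism.point_map g f inverse_map (point_map z) = z"
proof -
  interpret inv: domain_isomorphism g f inverse_map by (rule inverse)
  have "point_char f (point_map z) (inverse_map (weighted_shift g i)) = z $ i" for i
    using point_char_agree[OF z point_map_mem[OF z], of "inverse_map (weighted_shift g i)"]
    by (simp add: domain_algebra_shift point_char_shift[OF g z])
  then show ?thesis by (simp add: inv.point_map_def vec_eq_iff)
qed

text \<open>The reciprocal kernel is the quotient kernel of the inverse isomorphism at the
  transported points, hence positive as well.\<close>

lemma quotient_kernel_rank_one:
  assumes z: "z \<in> open_domain g" and w: "w \<in> open_domain g"
  shows "quotient_kernel z w * quotient_kernel 0 0 = quotient_kernel z 0 * quotient_kernel 0 w"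
proof (rule rank_one_kernel[OF quotient_kernel_hermitian])
  interpret inv: domain_isomorphism g f inverse_map by (rule inverse)
  have inv_kernel: "1 / quotient_kernel z w = inv.quotient_kernel (point_map z) (point_map w)"
    if "z \<in> open_domain g" "w \<in> open_domain g" for z w
    by (simp add: quotient_kernel_def inv.quotient_kernel_def inverse_point_map that)
  show "hermitian_psd (open_domain g) (\<lambda>x y. 1 / quotient_kernel x y)"
  proof
    show "psd3 (open_domain g) (\<lambda>x y. 1 / quotient_kernel x y)"
      unfolding psd3_def
    proof (intro allI impI)
      fix x :: "nat \<Rightarrow> complex ^ 'n" and c :: "nat \<Rightarrow> complex"
      assume x: "\<forall>i<3. x i \<in> open_domain g"
      then have "\<forall>i<3. point_map (x i) \<in> open_domain f" by (simp add: point_map_mem)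
      then have "0 \<le> Re (\<Sum>i<3. \<Sum>j<3. c i * cnj (c j) * inv.quotient_kernel (point_map (x j)) (point_map (x i)))"
        using inv.quotient_kernel_psd[unfolded psd3_def, rule_format, of "\<lambda>i. point_map (x i)" c] by blast
      also have "\<dots> = Re (\<Sum>i<3. \<Sum>j<3. c i * cnj (c j) * (1 / quotient_kernel (x j) (x i)))"
        using x by (intro arg_cong[where f = Re] sum.cong refl) (simp only: lessThan_iff inv_kernel)
      finally show "0 \<le> Re (\<Sum>i<3. \<Sum>j<3. c i * cnj (c j) * (1 / quotient_kernel (x j) (x i)))" .
    qed
    show "1 / quotient_kernel y x = cnj (1 / quotient_kernel x y)" for x y
      by (simp add: quotient_kernel_def cnj_series_kernel)
  qed
  show "quotient_kernel x y \<noteq> 0" if "x \<in> open_domain g" "y \<in> open_domain g" for x y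
    using quotient_kernel_eq(1)[OF that] inv.quotient_kernel_eq(1)[OF point_map_mem point_map_mem, OF that]
    by (simp add: quotient_kernel_def)
qed (use z w coeffs zero_in_open_domain[of g] in auto)

lemma point_map_bij: "bij_betw point_map (open_domain g) (open_domain f)"
proof -
  interpret inv: domain_isomorphism g f inverse_map by (rule inverse)
  have inv2: "point_map (inv.point_map y) = y" if y: "y \<in> open_domain f" for y
  proof -
    have "point_char g (inv.point_map y) (\<Phi> (weighted_shift f i)) = y $ i" for i
      using inv.point_char_agree[OF y inv.point_map_mem[OF y], of "\<Phi> (weighted_shift f i)"]
      by (simp add: domain_algebra_shift point_char_shift[OF f y])
    then show ?thesis by (simp add: point_map_def vec_eq_iff)
  qed
  show ?thesis
    by (rule bij_betwI[of _ _ _ inv.point_map])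
      (auto simp: point_map_mem inv.point_map_mem inverse_point_map inv2)
qed

lemma kernel_correspondence:
  "\<exists>h. kernel_correspondence f g point_map h"
proof -
  interpret inv: domain_isomorphism g f inverse_map by (rule inverse)
  interpret H: hermitian_psd "open_domain g" quotient_kernel by (rule quotient_kernel_hermitian)
  have 0: "0 \<in> open_domain g" using zero_in_open_domain[of g] coeffs by auto
  have nz: "quotient_kernel x y \<noteq> 0" if "x \<in> open_domain g" "y \<in> open_domain g" for x y
    using quotient_kernel_eq(1)[OF that] inv.quotient_kernel_eq(1)[OF point_map_mem point_map_mem, OF that]
    by (simp add: quotient_kernel_def)
  define a where "a = Re (quotient_kernel 0 0)"
  have a: "quotient_kernel 0 0 = of_real a" using H.diag(1)[OF 0] by (simp add: a_def)
  have "a \<noteq> 0" using nz[OF 0 0] unfolding a by simp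
  then have a0: "a > 0" using H.diag(2)[OF 0] unfolding a_def by linarith
  \<comment> \<open>The rank-one factorization through the base point 0, with the positive value
    \<open>a\<close> of the kernel at \<open>(0, 0)\<close> shared equally between both
    factors.\<close>
  define h where "h z = quotient_kernel z 0 / of_real (sqrt a)" for z
  have "kernel_correspondence f g point_map h"
  proof
    show "h z \<noteq> 0" if "z \<in> open_domain g" for z using nz[OF that 0] a0 by (simp add: h_def)
    show "1 - series_kernel f (point_map z) (point_map w) = h z * cnj (h w) * (1 - series_kernel g z w)"
      if z: "z \<in> open_domain g" and w: "w \<in> open_domain g" for z w
    proof -
      have sq: "of_real (sqrt a) * of_real (sqrt a) = complex_of_real a"
        using a0 by (simp flip: of_real_mult)
      have "h z * cnj (h w) = quotient_kernel z 0 * quotient_kernel 0 w / of_real a"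
        unfolding H.herm[OF w 0] sq[symmetric] by (simp add: h_def)
      also have "\<dots> = quotient_kernel z w"
        using quotient_kernel_rank_one[OF z w] a a0 by (simp add: field_simps)
      finally show ?thesis
        using quotient_kernel_eq(1)[OF z w] by (simp add: quotient_kernel_def)
    qed
  qed (rule f g point_map_bij)+
  then show ?thesis by blast
qed

text \<open>\<open>image_0\<close> wants the long word in the second series of a correspondence, so
  it is applied to the inverse, whose second series is \<open>f\<close>. Injectivity of the inverse
  point map transfers the conclusion.\<close>

lemma point_map_0:
  assumes "f \<gamma> \<noteq> 0" "length \<gamma> \<ge> 2"
  shows "point_map 0 = 0"
proof -
  interpret inv: domain_isomorphism g f inverse_map by (rule inverse)
  obtain h where "kernel_correspondence g f inv.point_map h" using inv.kernel_correspondence ..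
  then have "inv.point_map 0 = 0" using assms by (rule kernel_correspondence.image_0)
  moreover have "inv.point_map (point_map 0) = 0"
    by (rule inverse_point_map) (rule zero_in_open_domain, rule coeffs)
  moreover have "inj_on inv.point_map (open_domain f)"
    using inv.point_map_bij by (simp add: bij_betw_def)
  moreover have "point_map 0 \<in> open_domain f"
    by (rule point_map_mem, rule zero_in_open_domain, rule coeffs)
  moreover have "0 \<in> open_domain f" by (rule zero_in_open_domain, rule coeffs)
  ultimately show ?thesis by (metis inj_onD)
qed

end

section \<open>Evaluation at the origin and linear parts\<close>

lemma point_char_0:
  fixes g :: "'n::finite series"
  assumes g: "regular_positive g" "free_polynomial g"
  shows "point_char g 0 T = ell2_coord (T (ell2_basis [])) []"
proof -
  have 0: "0 \<in> open_domain g" using g by (intro zero_in_open_domain) (simp add: regular_positive_def)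
  have "ell2_coord (kernel_vector g 0) \<alpha> = (if \<alpha> = [] then 1 else 0)" for \<alpha>
    by (simp add: kernel_vector_coord[OF g 0] weight_def word_eval_0)
  then have "((\<lambda>\<alpha>. ell2_coord (T (ell2_basis [])) \<alpha> * cnj (ell2_coord (kernel_vector g 0) \<alpha>))
      has_sum ell2_coord (T (ell2_basis [])) []) UNIV"
    by (intro has_sum_finite_neutralI[of "{[]}"]) auto
  then show ?thesis unfolding point_char_def by (rule has_sum_unique[OF has_sum_cinner])
qed

lemma norm_ell2_basis [simp]: "norm (ell2_basis a) = 1"
proof -
  have "((\<lambda>i. (cmod (ell2_coord (ell2_basis a) i))\<^sup>2) has_sum 1) UNIV"
    by (rule has_sum_finite_neutralI[of "{a}"]) auto
  from has_sum_unique[OF norm_ell2_power2 this] have "(norm (ell2_basis a))\<^sup>2 = 1" .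
  then show ?thesis by (simp add: power2_eq_1_iff) (metis norm_ge_zero not_one_le_zero neg_0_le_iff_le order_trans zero_le_one)
qed

lemma cc_character_bounded_functional:
  assumes "cc_character A \<pi>"
  shows "bounded_functional A \<pi>"
proof -
  have "cmod (\<pi> T) \<le> 1 * norm T" if "T \<in> A" for T
  proof -
    have "op_matrix_norm (Suc 0) (\<lambda>i j. blinfun_mult_right (\<pi> T)) \<le> op_matrix_norm (Suc 0) (\<lambda>_ _. T)"
      using assms[unfolded cc_character_def, THEN conjunct2, THEN conjunct2, THEN conjunct2,
          rule_format, of "Suc 0" "\<lambda>_ _. T"] that by simp
    then have "norm (blinfun_mult_right (\<pi> T)) \<le> norm T" by (simp only: op_matrix_norm_1)
    moreover have "cmod (\<pi> T) \<le> norm (blinfun_mult_right (\<pi> T))"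
      using norm_blinfun[of "blinfun_mult_right (\<pi> T)" 1] by simp
    ultimately show ?thesis by simp
  qed
  then show ?thesis using assms unfolding bounded_functional_def cc_character_def by blast
qed

text \<open>On the algebra this is compression to the vacuum vector: with \<open>x j\<close> times
  the vacuum as input, the scalar matrix yields the coordinates at \<open>[]\<close> of what
  \<open>X\<close> yields.\<close>

lemma vacuum_cc_character:
  fixes g :: "'n::finite series"
  assumes g: "regular_positive g" "free_polynomial g"
  shows "cc_character (domain_algebra g) (restrict (point_char g 0) (domain_algebra g))"
  unfolding cc_character_def
proof (intro conjI allI impI ballI)
  let ?A = "domain_algebra g" and ?\<pi> = "restrict (point_char g 0) (domain_algebra g)"
  have 0: "0 \<in> open_domain g" using g by (intro zero_in_open_domain) (simp add: regular_positive_def)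
  show "?\<pi> id_blinfun = 1" by (simp add: domain_algebra_id point_char_shift[OF g 0])
  show "?\<pi> (S + T) = ?\<pi> S + ?\<pi> T" if "S \<in> ?A" "T \<in> ?A" for S T
    using that by (simp add: domain_algebra_add point_char_def blinfun.add_left cinner_add_left)
  show "?\<pi> (S o\<^sub>L T) = ?\<pi> S * ?\<pi> T" if "S \<in> ?A" "T \<in> ?A" for S T
    using that by (simp add: domain_algebra_compose[OF g(1)] point_char_compose[OF g 0])
  show "?\<pi> (scaleC_op c T) = c * ?\<pi> T" if "T \<in> ?A" for c T
    using that by (simp add: domain_algebra_scaleC point_char_def scaleC_op_apply cinner_scaleC_left)
  show "op_matrix_norm m (\<lambda>i j. blinfun_mult_right (?\<pi> (X i j))) \<le> op_matrix_norm m X"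
    if "m \<ge> 1" and X: "\<forall>i<m. \<forall>j<m. X i j \<in> ?A" for m X
  proof (rule op_matrix_norm_least)
    fix x :: "nat \<Rightarrow> complex" assume x: "(\<Sum>j<m. (norm (x j))\<^sup>2) \<le> 1"
    define y :: "nat \<Rightarrow> 'n list ell2" where "y j = scaleC_ell2 (x j) (ell2_basis [])" for j
    have "cmod (\<Sum>j<m. blinfun_mult_right (?\<pi> (X i j)) (x j)) \<le> norm (\<Sum>j<m. X i j (y j))" if "i < m" for i
    proof -
      have "(\<Sum>j<m. blinfun_mult_right (?\<pi> (X i j)) (x j)) = ell2_coord (\<Sum>j<m. X i j (y j)) []"
        unfolding ell2_coord_sum using X that
        by (intro sum.cong refl) (simp add: y_def domain_algebra_complex_linear[OF g(1)] point_char_0[OF g])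
      then show ?thesis by (simp add: norm_ell2_coord_le)
    qed
    then have "sqrt (\<Sum>i<m. (cmod (\<Sum>j<m. blinfun_mult_right (?\<pi> (X i j)) (x j)))\<^sup>2)
        \<le> sqrt (\<Sum>i<m. (norm (\<Sum>j<m. X i j (y j)))\<^sup>2)"
      by (intro real_sqrt_le_mono sum_mono power_mono) auto
    also have "\<dots> \<le> op_matrix_norm m X"
      using x by (intro op_matrix_norm_upper) (simp add: y_def norm_scaleC_ell2)
    finally show "sqrt (\<Sum>i<m. (cmod (\<Sum>j<m. blinfun_mult_right (?\<pi> (X i j)) (x j)))\<^sup>2) \<le> op_matrix_norm m X" .
  qed
qed

text \<open>A character vanishing on the shifts kills every nonempty word, so it is determined on
  words and then, by contractivity, on the whole algebra.\<close>

lemma point_eval_0: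
  fixes g :: "'n::finite series"
  assumes g: "regular_positive g" "free_polynomial g" and T: "T \<in> domain_algebra g"
  shows "point_eval g 0 T = point_char g 0 T"
proof -
  let ?A = "domain_algebra g" and ?\<pi> = "restrict (point_char g 0) (domain_algebra g)"
  have 0: "0 \<in> open_domain g" using g by (intro zero_in_open_domain) (simp add: regular_positive_def)
  have "point_eval g 0 = ?\<pi>"
    unfolding point_eval_def
  proof (rule the_equality)
    show "?\<pi> \<in> extensional ?A \<and> cc_character ?A ?\<pi> \<and> (\<forall>j. ?\<pi> (weighted_shift g j) = 0 $ j)"
      by (simp add: vacuum_cc_character[OF g] domain_algebra_shift point_char_shift[OF g 0])
  next
    fix \<pi> assume \<pi>: "\<pi> \<in> extensional ?A \<and> cc_character ?A \<pi> \<and> (\<forall>j. \<pi> (weighted_shift g j) = 0 $ j)"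
    show "\<pi> = ?\<pi>"
    proof (rule extensionalityI[of _ ?A])
      fix T assume T: "T \<in> ?A"
      have w: "\<pi> (weighted_shift_word g \<alpha>) = (if \<alpha> = [] then 1 else 0)" for \<alpha>
      proof (cases \<alpha>)
        case Nil
        then show ?thesis using \<pi> by (simp add: weighted_shift_word_Nil cc_character_def)
      next
        case (Cons i \<beta>)
        have "\<pi> (weighted_shift g i o\<^sub>L weighted_shift_word g \<beta>) = \<pi> (weighted_shift g i) * \<pi> (weighted_shift_word g \<beta>)"
          using \<pi> domain_algebra_shift[of g i] domain_algebra_word[of g \<beta>] unfolding cc_character_def by blast
        then show ?thesis using \<pi> Cons by (simp add: weighted_shift_word_Cons)
      qed
      have "\<pi> T = point_char g 0 T"
      proof (rule bounded_functional_eqI[OF _ bounded_functional_point_char _ T])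
        show "bounded_functional ?A \<pi>" using \<pi> cc_character_bounded_functional by blast
        fix \<alpha>
        show "\<pi> (weighted_shift_word g \<alpha>) = point_char g 0 (weighted_shift_word g \<alpha>)"
          using cinner_weighted_shift_word[OF g 0, of \<alpha> "ell2_basis []"] cinner_vacuum_kernel_vector[OF g 0]
          by (simp add: w point_char_def word_eval_0)
      qed
      then show "\<pi> T = ?\<pi> T" using T by simp
    qed (use \<pi> in auto)
  qed
  then show ?thesis using T by simp
qed

lemma weight_single: "weight f [i] = f [i]" for f :: "'n::finite series"
  using weight_split[of "[i]" f] by (simp add: weight_def)

text \<open>The row contraction applied to a family supported on one-letter words, with entry
  \<open>scaleC_ell2 (c i) x\<close> at \<open>[i]\<close>.\<close>

lemma row_contraction_linear:
  fixes f :: "'n::finite series"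
  assumes f: "regular_positive f" "free_polynomial f"
  shows "norm (\<Sum>i\<in>UNIV. scaleC_op (c i * of_real (sqrt (f [i]))) (weighted_shift f i))
      \<le> sqrt (\<Sum>i\<in>UNIV. (cmod (c i))\<^sup>2)"
proof (rule norm_blinfun_bound)
  fix x :: "'n list ell2"
  have fin: "finite {\<alpha>. f \<alpha> \<noteq> 0}" using f by (simp add: free_polynomial_def)
  have pos: "f [i] > 0" for i using f by (simp add: regular_positive_def)
  define y where "y \<alpha> = (if length \<alpha> = 1 then scaleC_ell2 (c (hd \<alpha>)) x else 0)" for \<alpha>
  have sub: "range (\<lambda>i. [i]) \<subseteq> {\<alpha>. f \<alpha> \<noteq> 0}" using pos by (auto simp: less_imp_neq[symmetric])
  have red: "(\<Sum>\<alpha> | f \<alpha> \<noteq> 0. F \<alpha>) = (\<Sum>i\<in>UNIV. F [i])"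
    if "\<And>\<alpha>. length \<alpha> \<noteq> 1 \<Longrightarrow> F \<alpha> = 0" for F :: "'n list \<Rightarrow> 'z::comm_monoid_add"
  proof -
    have "(\<Sum>\<alpha> | f \<alpha> \<noteq> 0. F \<alpha>) = (\<Sum>\<alpha>\<in>range (\<lambda>i. [i]). F \<alpha>)"
    proof (rule sum.mono_neutral_right[OF fin sub], safe)
      fix \<alpha> assume "\<alpha> \<notin> range (\<lambda>i :: 'n. [i])"
      then have "length \<alpha> \<noteq> 1" by (auto simp: length_Suc_conv)
      then show "F \<alpha> = 0" by (rule that)
    qed
    also have "\<dots> = (\<Sum>i\<in>UNIV. F [i])" by (subst sum.reindex) (auto simp: inj_on_def)
    finally show ?thesis .
  qed
  have "(norm (\<Sum>i\<in>UNIV. sqrt (f [i]) *\<^sub>R weighted_shift_word f [i] (y [i])))\<^sup>2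
      \<le> (\<Sum>i\<in>UNIV. (norm (y [i]))\<^sup>2)"
    using row_contraction[OF f, of y]
    by (subst (asm) (1 2) red) (auto simp: y_def blinfun.zero_right)
  also have "(\<Sum>i\<in>UNIV. (norm (y [i]))\<^sup>2) = (\<Sum>i\<in>UNIV. (cmod (c i))\<^sup>2) * (norm x)\<^sup>2"
    by (simp add: y_def norm_scaleC_ell2 power_mult_distrib sum_distrib_right)
  also have "(\<Sum>i\<in>UNIV. sqrt (f [i]) *\<^sub>R weighted_shift_word f [i] (y [i]))
      = (\<Sum>i\<in>UNIV. scaleC_op (c i * of_real (sqrt (f [i]))) (weighted_shift f i)) x"
    unfolding blinfun.sum_left
    by (intro sum.cong refl ell2_eqI)
      (simp add: y_def weighted_shift_word_single scaleC_op_apply domain_algebra_complex_linear[OF f(1) domain_algebra_shift])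
  finally have "(norm ((\<Sum>i\<in>UNIV. scaleC_op (c i * of_real (sqrt (f [i]))) (weighted_shift f i)) x))\<^sup>2
      \<le> (sqrt (\<Sum>i\<in>UNIV. (cmod (c i))\<^sup>2) * norm x)\<^sup>2"
    by (simp add: power_mult_distrib sum_nonneg)
  then show "norm ((\<Sum>i\<in>UNIV. scaleC_op (c i * of_real (sqrt (f [i]))) (weighted_shift f i)) x)
      \<le> sqrt (\<Sum>i\<in>UNIV. (cmod (c i))\<^sup>2) * norm x"
    by (rule power2_le_imp_le) (simp add: sum_nonneg)
qed (simp add: sum_nonneg)

text \<open>A one-letter word has only two splittings. On products this is the Leibniz rule for a
  point derivation at the vacuum.\<close>

lemma ell2_coord_single:
  fixes g :: "'n::finite series"
  assumes g: "regular_positive g" and T: "T \<in> domain_algebra g"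
  shows "ell2_coord (T x) [j] = ell2_coord (T (ell2_basis [])) [] * ell2_coord x [j]
      + ell2_coord (T (ell2_basis [])) [j] * ell2_coord x []"
  using weight_pos[OF g, of "[j]"] by (subst domain_algebra_coord[OF g T]) (simp add: weight_def[of g "[]"])

lemma ell2_coord_Nil:
  fixes g :: "'n::finite series"
  assumes g: "regular_positive g" and T: "T \<in> domain_algebra g"
  shows "ell2_coord (T x) [] = ell2_coord (T (ell2_basis [])) [] * ell2_coord x []"
  by (subst domain_algebra_coord[OF g T]) (simp add: weight_def[of g "[]"])

lemma weighted_shift_vacuum:
  fixes g :: "'n::finite series"
  assumes g: "regular_positive g"
  shows "weighted_shift g j (ell2_basis []) = (1 / sqrt (g [j])) *\<^sub>R ell2_basis [j]"
  by (simp add: weighted_shift_basis[OF g] weight_single weight_def[of g "[]"] real_sqrt_divide)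

context domain_isomorphism
begin

text \<open>Chain rule for the point derivations at the vacuum.\<close>

lemma linear_part_image:
  assumes vac: "\<And>i. ell2_coord (\<Phi> (weighted_shift f i) (ell2_basis [])) [] = 0"
    and T: "T \<in> domain_algebra f"
  shows "ell2_coord (\<Phi> T (ell2_basis [])) [j] =
    (\<Sum>i\<in>UNIV. ell2_coord (T (ell2_basis [])) [i] * of_real (sqrt (f [i]))
       * ell2_coord (\<Phi> (weighted_shift f i) (ell2_basis [])) [j])"
proof (rule bounded_functional_eqI[OF _ _ _ T])
  show "bounded_functional (domain_algebra f) (\<lambda>T. ell2_coord (\<Phi> T (ell2_basis [])) [j])"
    by (rule bounded_functional_comp[OF iso bounded_functional_coord])
  define d where "d i = of_real (sqrt (f [i])) * ell2_coord (\<Phi> (weighted_shift f i) (ell2_basis [])) [j]" for i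
  define L where "L x = (\<Sum>i\<in>UNIV. ell2_coord x [i] * d i)" for x
  have "bounded_functional (domain_algebra f) (\<lambda>T. L (T (ell2_basis [])))"
  proof (rule bounded_functional_vector)
    show "L (x + y) = L x + L y" for x y by (simp add: L_def distrib_right sum.distrib)
    show "L (scaleC_ell2 c x) = c * L x" for c x by (simp add: L_def sum_distrib_left mult.assoc)
    show "cmod (L x) \<le> (\<Sum>i\<in>UNIV. cmod (d i)) * norm x" for x
      unfolding L_def sum_distrib_right
      by (rule sum_norm_le) (simp add: norm_mult mult.commute[of _ "norm x"] mult_right_mono norm_ell2_coord_le)
  qed
  then show "bounded_functional (domain_algebra f) (\<lambda>T. \<Sum>i\<in>UNIV. ell2_coord (T (ell2_basis [])) [i]
      * of_real (sqrt (f [i])) * ell2_coord (\<Phi> (weighted_shift f i) (ell2_basis [])) [j])"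
    by (simp add: L_def d_def mult.assoc)
  fix \<alpha>
  show "ell2_coord (\<Phi> (weighted_shift_word f \<alpha>) (ell2_basis [])) [j] =
    (\<Sum>i\<in>UNIV. ell2_coord (weighted_shift_word f \<alpha> (ell2_basis [])) [i] * of_real (sqrt (f [i]))
       * ell2_coord (\<Phi> (weighted_shift f i) (ell2_basis [])) [j])"
  proof (cases \<alpha>)
    case Nil
    show ?thesis unfolding Nil \<Phi>_word_Nil by (simp add: weighted_shift_word_Nil)
  next
    case (Cons i \<beta>)
    have l: "ell2_coord (\<Phi> (weighted_shift_word f \<alpha>) (ell2_basis [])) [j]
        = ell2_coord (\<Phi> (weighted_shift f i) (ell2_basis [])) [j] * ell2_coord (\<Phi> (weighted_shift_word f \<beta>) (ell2_basis [])) []"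
      unfolding Cons \<Phi>_word_Cons blinfun_apply_blinfun_compose
      by (subst ell2_coord_single[OF g(1)]) (simp_all add: domain_algebra_shift vac)
    show ?thesis
    proof (cases \<beta>)
      case Nil
      have "ell2_coord (weighted_shift_word f \<alpha> (ell2_basis [])) [k] * of_real (sqrt (f [k]))
         * ell2_coord (\<Phi> (weighted_shift f k) (ell2_basis [])) [j]
         = (if k = i then ell2_coord (\<Phi> (weighted_shift f i) (ell2_basis [])) [j] else 0)" for k
        using coeffs(5)[of i]
        by (simp add: Cons Nil weighted_shift_word_single weighted_shift_vacuum[OF f(1)] flip: of_real_mult)
      then show ?thesis unfolding l by (simp add: Nil \<Phi>_word_Nil)
    next
      \<comment> \<open>For words of length at least 2 both sides vanish, the left one because
        \<open>\<Phi>\<close> preserves a zero vacuum coordinate.\<close>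
      case Cons': (Cons k \<gamma>)
      have "ell2_coord (\<Phi> (weighted_shift_word f \<beta>) (ell2_basis [])) [] = 0"
        unfolding Cons' \<Phi>_word_Cons blinfun_apply_blinfun_compose
        by (subst ell2_coord_Nil[OF g(1)]) (simp_all add: domain_algebra_shift vac)
      moreover have "ell2_coord (weighted_shift_word f \<alpha> (ell2_basis [])) [l] = 0" for l
        by (simp add: weighted_shift_word_coord[OF f(1)] Cons Cons')
      ultimately show ?thesis unfolding l by simp
    qed
  qed
qed

text \<open>Let \<open>R\<close> be the linear part of \<open>T\<close>. By the chain rule for the
  inverse, \<open>inverse_map R\<close> has the same linear coefficient
  \<open>1 / sqrt (f [i])\<close> as the shift itself, so \<open>norm R\<close> is at least that,
  while \<open>row_contraction_linear\<close> bounds \<open>norm R\<close> by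
  \<open>sqrt \<delta>\<close>. Hence the one-letter coordinates of \<open>v\<close> already have
  square sum at least \<open>1 / f [i]\<close>, which is an upper bound for
  \<open>(norm v)\<^sup>2\<close>.\<close>

lemma image_of_shift_linear:
  assumes "point_map 0 = 0"
  shows "\<Phi> (weighted_shift f i) = (\<Sum>j\<in>UNIV. scaleC_op
    (ell2_coord (\<Phi> (weighted_shift f i) (ell2_basis [])) [j] * of_real (sqrt (g [j]))) (weighted_shift g j))"
proof -
  interpret inv: domain_isomorphism g f inverse_map by (rule inverse)
  define T where "T = \<Phi> (weighted_shift f i)"
  define v where "v = T (ell2_basis [])"
  define R where "R = (\<Sum>j\<in>UNIV. scaleC_op (ell2_coord v [j] * of_real (sqrt (g [j]))) (weighted_shift g j))"
  have T: "T \<in> domain_algebra g" by (simp add: T_def domain_algebra_shift)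
  have R: "R \<in> domain_algebra g"
    unfolding R_def by (intro domain_algebra_sum domain_algebra_scaleC domain_algebra_shift)
  have 0: "0 \<in> open_domain g" by (rule zero_in_open_domain) (rule coeffs)
  have vac: "ell2_coord (\<Phi> (weighted_shift f i) (ell2_basis [])) [] = 0" for i
    using assms by (simp add: point_map_def vec_eq_iff point_char_0[OF g])
  have inv0: "inv.point_map 0 = 0" using inverse_point_map[OF 0] assms by simp
  have inv_vac: "ell2_coord (inverse_map (weighted_shift g i) (ell2_basis [])) [] = 0" for i
    using inv0 by (simp add: inv.point_map_def vec_eq_iff point_char_0[OF f])
  have vj: "ell2_coord (R (ell2_basis [])) \<beta> = (\<Sum>j\<in>UNIV. if \<beta> = [j] then ell2_coord v [j] else 0)" for \<beta>
    unfolding R_def blinfun.sum_left ell2_coord_sum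
  proof (intro sum.cong refl)
    fix j
    have "sqrt (g [j]) \<noteq> 0" using coeffs(6)[of j] by simp
    then show "ell2_coord (scaleC_op (ell2_coord v [j] * of_real (sqrt (g [j]))) (weighted_shift g j) (ell2_basis [])) \<beta>
      = (if \<beta> = [j] then ell2_coord v [j] else 0)"
      by (simp add: scaleC_op_apply weighted_shift_vacuum[OF g(1)])
  qed
  have Rj: "ell2_coord (R (ell2_basis [])) [j] = ell2_coord v [j]" for j
    unfolding vj by simp
  have RT: "ell2_coord (inverse_map R (ell2_basis [])) [i] = 1 / of_real (sqrt (f [i]))"
  proof -
    have "ell2_coord (inverse_map R (ell2_basis [])) [i] = ell2_coord (inverse_map T (ell2_basis [])) [i]"
      by (simp add: inv.linear_part_image[OF inv_vac] R T Rj v_def)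
    also have "inverse_map T = weighted_shift f i" by (simp add: T_def domain_algebra_shift)
    finally show ?thesis by (simp add: weighted_shift_vacuum[OF f(1)])
  qed
  define \<delta> where "\<delta> = (\<Sum>j\<in>UNIV. (cmod (ell2_coord v [j]))\<^sup>2)"
  have d0: "\<delta> \<ge> 0" unfolding \<delta>_def by (intro sum_nonneg) auto
  have fi: "f [i] > 0" by (rule coeffs)
  have "1 / sqrt (f [i]) = cmod (ell2_coord (inverse_map R (ell2_basis [])) [i])"
    using fi by (simp add: RT norm_divide)
  also have "\<dots> \<le> norm (inverse_map R (ell2_basis []))" by (rule norm_ell2_coord_le)
  also have "\<dots> \<le> norm (inverse_map R)" using norm_blinfun[of "inverse_map R" "ell2_basis []"] by simp
  also have "\<dots> = norm R" by (rule ci_isomorphism_norm[OF inv.iso R])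
  also have "\<dots> \<le> sqrt \<delta>" unfolding R_def \<delta>_def by (rule row_contraction_linear[OF g])
  finally have "(1 / sqrt (f [i]))\<^sup>2 \<le> (sqrt \<delta>)\<^sup>2"
    using fi by (intro power_mono) auto
  then have lower: "1 / f [i] \<le> \<delta>"
    using fi d0 by (simp add: power_divide)
  have "norm v \<le> norm T" using norm_blinfun[of T "ell2_basis []"] by (simp add: v_def)
  also have "norm T = norm (weighted_shift f i)"
    unfolding T_def by (rule ci_isomorphism_norm[OF iso domain_algebra_shift])
  also have "\<dots> \<le> 1 / sqrt (f [i])"
  proof -
    have "norm (\<Sum>k\<in>UNIV. scaleC_op ((if k = i then 1 / of_real (sqrt (f [i])) else 0) * of_real (sqrt (f [k]))) (weighted_shift f k))
       \<le> sqrt (\<Sum>k\<in>UNIV. (cmod (if k = i then 1 / of_real (sqrt (f [i])) else 0))\<^sup>2)"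
      by (rule row_contraction_linear[OF f])
    moreover have "(\<Sum>k\<in>UNIV. scaleC_op ((if k = i then 1 / of_real (sqrt (f [i])) else 0) * of_real (sqrt (f [k]))) (weighted_shift f k))
       = (\<Sum>k\<in>UNIV. if k = i then weighted_shift f i else 0)"
      using fi by (intro sum.cong) auto
    moreover have "(\<Sum>k\<in>UNIV. (cmod (if k = i then 1 / of_real (sqrt (f [i])) else 0))\<^sup>2)
       = (\<Sum>k\<in>UNIV. if k = i then 1 / f [i] else 0)"
      using fi by (intro sum.cong) (auto simp: norm_divide power_divide)
    ultimately show ?thesis by (simp add: real_sqrt_divide)
  qed
  finally have "(norm v)\<^sup>2 \<le> (1 / sqrt (f [i]))\<^sup>2" by (rule power_mono) simp
  then have upper: "(norm v)\<^sup>2 \<le> 1 / f [i]" using fi by (simp add: power_divide)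
  have rest: "ell2_coord v \<beta> = 0" if "\<beta> \<notin> range (\<lambda>j. [j])" for \<beta>
  proof -
    have "sum (\<lambda>\<beta>. (cmod (ell2_coord v \<beta>))\<^sup>2) (insert \<beta> (range (\<lambda>j. [j]))) \<le> (norm v)\<^sup>2"
      by (rule finite_sum_le_has_sum[OF norm_ell2_power2]) auto
    also have "sum (\<lambda>\<beta>. (cmod (ell2_coord v \<beta>))\<^sup>2) (insert \<beta> (range (\<lambda>j. [j])))
       = (cmod (ell2_coord v \<beta>))\<^sup>2 + \<delta>"
      using that by (simp add: \<delta>_def sum.reindex inj_on_def)
    finally have "(cmod (ell2_coord v \<beta>))\<^sup>2 \<le> 0" using lower upper by linarith
    then show ?thesis by simp
  qed
  have "T = R"
  proof (rule domain_algebra_eqI[OF g(1) T R], rule ell2_eqI)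
    fix \<beta>
    show "ell2_coord (T (ell2_basis [])) \<beta> = ell2_coord (R (ell2_basis [])) \<beta>"
    proof (cases "\<beta> \<in> range (\<lambda>j. [j])")
      case True
      then show ?thesis using Rj by (auto simp: v_def)
    next
      case False
      then have "ell2_coord (R (ell2_basis [])) \<beta> = 0" unfolding vj by (intro sum.neutral) auto
      then show ?thesis using rest[OF False] by (simp add: v_def)
    qed
  qed
  then show ?thesis unfolding T_def R_def v_def .
qed

end

text \<open>Scaling each letter by its own coefficient turns the plain sum of the letters into
  \<open>f\<close>, and the scalar domain of that sum is the interior of the closed unit
  ball.\<close>

lemma linear_series_spherical:
  fixes f :: "'n::finite series"
  assumes f: "regular_positive f" and lin: "\<And>\<alpha>. length \<alpha> \<ge> 2 \<Longrightarrow> f \<alpha> = 0"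
  shows "spherical f"
  unfolding spherical_def
proof (intro exI conjI)
  define g :: "'n series" where "g \<alpha> = (if length \<alpha> = 1 then 1 else 0)" for \<alpha>
  have fin: "finite (range (\<lambda>i :: 'n. [i]))" by simp
  have supp: "g \<alpha> = 0" if "\<alpha> \<notin> range (\<lambda>i. [i])" for \<alpha>
    using that by (auto simp: g_def length_Suc_conv)
  show "regular_positive g"
    unfolding regular_positive_def
  proof (intro conjI)
    show "bdd_above ((\<lambda>k. root k \<bar>\<Sum>\<alpha> | length \<alpha> = k. (g \<alpha>)\<^sup>2\<bar>) ` {1..})"
    proof (rule bdd_aboveI2)
      fix k :: nat assume "k \<in> {1..}"
      show "root k \<bar>\<Sum>\<alpha> | length \<alpha> = k. (g \<alpha>)\<^sup>2\<bar> \<le> \<bar>\<Sum>\<alpha> | length \<alpha> = 1. (g \<alpha>)\<^sup>2\<bar>"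
      proof (cases "k = 1")
        case False
        then have "(\<Sum>\<alpha> | length \<alpha> = k. (g \<alpha>)\<^sup>2) = 0" by (intro sum.neutral) (auto simp: g_def)
        then show ?thesis by simp
      qed simp
    qed
  qed (auto simp: g_def)
  show "perm_rescale_equiv f g"
    unfolding perm_rescale_equiv_def
  proof (intro exI conjI)
    show "bij (id :: 'n \<Rightarrow> 'n)" by simp
    show "\<forall>i. f [i] > 0" using f by (simp add: regular_positive_def)
    \<comment> \<open>Rescaling acts on coefficients linearly, so the factor is \<open>f [i]\<close>
      and not its square root.\<close>
    show "rescale_permute id (\<lambda>i. f [i]) g = f"
    proof
      fix \<beta>
      have "rescale_permute id (\<lambda>i. f [i]) g \<beta> = prod_list (map (\<lambda>i. f [i]) \<beta>) * g \<beta>"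
        by (simp add: rescale_permute_def)
      also have "\<dots> = f \<beta>"
      proof (cases "length \<beta> = 1")
        case True
        then show ?thesis by (auto simp: g_def length_Suc_conv)
      next
        case False
        then have "f \<beta> = 0" using f lin[of \<beta>] by (cases "\<beta> = []") (auto simp: regular_positive_def Suc_le_eq numeral_2_eq_2 neq_Nil_conv)
        then show ?thesis using False by (simp add: g_def)
      qed
      finally show "rescale_permute id (\<lambda>i. f [i]) g \<beta> = f \<beta>" .
    qed
  qed
  have sums: "((\<lambda>\<alpha>. g \<alpha> * (cmod (prod_list (map (($) z) \<alpha>)))\<^sup>2) has_sum (\<Sum>i\<in>UNIV. (cmod (z $ i))\<^sup>2)) UNIV"
    for z :: "complex ^ 'n"
  proof (rule has_sum_finite_neutralI[OF fin])
    show "(\<Sum>i\<in>UNIV. (cmod (z $ i))\<^sup>2) = (\<Sum>\<alpha>\<in>range (\<lambda>i. [i]). g \<alpha> * (cmod (prod_list (map (($) z) \<alpha>)))\<^sup>2)"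
      by (subst sum.reindex) (auto simp: inj_on_def g_def)
  qed (auto simp: supp)
  have norm: "(norm z)\<^sup>2 = (\<Sum>i\<in>UNIV. (cmod (z $ i))\<^sup>2)" for z :: "complex ^ 'n"
    by (simp add: norm_vec_def L2_set_def sum_nonneg)
  have "scalar_domain g = interior {z. (\<Sum>i\<in>UNIV. (cmod (z $ i))\<^sup>2) \<le> 1}"
    unfolding scalar_domain_def using has_sum_imp_summable[OF sums] infsumI[OF sums] by simp
  also have "{z :: complex ^ 'n. (\<Sum>i\<in>UNIV. (cmod (z $ i))\<^sup>2) \<le> 1} = cball 0 1"
    unfolding norm[symmetric] by (auto simp: abs_square_le_1)
  also have "interior (cball 0 1) = ball (0 :: complex ^ 'n) 1" by (rule interior_cball)
  also have "ball (0 :: complex ^ 'n) 1 = {z. (\<Sum>i\<in>UNIV. (cmod (z $ i))\<^sup>2) < 1}"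
    unfolding norm[symmetric] by (auto simp: abs_square_less_1)
  finally show "scalar_domain g = {z. (\<Sum>i\<in>UNIV. (cmod (z $ i))\<^sup>2) < 1}" .
qed

theorem theorem2p15:
  fixes f g :: "'n::finite series"
    and \<Phi> :: "'n list op \<Rightarrow> 'n list op"
  assumes "regular_positive f" and "free_polynomial f"
    and "regular_positive g" and "free_polynomial g"
    and "aspherical f"
    and "ci_isomorphism (domain_algebra f) (domain_algebra g) \<Phi>"
  shows "dual_map f g \<Phi> 0 = 0 \<and>
    (\<exists>M :: complex ^ 'n ^ 'n. \<forall>i.
       \<Phi> (weighted_shift f i) = (\<Sum>j\<in>UNIV. scaleC_op (M $ i $ j) (weighted_shift g j)))"
proof -
  interpret domain_isomorphism f g \<Phi> by unfold_locales (fact assms)+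
  obtain \<gamma> where "f \<gamma> \<noteq> 0" "length \<gamma> \<ge> 2"
    using linear_series_spherical[OF assms(1)] assms(5) by blast
  then have 0: "point_map 0 = 0" by (rule point_map_0)
  have "dual_map f g \<Phi> 0 = point_map 0"
    unfolding dual_map_def point_map_def by (simp add: point_eval_0[OF assms(3,4)] domain_algebra_shift)
  moreover have "\<forall>i. \<Phi> (weighted_shift f i) = (\<Sum>j\<in>UNIV. scaleC_op
    ((\<chi> i j. ell2_coord (\<Phi> (weighted_shift f i) (ell2_basis [])) [j] * of_real (sqrt (g [j]))) $ i $ j)
    (weighted_shift g j))"
    using image_of_shift_linear[OF 0] by simp
  ultimately show ?thesis unfolding 0 by (intro conjI exI)
qed

end
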